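(* Let $k$ be a field, $r\ge1$, and let $\mathcal X\subset\mathbb Z^r$ be a Cubist subset. Then the algebra $U_{\mathcal X}$ is symmetric; that is, there exists an associative, symmetric, non-degenerate $k$-bilinear form on $U_{\mathcal X}$.
   Context: $\epsilon_1,\dots,\epsilon_r$ is the standard basis of $\mathbb Z^r$; $x\le y$ means $y-x$ has nonnegative coordinates; $x[n]=x+n(\epsilon_1+\cdots+\epsilon_r)$. A subset $\mathcal X\subset\mathbb Z^r$ is Cubist if $\mathcal X=\mathcal X^-\setminus\mathcal X^-[-1]$ for some nonempty proper ideal (down-closed subset) $\mathcal X^-$ of $(\mathbb Z^r,\le)$. Paths in quivers are composed from left to right. $U_r$ is the $k$-algebra given by the quiver with vertices (idempotents) $e_x$, $x\in\mathbb Z^r$, arrows $a_{x,i}$ from $x$ to $x+\epsilon_i$ and $b_{x,i}$ from $x$ to $x-\epsilon_i$ ($1\le i\le r$), with relations, for all $x$: $a_{x,i}a_{x+\epsilon_i,i}=0$ and $b_{x,i}b_{x-\epsilon_i,i}=0$; for $i\neq j$: $a_{x,i}a_{x+\epsilon_i,j}+a_{x,j}a_{x+\epsilon_j,i}=0$, $b_{x,i}b_{x-\epsilon_i,j}+b_{x,j}b_{x-\epsilon_j,i}=0$, $a_{x,i}b_{x+\epsilon_i,j}+b_{x,j}a_{x-\epsilon_j,i}=0$; and for $1\le i<r$: $b_{x,i}a_{x-\epsilon_i,i}+a_{x,i}b_{x+\epsilon_i,i}=b_{x,i+1}a_{x-\epsilon_{i+1},i+1}+a_{x,i+1}b_{x+\epsilon_{i+1},i+1}$.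 Put $U_{\mathcal X}=U_r/\sum_{x\in\mathbb Z^r\setminus\mathcal X}U_re_xU_r$ (in general an infinite-dimensional algebra without unit, but with local idempotents $e_x$, $x\in\mathcal X$). A bilinear form $(\,,)$ on an algebra $A$ is associative if $(ab,c)=(a,bc)$ for all $a,b,c\in A$. *)

theory Defs
  imports "HOL-Library.Poly_Mapping" "Graph_Theory.Arc_Walk"
begin

section \<open>Algebras without unit\<close>

text \<open>The ring locales of HOL-Algebra presuppose a unit element, which the algebras below
  do not have. Hence a separate record for algebras over a field, not necessarily unital.\<close>

record ('k, 'a) nu_algebra =
  alg_carrier :: "'a set"
  alg_zero :: 'a
  alg_add :: "'a \<Rightarrow> 'a \<Rightarrow> 'a"
  alg_scale :: "'k \<Rightarrow> 'a \<Rightarrow> 'a"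
  alg_mult :: "'a \<Rightarrow> 'a \<Rightarrow> 'a"

definition alg_subspace :: "('k, 'a) nu_algebra \<Rightarrow> 'a set \<Rightarrow> bool" where
  "alg_subspace A V \<longleftrightarrow>
     V \<subseteq> alg_carrier A \<and> alg_zero A \<in> V \<and>
     (\<forall>x\<in>V. \<forall>y\<in>V. alg_add A x y \<in> V) \<and>
     (\<forall>c. \<forall>x\<in>V. alg_scale A c x \<in> V)"

definition alg_span :: "('k, 'a) nu_algebra \<Rightarrow> 'a set \<Rightarrow> 'a set" where
  "alg_span A S = \<Inter> {V. alg_subspace A V \<and> S \<subseteq> V}"

definition alg_ideal :: "('k, 'a) nu_algebra \<Rightarrow> 'a set \<Rightarrow> bool" where
  "alg_ideal A I \<longleftrightarrow>
     alg_subspace A I \<and>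
     (\<forall>a\<in>alg_carrier A. \<forall>x\<in>I. alg_mult A a x \<in> I \<and> alg_mult A x a \<in> I)"

definition alg_genideal :: "('k, 'a) nu_algebra \<Rightarrow> 'a set \<Rightarrow> 'a set" where
  "alg_genideal A S = \<Inter> {I. alg_ideal A I \<and> S \<subseteq> I}"

definition alg_coset :: "('k, 'a) nu_algebra \<Rightarrow> 'a set \<Rightarrow> 'a \<Rightarrow> 'a set" where
  "alg_coset A I a = alg_add A a ` I"

text \<open>The elements of the quotient algebra are the cosets of the ideal. As in the ring
  quotient of HOL-Algebra, operations on cosets are unions over all representatives; for an
  ideal, all the cosets in such a union coincide.\<close>

definition alg_quotient :: "('k, 'a) nu_algebra \<Rightarrow> 'a set \<Rightarrow> ('k, 'a set) nu_algebra" where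
  "alg_quotient A I =
     \<lparr> alg_carrier = alg_coset A I ` alg_carrier A,
       alg_zero = alg_coset A I (alg_zero A),
       alg_add = (\<lambda>X Y. \<Union>x\<in>X. \<Union>y\<in>Y. alg_coset A I (alg_add A x y)),
       alg_scale = (\<lambda>c X. \<Union>x\<in>X. alg_coset A I (alg_scale A c x)),
       alg_mult = (\<lambda>X Y. \<Union>x\<in>X. \<Union>y\<in>Y. alg_coset A I (alg_mult A x y)) \<rparr>"


section \<open>Symmetric algebras\<close>

text \<open>Only the values of a form on the carrier matter.\<close>

definition alg_bilinear_form ::
    "('k::field, 'a) nu_algebra \<Rightarrow> ('a \<Rightarrow> 'a \<Rightarrow> 'k) \<Rightarrow> bool" where
  "alg_bilinear_form A B \<longleftrightarrow>
     (\<forall>a\<in>alg_carrier A. \<forall>b\<in>alg_carrier A. \<forall>c\<in>alg_carrier A.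
        B (alg_add A a b) c = B a c + B b c \<and> B a (alg_add A b c) = B a b + B a c) \<and>
     (\<forall>t. \<forall>a\<in>alg_carrier A. \<forall>b\<in>alg_carrier A.
        B (alg_scale A t a) b = t * B a b \<and> B a (alg_scale A t b) = t * B a b)"

definition alg_associative_form ::
    "('k::field, 'a) nu_algebra \<Rightarrow> ('a \<Rightarrow> 'a \<Rightarrow> 'k) \<Rightarrow> bool" where
  "alg_associative_form A B \<longleftrightarrow>
     (\<forall>a\<in>alg_carrier A. \<forall>b\<in>alg_carrier A. \<forall>c\<in>alg_carrier A.
        B (alg_mult A a b) c = B a (alg_mult A b c))"

definition alg_symmetric_form ::
    "('k::field, 'a) nu_algebra \<Rightarrow> ('a \<Rightarrow> 'a \<Rightarrow> 'k) \<Rightarrow> bool" where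
  "alg_symmetric_form A B \<longleftrightarrow>
     (\<forall>a\<in>alg_carrier A. \<forall>b\<in>alg_carrier A. B a b = B b a)"

definition alg_nondegenerate_form ::
    "('k::field, 'a) nu_algebra \<Rightarrow> ('a \<Rightarrow> 'a \<Rightarrow> 'k) \<Rightarrow> bool" where
  "alg_nondegenerate_form A B \<longleftrightarrow>
     (\<forall>a\<in>alg_carrier A. (\<forall>b\<in>alg_carrier A. B a b = 0) \<longrightarrow> a = alg_zero A) \<and>
     (\<forall>b\<in>alg_carrier A. (\<forall>a\<in>alg_carrier A. B a b = 0) \<longrightarrow> b = alg_zero A)"

definition symmetric_algebra :: "('k::field, 'a) nu_algebra \<Rightarrow> bool" where
  "symmetric_algebra A \<longleftrightarrow>
     (\<exists>B. alg_bilinear_form A B \<and> alg_associative_form A B \<and>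
          alg_symmetric_form A B \<and> alg_nondegenerate_form A B)"


section \<open>Path algebras\<close>

text \<open>A path is a pair of its initial vertex and the list of its arrows, in the order in
  which they are traversed, so that products of paths are composed from left to right. The
  initial vertex distinguishes the trivial paths.\<close>

type_synonym ('v, 'e) qpath = "'v \<times> 'e list"

definition qpaths :: "('v, 'e) pre_digraph \<Rightarrow> ('v, 'e) qpath set" where
  "qpaths Q = {(u, p). \<exists>v. pre_digraph.awalk Q u p v}"

definition path_mult ::
    "('v, 'e) pre_digraph \<Rightarrow> (('v, 'e) qpath \<Rightarrow>\<^sub>0 'k::field) \<Rightarrow> (('v, 'e) qpath \<Rightarrow>\<^sub>0 'k) \<Rightarrow>
      (('v, 'e) qpath \<Rightarrow>\<^sub>0 'k)" where
  "path_mult Q f g =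
     (\<Sum>(u, p)\<in>Poly_Mapping.keys f. \<Sum>(v, q)\<in>Poly_Mapping.keys g.
        if pre_digraph.awlast Q u p = v
        then Poly_Mapping.single (u, p @ q)
               (Poly_Mapping.lookup f (u, p) * Poly_Mapping.lookup g (v, q))
        else 0)"

definition path_algebra ::
    "('v, 'e) pre_digraph \<Rightarrow> ('k::field, ('v, 'e) qpath \<Rightarrow>\<^sub>0 'k) nu_algebra" where
  "path_algebra Q =
     \<lparr> alg_carrier = {f. Poly_Mapping.keys f \<subseteq> qpaths Q},
       alg_zero = 0,
       alg_add = (+),
       alg_scale = (\<lambda>c. Poly_Mapping.map ((*) c)),
       alg_mult = path_mult Q \<rparr>"


section \<open>The lattice and Cubist subsets\<close>

text \<open>A vector in $\mathbb{Z}^r$ is a function that vanishes outside the index set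
  $\{1,\dots,r\}$. On such functions the pointwise order of function spaces is the
  coordinatewise order.\<close>

definition Zlat :: "nat \<Rightarrow> (nat \<Rightarrow> int) set" where
  "Zlat r = {x. \<forall>i. i \<notin> {1..r} \<longrightarrow> x i = 0}"

definition inc :: "nat \<Rightarrow> (nat \<Rightarrow> int) \<Rightarrow> (nat \<Rightarrow> int)" where
  "inc i x = x(i := x i + 1)"

definition dec :: "nat \<Rightarrow> (nat \<Rightarrow> int) \<Rightarrow> (nat \<Rightarrow> int)" where
  "dec i x = x(i := x i - 1)"

definition shift :: "nat \<Rightarrow> int \<Rightarrow> (nat \<Rightarrow> int) \<Rightarrow> (nat \<Rightarrow> int)" where
  "shift r n x = (\<lambda>i. if i \<in> {1..r} then x i + n else 0)"

definition down_closed :: "nat \<Rightarrow> (nat \<Rightarrow> int) set \<Rightarrow> bool" where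
  "down_closed r D \<longleftrightarrow> D \<subseteq> Zlat r \<and> (\<forall>x\<in>D. \<forall>y\<in>Zlat r. y \<le> x \<longrightarrow> y \<in> D)"

definition cubist :: "nat \<Rightarrow> (nat \<Rightarrow> int) set \<Rightarrow> bool" where
  "cubist r X \<longleftrightarrow>
     (\<exists>D. down_closed r D \<and> D \<noteq> {} \<and> D \<noteq> Zlat r \<and> X = D - shift r (- 1) ` D)"


section \<open>The algebras U\<close>

datatype arrow = ArrA "nat \<Rightarrow> int" nat | ArrB "nat \<Rightarrow> int" nat

fun arrow_source :: "arrow \<Rightarrow> nat \<Rightarrow> int" where
  "arrow_source (ArrA x i) = x"
| "arrow_source (ArrB x i) = x"

fun arrow_target :: "arrow \<Rightarrow> nat \<Rightarrow> int" where
  "arrow_target (ArrA x i) = inc i x"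
| "arrow_target (ArrB x i) = dec i x"

definition U_quiver :: "nat \<Rightarrow> (nat \<Rightarrow> int, arrow) pre_digraph" where
  "U_quiver r =
     \<lparr> verts = Zlat r,
       arcs = {ArrA x i | x i. x \<in> Zlat r \<and> i \<in> {1..r}} \<union>
              {ArrB x i | x i. x \<in> Zlat r \<and> i \<in> {1..r}},
       tail = arrow_source,
       head = arrow_target \<rparr>"

type_synonym 'k U_path_elem = "(nat \<Rightarrow> int, arrow) qpath \<Rightarrow>\<^sub>0 'k"

definition path_a :: "(nat \<Rightarrow> int) \<Rightarrow> nat \<Rightarrow> 'k::field U_path_elem" where
  "path_a x i = Poly_Mapping.single (x, [ArrA x i]) 1"

definition path_b :: "(nat \<Rightarrow> int) \<Rightarrow> nat \<Rightarrow> 'k::field U_path_elem" where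
  "path_b x i = Poly_Mapping.single (x, [ArrB x i]) 1"

definition path_e :: "(nat \<Rightarrow> int) \<Rightarrow> 'k::field U_path_elem" where
  "path_e x = Poly_Mapping.single (x, []) 1"

text \<open>An equation between two elements is recorded as the difference of its sides.\<close>

definition U_relations :: "nat \<Rightarrow> 'k::field U_path_elem set" where
  "U_relations r =
     (let m = path_mult (U_quiver r) in
      {m (path_a x i) (path_a (inc i x) i) | x i. x \<in> Zlat r \<and> i \<in> {1..r}} \<union>
      {m (path_b x i) (path_b (dec i x) i) | x i. x \<in> Zlat r \<and> i \<in> {1..r}} \<union>
      {m (path_a x i) (path_a (inc i x) j) + m (path_a x j) (path_a (inc j x) i) | x i j.
         x \<in> Zlat r \<and> i \<in> {1..r} \<and> j \<in> {1..r} \<and> i \<noteq> j} \<union>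
      {m (path_b x i) (path_b (dec i x) j) + m (path_b x j) (path_b (dec j x) i) | x i j.
         x \<in> Zlat r \<and> i \<in> {1..r} \<and> j \<in> {1..r} \<and> i \<noteq> j} \<union>
      {m (path_a x i) (path_b (inc i x) j) + m (path_b x j) (path_a (dec j x) i) | x i j.
         x \<in> Zlat r \<and> i \<in> {1..r} \<and> j \<in> {1..r} \<and> i \<noteq> j} \<union>
      {(m (path_b x i) (path_a (dec i x) i) + m (path_a x i) (path_b (inc i x) i)) -
       (m (path_b x (i + 1)) (path_a (dec (i + 1) x) (i + 1)) +
        m (path_a x (i + 1)) (path_b (inc (i + 1) x) (i + 1))) | x i.
         x \<in> Zlat r \<and> 1 \<le> i \<and> i < r})"

definition U_ideal :: "nat \<Rightarrow> 'k::field U_path_elem set" where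
  "U_ideal r = alg_genideal (path_algebra (U_quiver r)) (U_relations r)"

definition U_alg :: "nat \<Rightarrow> ('k::field, 'k U_path_elem set) nu_algebra" where
  "U_alg r = alg_quotient (path_algebra (U_quiver r)) (U_ideal r)"

definition U_e :: "nat \<Rightarrow> (nat \<Rightarrow> int) \<Rightarrow> 'k::field U_path_elem set" where
  "U_e r x = alg_coset (path_algebra (U_quiver r)) (U_ideal r) (path_e x)"

text \<open>The sum over $x \in \mathbb{Z}^r \setminus X$ of the two-sided ideals $U e_x U$, where
  $U e_x U$ denotes the linear span of the products $u e_x v$; a sum of spans is the span of
  the union.\<close>

definition U_vertex_ideal ::
    "nat \<Rightarrow> (nat \<Rightarrow> int) set \<Rightarrow> 'k::field U_path_elem set set" where
  "U_vertex_ideal r X =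
     alg_span (U_alg r)
       (\<Union>x\<in>Zlat r - X.
          {alg_mult (U_alg r) (alg_mult (U_alg r) u (U_e r x)) v | u v.
             u \<in> alg_carrier (U_alg r) \<and> v \<in> alg_carrier (U_alg r)})"

definition U_cubist ::
    "nat \<Rightarrow> (nat \<Rightarrow> int) set \<Rightarrow> ('k::field, 'k U_path_elem set set) nu_algebra" where
  "U_cubist r X = alg_quotient (U_alg r) (U_vertex_ideal r X)"

end

theory Submission
  imports Defs
begin

text \<open>
  Rescale the arrows by signs so that the relations of $U_r$ say: letters with distinct indices
  commute, a repeated letter is zero, and the loop $c = a_i b_i + b_i a_i$ does not depend on $i$.
  For every unit cube $z + \{0,1\}^r$, mapping a path to $1$ if all its vertices lie in the cube
  and to $0$ otherwise respects these relations. The form is $(p, q) = t(pq)$, where $t$ sends a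
  closed path of length $2(r-1)$ to the sum of $(-1)^{|z|}$ over the cubes $z + \{0,1\}^r$ that
  contain the path and satisfy $z[1] \in \mathcal X^-$. For the cubes around a vertex outside
  $\mathcal X$, this last condition holds always or never, and the sum of the signs is zero
  because a closed path of length $2(r-1)$ leaves some coordinate unchanged.

  For the non-degeneracy, let $R$ be the set of the coordinates in which $x$ and $y$ agree. The
  paths of a given length from $x$ to $y$ reduce to normal forms, which the cubes evaluate to the
  polynomials of some degree at most $d$ on $\{0,1\}^R$. If $f$ lies in the radical of the form
  and $g$ is the indicator function of the cubes with $z[1] \in \mathcal X^-$, the product of $g$
  with the polynomial $\varphi$ of $f$ still has degree at most $d$. By Moebius inversion
  $g\varphi$ and $(1-g)\varphi$ are combinations of monomials that belong to paths through
  vertices outside $\mathcal X$. Hence every linear functional that vanishes on the relations and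
  on these paths vanishes on $f$, so $f$ is zero in the quotient.
\<close>

section \<open>Functionals that respect the relations\<close>

text \<open>The length 2(r-1) is forced from two sides. A closed path that moves in every coordinate
  has length at least 2r, and closed paths have even length; so 2(r-1) is the greatest length at
  which some coordinate always stays unchanged. Conversely, take paths from x to y of polynomial
  degree at most d and a return path that leaves exactly the coordinates in U \<subseteq> R of the
  surrounding cubes free. Summing over these cubes gives, up to sign, the coefficient of g\<phi> at
  the monomial of U, and the two lengths add up to 2(r + d - |U|). This is at most 2(r-1) if and
  only if |U| > d, and loops fill the gap. Thus the radical condition says that g\<phi> has no
  coefficients above degree d.

  No basis of U_r or of its quotient is constructed. Normal forms serve only as a spanning set, and
  all elements are tested on functionals on words. The linear relation between normal forms that
  matters, a loop being the sum of its two halves, becomes the identity 1 = z_i + (1 - z_i) of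
  polynomials.\<close>

text \<open>The letter $(i, \mathrm{True})$ stands for $a_i$ and $(i, \mathrm{False})$ for $b_i$.\<close>

type_synonym word = "(nat \<times> bool) list"

definition step :: "nat \<times> bool \<Rightarrow> (nat \<Rightarrow> int) \<Rightarrow> (nat \<Rightarrow> int)" where
  "step l x = (if snd l then inc (fst l) x else dec (fst l) x)"

definition endp :: "(nat \<Rightarrow> int) \<Rightarrow> word \<Rightarrow> (nat \<Rightarrow> int)" where
  "endp x w = fold step w x"

lemma endp_simps [simp]:
  "endp x [] = x" "endp x (l # w) = endp (step l x) w" "endp x (u @ v) = endp (endp x u) v"
  by (simp_all add: endp_def)

definition valid :: "nat \<Rightarrow> word \<Rightarrow> bool" where
  "valid r w \<longleftrightarrow> fst ` set w \<subseteq> {1..r}"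

lemma valid_simps [simp]:
  "valid r []" "valid r (l # w) \<longleftrightarrow> fst l \<in> {1..r} \<and> valid r w"
  "valid r (u @ v) \<longleftrightarrow> valid r u \<and> valid r v"
  by (auto simp: valid_def)

text \<open>The relations after the rescaling of the arrows by \<open>wsign\<close> below, hence without signs.\<close>

definition compat :: "nat \<Rightarrow> (word \<Rightarrow> 'k::comm_ring_1) \<Rightarrow> bool" where
  "compat r f \<longleftrightarrow>
     (\<forall>u v l. f (u @ l # l # v) = 0) \<and>
     (\<forall>u v l l'. fst l \<noteq> fst l' \<longrightarrow> f (u @ l # l' # v) = f (u @ l' # l # v)) \<and>
     (\<forall>u v i j. i \<in> {1..r} \<longrightarrow> j \<in> {1..r} \<longrightarrow>
        f (u @ (i, True) # (i, False) # v) + f (u @ (i, False) # (i, True) # v) =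
        f (u @ (j, True) # (j, False) # v) + f (u @ (j, False) # (j, True) # v))"

lemma compatI:
  assumes "\<And>u v l. f (u @ l # l # v) = 0"
    and "\<And>u v l l'. fst l \<noteq> fst l' \<Longrightarrow> f (u @ l # l' # v) = f (u @ l' # l # v)"
    and "\<And>u v i j. i \<in> {1..r} \<Longrightarrow> j \<in> {1..r} \<Longrightarrow>
      f (u @ (i, True) # (i, False) # v) + f (u @ (i, False) # (i, True) # v) =
      f (u @ (j, True) # (j, False) # v) + f (u @ (j, False) # (j, True) # v)"
  shows "compat r f"
  unfolding compat_def by (intro conjI allI impI) (rule assms; assumption)+

lemma compat_square: "compat r f \<Longrightarrow> f (u @ l # l # v) = 0"
  and compat_swap: "compat r f \<Longrightarrow> fst l \<noteq> fst l' \<Longrightarrow> f (u @ l # l' # v) = f (u @ l' # l # v)"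
  and compat_loop: "compat r f \<Longrightarrow> i \<in> {1..r} \<Longrightarrow> j \<in> {1..r} \<Longrightarrow>
    f (u @ (i, True) # (i, False) # v) + f (u @ (i, False) # (i, True) # v) =
    f (u @ (j, True) # (j, False) # v) + f (u @ (j, False) # (j, True) # v)"
  unfolding compat_def by blast+

text \<open>The relations are closed under multiplication from both sides, so a fixed prefix can be
  absorbed into the functional. Inductions along a word therefore run over all compatible
  functionals at once.\<close>

lemma compat_prefix:
  assumes "compat r f"
  shows "compat r (\<lambda>w. f (p @ w))"
proof (rule compatI)
  fix u v i j assume "i \<in> {1..r}" "j \<in> {1..r}"
  then show "f (p @ u @ (i, True) # (i, False) # v) + f (p @ u @ (i, False) # (i, True) # v) =
    f (p @ u @ (j, True) # (j, False) # v) + f (p @ u @ (j, False) # (j, True) # v)"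
    using compat_loop[OF assms, of i j "p @ u" v] by (simp only: append_assoc)
next
  fix u v and l l' :: "nat \<times> bool" assume "fst l \<noteq> fst l'"
  from compat_swap[OF assms this, of "p @ u" v]
  show "f (p @ u @ l # l' # v) = f (p @ u @ l' # l # v)" unfolding append_assoc .
next
  fix u v and l :: "nat \<times> bool"
  show "f (p @ u @ l # l # v) = 0"
    using compat_square[OF assms, of "p @ u" l v] by (simp only: append_assoc)
qed

text \<open>The action of the central element $a_1 b_1 + b_1 a_1$; by \<open>compat_central\<close> below, it may be
  inserted anywhere and with any index.\<close>

definition loop_op :: "(word \<Rightarrow> 'k::comm_ring_1) \<Rightarrow> word \<Rightarrow> 'k" where
  "loop_op f w = f ((1, True) # (1, False) # w) + f ((1, False) # (1, True) # w)"

section \<open>Centrality of the loop\<close>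

lemma compat_add:
  assumes "compat r f" "compat r g"
  shows "compat r (\<lambda>w. f w + g w)"
proof -
  have ac: "a + a' + (b + b') = c + c' + (d + d')" if "a + b = c + d" "a' + b' = c' + d'"
    for a b c d a' b' c' d' :: 'a
  proof -
    have "a + a' + (b + b') = (a + b) + (a' + b')" by (simp only: add_ac)
    also have "\<dots> = c + c' + (d + d')" unfolding that by (simp only: add_ac)
    finally show ?thesis .
  qed
  show ?thesis
  proof (rule compatI)
    fix u v i j assume "i \<in> {1..r}" "j \<in> {1..r}"
    then show "f (u @ (i, True) # (i, False) # v) + g (u @ (i, True) # (i, False) # v) +
      (f (u @ (i, False) # (i, True) # v) + g (u @ (i, False) # (i, True) # v)) =
      f (u @ (j, True) # (j, False) # v) + g (u @ (j, True) # (j, False) # v) +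
      (f (u @ (j, False) # (j, True) # v) + g (u @ (j, False) # (j, True) # v))"
      by (intro ac compat_loop[OF assms(1)] compat_loop[OF assms(2)])
  next
    fix u v and l l' :: "nat \<times> bool" assume d: "fst l \<noteq> fst l'"
    show "f (u @ l # l' # v) + g (u @ l # l' # v) = f (u @ l' # l # v) + g (u @ l' # l # v)"
      unfolding compat_swap[OF assms(1) d] compat_swap[OF assms(2) d] ..
  qed (simp add: compat_square[OF assms(1)] compat_square[OF assms(2)])
qed

lemma compat_loop_op: "compat r f \<Longrightarrow> compat r (loop_op f)"
  using compat_add[OF compat_prefix[of r f "[(1,True),(1,False)]"] compat_prefix[of r f
    "[(1,False),(1,True)]"]]
  by (simp add: loop_op_def[abs_def])

lemma compat_loop_op_pow: "compat r f \<Longrightarrow> compat r ((loop_op ^^ n) f)"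
  by (induction n) (auto intro: compat_loop_op)

lemma compat_move: "compat r f \<Longrightarrow> fst l \<notin> fst ` set u \<Longrightarrow> f (p @ l # u @ v) = f (p @ u @ l # v)"
proof (induction u arbitrary: p)
  case (Cons a u)
  have "f (p @ l # (a # u) @ v) = f ((p @ [a]) @ l # u @ v)"
    using compat_swap[OF Cons.prems(1), of l a p "u @ v"] Cons.prems(2) by simp
  also have "\<dots> = f ((p @ [a]) @ u @ l # v)"
    by (rule Cons.IH) (use Cons.prems in auto)
  finally show ?case by simp
qed simp

text \<open>If \<open>l\<close> has the index \<open>i\<close>, two of the four words contain a
  square and the other two coincide. Otherwise \<open>l\<close> commutes with both letters of the
  loop.\<close>

lemma compat_central_step:
  assumes "compat r f"
  shows "f (u @ [(i, True), (i, False), l] @ v) + f (u @ [(i, False), (i, True), l] @ v) =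
         f (u @ [l, (i, True), (i, False)] @ v) + f (u @ [l, (i, False), (i, True)] @ v)"
proof (cases "fst l = i")
  case True
  then consider "l = (i, True)" | "l = (i, False)" by (cases l; cases "snd l") auto
  then show ?thesis
    using compat_square[OF assms, of u "(i,True)" "(i,False) # v"]
      compat_square[OF assms, of u "(i,False)" "(i,True) # v"]
      compat_square[OF assms, of "u @ [(i, True)]" "(i,False)" "v"]
      compat_square[OF assms, of "u @ [(i, False)]" "(i,True)" "v"]
    by cases (auto simp: add.commute)
next
  case False
  have "f (u @ [l] @ [(i, s), (i, t)] @ v) = f (u @ [(i, s), (i, t)] @ [l] @ v)" for s t
    using compat_move[OF assms, of l "[(i, s), (i, t)]" u v] False by auto
  then show ?thesis by simp
qed

text \<open>The loop passes the letters of \<open>u\<close> one by one, from right to left. Once it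
  stands in front, \<open>compat_loop\<close> changes its index from \<open>i\<close> to 1.\<close>

lemma compat_central:
  assumes "compat r f" "i \<in> {1..r}"
  shows "f (u @ (i, True) # (i, False) # v) + f (u @ (i, False) # (i, True) # v) = loop_op f (u @ v)"
proof (induction u arbitrary: v rule: rev_induct)
  case Nil
  have "1 \<in> {1..r}" using assms(2) by auto
  then show ?case using compat_loop[OF assms, of 1 "[]" v] by (simp add: loop_op_def)
next
  case (snoc l u)
  show ?case using snoc.IH[of "l # v"] compat_central_step[OF assms(1), of u i l v] by simp
qed

section \<open>Normal forms of words\<close>

definition restrict :: "nat \<Rightarrow> word \<Rightarrow> word" where
  "restrict i w = filter (\<lambda>l. fst l = i) w"

lemma restrict_simps [simp]:
  "restrict i [] = []" "restrict i (l # w) = (if fst l = i then l # restrict i w else restrict i w)"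
  "restrict i (u @ v) = restrict i u @ restrict i v"
  by (simp_all add: restrict_def)

text \<open>As in a partially commutative monoid, a word is determined up to commutations by its
  projections to the single indices: the first letter of \<open>w\<close> is also the first letter
  of its index in \<open>w'\<close>, so it can be moved to the front there and stripped off.\<close>

lemma compat_restrict_eq:
  assumes "compat r f" "\<And>i. restrict i w = restrict i w'"
  shows "f w = f w'"
  using assms
proof (induction w arbitrary: w' f)
  case Nil
  have "w' = []"
  proof (cases w')
    case (Cons l u)
    then show ?thesis using Nil.prems(2)[of "fst l"] by simp
  qed
  then show ?case by simp
next
  case (Cons l w)
  have "restrict (fst l) w' \<noteq> []" using Cons.prems(2)[of "fst l", symmetric] by simp
  then have "\<exists>a\<in>set w'. fst a = fst l" by (simp add: restrict_def filter_empty_conv)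
  then obtain u l' v where w': "w' = u @ l' # v" "fst l' = fst l" "\<forall>a\<in>set u. fst a \<noteq> fst l"
    using split_list_first_prop[of w' "\<lambda>a. fst a = fst l"] by blast
  then have "restrict (fst l) u = []" by (simp add: restrict_def filter_empty_conv)
  with Cons.prems(2)[of "fst l"] w' have l': "l' = l" by simp
  have "restrict i w = restrict i (u @ v)" for i
    using Cons.prems(2)[of i] w' l' \<open>restrict (fst l) u = []\<close> by (auto split: if_splits)
  then have "f (l # w) = f (l # u @ v)"
    using Cons.IH[OF compat_prefix[OF Cons.prems(1), of "[l]"]] by simp
  also have "\<dots> = f w'"
  proof -
    have "fst l \<notin> fst ` set u" using w'(3) by fastforce
    from compat_move[OF Cons.prems(1) this, of "[]" v] show ?thesis using w'(1) l' by simp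
  qed
  finally show ?case .
qed

text \<open>Compatible functionals do not see the order of these letters; sorting merely picks
  one.\<close>

definition letters :: "nat set \<Rightarrow> bool \<Rightarrow> word" where
  "letters K s = map (\<lambda>i. (i, s)) (sorted_list_of_set K)"

lemma restrict_map_distinct:
  "distinct is \<Longrightarrow> restrict i (map (\<lambda>i. (i, s)) is) = (if i \<in> set is then [(i, s)] else [])"
  by (induction "is") auto

lemma restrict_letters: "finite K \<Longrightarrow> restrict i (letters K s) = (if i \<in> K then [(i, s)] else [])"
  unfolding letters_def using restrict_map_distinct[of "sorted_list_of_set K" i s] by simp

lemma valid_letters: "finite K \<Longrightarrow> valid r (letters K s) \<longleftrightarrow> K \<subseteq> {1..r}"
  by (simp add: valid_def letters_def image_image)

lemma length_letters: "finite K \<Longrightarrow> length (letters K s) = card K"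
  by (simp add: letters_def)

text \<open>The letters with index $i$ are $a$ for $i \in A$, $b$ for $i \in B$, $ba$ for $i \in S$ and
  $ab$ for $i \in T$.\<close>

definition normal_word :: "nat set \<Rightarrow> nat set \<Rightarrow> nat set \<Rightarrow> nat set \<Rightarrow> word" where
  "normal_word A B S T = letters (B \<union> S) False @ letters (A \<union> S \<union> T) True @ letters T False"

lemma restrict_normal_word:
  "finite A \<Longrightarrow> finite B \<Longrightarrow> finite S \<Longrightarrow> finite T \<Longrightarrow> restrict i (normal_word A B S T) =
    (if i \<in> B \<union> S then [(i, False)] else []) @ (if i \<in> A \<union> S \<union> T then [(i, True)] else []) @
    (if i \<in> T then [(i, False)] else [])"
  by (simp add: normal_word_def restrict_letters)

lemma endp_apply:
  "endp x w j = x j + int (count_list w (j, True)) - int (count_list w (j, False))"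
  by (induction w arbitrary: x) (auto simp: step_def inc_def dec_def)

definition disjoint4 :: "nat set \<Rightarrow> nat set \<Rightarrow> nat set \<Rightarrow> nat set \<Rightarrow> bool" where
  "disjoint4 A B S T \<longleftrightarrow> A \<inter> B = {} \<and> A \<inter> S = {} \<and> A \<inter> T = {} \<and> B \<inter> S = {} \<and> B \<inter> T = {} \<and> S \<inter> T = {}"

lemma length_eq_restrict: "valid r w \<Longrightarrow> length w = (\<Sum>i\<in>{1..r}. length (restrict i w))"
proof (induction w)
  case (Cons a w)
  have "(\<Sum>i = 1..r. length (if fst a = i then a # restrict i w else restrict i w)) =
    (\<Sum>i = 1..r. (if fst a = i then 1 else 0) + length (restrict i w))"
    by (rule sum.cong) auto
  then show ?case using Cons by (simp add: sum.distrib)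
qed simp

lemma count_list_restrict: "count_list w (j, s) = count_list (restrict j w) (j, s)"
  by (induction w) auto

lemma endp_restrict: "(\<And>i. restrict i w = restrict i w') \<Longrightarrow> endp x w = endp x w'"
  by (rule ext) (simp add: endp_apply count_list_restrict[of w] count_list_restrict[of w'])

text \<open>Of the two halves of a loop in front of \<open>(i, s)\<close>, the one ending in
  \<open>(i, s)\<close> creates a square, so the other half alone carries the value of the
  loop.\<close>

lemma compat_reduce_triple:
  assumes "compat r f" "i \<in> {1..r}"
  shows "f (u @ (i, s) # (i, \<not> s) # (i, s) # v) = loop_op f (u @ (i, s) # v)"
  using compat_central[OF assms, of u "(i,s) # v"]
    compat_square[OF assms(1), of "u @ [(i, \<not> s)]" "(i, s)" v]
  by (cases s) auto

text \<open>Only the part of the normal word with the index of \<open>l\<close> changes. Writing c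
  for the loop, multiplication by a from the left sends 1 to a, a to 0, b to ab, ba to ca and ab to
  0; multiplication by b is the mirror image.\<close>

lemma compat_normal_form_step:
  fixes A B S T :: "nat set" and l
  assumes i: "fst l \<in> {1..r}" and sub: "A \<union> B \<union> S \<union> T \<subseteq> {1..r}" and d: "disjoint4 A B S T"
  shows "(\<forall>f :: word \<Rightarrow> 'k::comm_ring_1. compat r f \<longrightarrow> f (l # normal_word A B S T) = 0) \<or>
    (\<exists>A' B' S' T' n. A' \<union> B' \<union> S' \<union> T' \<subseteq> {1..r} \<and> disjoint4 A' B' S' T' \<and>
       (\<forall>f :: word \<Rightarrow> 'k. compat r f \<longrightarrow> f (l # normal_word A B S T) =
         (loop_op ^^ n) f (normal_word A' B' S' T')) \<and>
       Suc (length (normal_word A B S T)) = 2 * n + length (normal_word A' B' S' T') \<and>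
       (\<forall>x. endp x (l # normal_word A B S T) = endp x (normal_word A' B' S' T')))"
    (is "?Z \<or> ?E")
proof -
  obtain i s where l: "l = (i, s)" by (cases l)
  have fin: "finite K" if "K \<subseteq> {Suc 0..r}" for K
    using that finite_subset by blast
  have f4: "finite A" "finite B" "finite S" "finite T" using sub by (auto intro: fin)
  have fm: "f (l # normal_word A B S T) = f w'" if "compat r f"
    "\<And>j. restrict j (l # normal_word A B S T) = restrict j w'" for f :: "word \<Rightarrow> 'k" and w'
    using compat_restrict_eq[OF that] .
  \<comment> \<open>The result is a normal word up to commutations, and no loop splits off.\<close>
  have easy: ?E if s': "A' \<union> B' \<union> S' \<union> T' \<subseteq> {1..r}" "disjoint4 A' B' S' T'" and
    p: "\<And>j. restrict j (l # normal_word A B S T) = restrict j (normal_word A' B' S' T')" for A' B' S' T'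
  proof -
    have "finite A'" "finite B'" "finite S'" "finite T'" using s' by (auto intro: fin)
    then have vv: "valid r (l # normal_word A B S T)" "valid r (normal_word A' B' S' T')"
      using s' sub i f4 by (auto simp: normal_word_def valid_letters)
    have "length (l # normal_word A B S T) = length (normal_word A' B' S' T')"
      unfolding length_eq_restrict[OF vv(1)] length_eq_restrict[OF vv(2)] p ..
    then show ?thesis using s' endp_restrict[OF p] fm[OF _ p]
      by (intro disjI2 exI[of _ A'] exI[of _ B'] exI[of _ S'] exI[of _ T'] exI[of _ "0::nat"]) auto
  qed
  \<comment> \<open>Up to commutations the word begins with a square.\<close>
  have zero: ?Z if p: "\<And>j. restrict j (l # normal_word A B S T) = restrict j ([l,l] @ w')" for w'
    using fm[OF _ p] compat_square[where u = "[]"] by (metis append_Cons append_Nil)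
  \<comment> \<open>Three alternating letters of index \<open>i\<close> shrink to one and release
    one loop, hence \<open>n = 1\<close>.\<close>
  have triple: ?E if s': "A' \<union> B' \<union> S' \<union> T' \<subseteq> {1..r}" "disjoint4 A' B' S' T'" and
    p: "\<And>j. restrict j (l # normal_word A B S T) = restrict j ([(i, s), (i, \<not> s), (i, s)] @ w')" and
    q: "\<And>j. restrict j (normal_word A' B' S' T') = restrict j ([(i, s)] @ w')" and v: "valid r w'"
    for A' B' S' T' w'
  proof -
    have "finite A'" "finite B'" "finite S'" "finite T'" using s' by (auto intro: fin)
    then have vv: "valid r (l # normal_word A B S T)" "valid r (normal_word A' B' S' T')"
      "valid r ([(i, s), (i, \<not> s), (i, s)] @ w')" "valid r ([(i, s)] @ w')"
      using s' sub i f4 v l by (auto simp: normal_word_def valid_letters)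
    have "length (l # normal_word A B S T) = length ([(i, s), (i, \<not> s), (i, s)] @ w')"
      unfolding length_eq_restrict[OF vv(1)] length_eq_restrict[OF vv(3)] p ..
    moreover have "length (normal_word A' B' S' T') = length ([(i, s)] @ w')"
      unfolding length_eq_restrict[OF vv(2)] length_eq_restrict[OF vv(4)] q ..
    moreover have "endp x (l # normal_word A B S T) = endp x (normal_word A' B' S' T')" for x
    proof -
      have "step (i, s) (step (i, \<not> s) (step (i, s) x)) = step (i, s) x"
        by (cases s) (simp_all add: step_def inc_def dec_def)
      then have "endp x ([(i, s), (i, \<not> s), (i, s)] @ w') = endp x ([(i, s)] @ w')" by simp
      then show ?thesis using endp_restrict[of "l # normal_word A B S T", OF p] endp_restrict[of
        "normal_word A' B' S' T'", OF q]
        by metis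
    qed
    moreover have "f (l # normal_word A B S T) =
      loop_op f (normal_word A' B' S' T')" if f: "compat r f" for f :: "word \<Rightarrow> 'k"
      using fm[OF f p] compat_restrict_eq[OF compat_loop_op[OF f] q]
        compat_reduce_triple[OF f, of i "[]" s w'] i l by simp
    ultimately show ?thesis using s'
      by (intro exI[of _ A'] exI[of _ B'] exI[of _ S'] exI[of _ T'] exI[of _ "1::nat"]) auto
  qed
  have ir: "i \<in> {1..r}" using i l by simp
  note disj = d[unfolded disjoint4_def]
  consider "i \<notin> A" "i \<notin> B" "i \<notin> S" "i \<notin> T" | "i \<in> A" "i \<notin> B" "i \<notin> S" "i \<notin> T"
    | "i \<notin> A" "i \<in> B" "i \<notin> S" "i \<notin> T" | "i \<notin> A" "i \<notin> B" "i \<in> S" "i \<notin> T"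
    | "i \<notin> A" "i \<notin> B" "i \<notin> S" "i \<in> T" using disj by blast
  then show ?thesis
  proof cases
    case 1
    show ?thesis
    proof (cases s)
      case True
      have ?E
      proof (rule easy[of "insert i A" "B" "S" "T"])
        show "restrict j (l # normal_word A B S T) = restrict j (normal_word (insert i A) B S T)" for j
          using 1 True f4 by (cases "j = i") (simp_all add: restrict_normal_word l)
      qed (use 1 ir sub disj in \<open>auto simp: disjoint4_def\<close>)
      then show ?thesis ..
    next
      case False
      have ?E
      proof (rule easy[of "A" "insert i B" "S" "T"])
        show "restrict j (l # normal_word A B S T) = restrict j (normal_word A (insert i B) S T)" for j
          using 1 False f4 by (cases "j = i") (simp_all add: restrict_normal_word l)
      qed (use 1 ir sub disj in \<open>auto simp: disjoint4_def\<close>)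
      then show ?thesis ..
    qed
  next
    case 2
    show ?thesis
    proof (cases s)
      case True
      have ?Z
      proof (rule zero[of "normal_word (A - {i}) B S T"])
        show "restrict j (l # normal_word A B S T) =
          restrict j ([l, l] @ normal_word (A - {i}) B S T)" for j
          using 2 True f4 by (cases "j = i") (simp_all add: restrict_normal_word l)
      qed
      then show ?thesis ..
    next
      case False
      have ?E
      proof (rule easy[of "A - {i}" "B" "insert i S" "T"])
        show "restrict j (l # normal_word A B S T) =
          restrict j (normal_word (A - {i}) B (insert i S) T)" for j
          using 2 False f4 by (cases "j = i") (simp_all add: restrict_normal_word l)
      qed (use 2 ir sub disj in \<open>auto simp: disjoint4_def\<close>)
      then show ?thesis ..
    qed
  next
    case 3
    show ?thesis
    proof (cases s)
      case True
      have ?E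
      proof (rule easy[of "A" "B - {i}" "S" "insert i T"])
        show "restrict j (l # normal_word A B S T) =
          restrict j (normal_word A (B - {i}) S (insert i T))" for j
          using 3 True f4 by (cases "j = i") (simp_all add: restrict_normal_word l)
      qed (use 3 ir sub disj in \<open>auto simp: disjoint4_def\<close>)
      then show ?thesis ..
    next
      case False
      have ?Z
      proof (rule zero[of "normal_word A (B - {i}) S T"])
        show "restrict j (l # normal_word A B S T) =
          restrict j ([l, l] @ normal_word A (B - {i}) S T)" for j
          using 3 False f4 by (cases "j = i") (simp_all add: restrict_normal_word l)
      qed
      then show ?thesis ..
    qed
  next
    case 4
    show ?thesis
    proof (cases s)
      case True
      have ?E
      proof (rule triple[of "insert i A" "B" "S - {i}" "T" "normal_word A B (S - {i}) T"])
        show "restrict j (l # normal_word A B S T) =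
          restrict j ([(i, s), (i, \<not> s), (i, s)] @ normal_word A B (S - {i}) T)" for j
          using 4 True f4 by (cases "j = i") (simp_all add: restrict_normal_word l)
        show "restrict j (normal_word (insert i A) B (S - {i}) T) =
          restrict j ([(i, s)] @ normal_word A B (S - {i}) T)" for j
          using 4 True f4 by (cases "j = i") (simp_all add: restrict_normal_word)
        show "valid r (normal_word A B (S - {i}) T)"
          using sub f4 by (auto simp: normal_word_def valid_letters)
      qed (use 4 ir sub disj in \<open>auto simp: disjoint4_def\<close>)
      then show ?thesis ..
    next
      case False
      have ?Z
      proof (rule zero[of "normal_word (insert i A) B (S - {i}) T"])
        show "restrict j (l # normal_word A B S T) =
          restrict j ([l, l] @ normal_word (insert i A) B (S - {i}) T)" for j
          using 4 False f4 by (cases "j = i") (simp_all add: restrict_normal_word l)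
      qed
      then show ?thesis ..
    qed
  next
    case 5
    show ?thesis
    proof (cases s)
      case True
      have ?Z
      proof (rule zero[of "normal_word A (insert i B) S (T - {i})"])
        show "restrict j (l # normal_word A B S T) =
          restrict j ([l, l] @ normal_word A (insert i B) S (T - {i}))" for j
          using 5 True f4 by (cases "j = i") (simp_all add: restrict_normal_word l)
      qed
      then show ?thesis ..
    next
      case False
      have ?E
      proof (rule triple[of "A" "insert i B" "S" "T - {i}" "normal_word A B S (T - {i})"])
        show "restrict j (l # normal_word A B S T) =
          restrict j ([(i, s), (i, \<not> s), (i, s)] @ normal_word A B S (T - {i}))" for j
          using 5 False f4 by (cases "j = i") (simp_all add: restrict_normal_word l)
        show "restrict j (normal_word A (insert i B) S (T - {i})) =
          restrict j ([(i, s)] @ normal_word A B S (T - {i}))" for j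
          using 5 False f4 by (cases "j = i") (simp_all add: restrict_normal_word)
        show "valid r (normal_word A B S (T - {i}))"
          using sub f4 by (auto simp: normal_word_def valid_letters)
      qed (use 5 ir sub disj in \<open>auto simp: disjoint4_def\<close>)
      then show ?thesis ..
    qed
  qed
qed

text \<open>The word is built up from its end, one letter in front of a normal form at a time. The
  sets and the number \<open>n\<close> are chosen before the functional: later the same normal form
  is evaluated both by a test functional and by all the cubes.\<close>

lemma compat_normal_form:
  assumes "valid r w"
  shows "(\<forall>f :: word \<Rightarrow> 'k::comm_ring_1. compat r f \<longrightarrow> f w = 0) \<or>
    (\<exists>A B S T n. A \<union> B \<union> S \<union> T \<subseteq> {1..r} \<and> disjoint4 A B S T \<and>
       (\<forall>f :: word \<Rightarrow> 'k. compat r f \<longrightarrow> f w = (loop_op ^^ n) f (normal_word A B S T)) \<and>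
       length w = 2 * n + length (normal_word A B S T) \<and>
       (\<forall>x. endp x w = endp x (normal_word A B S T)))"
  using assms
proof (induction w)
  case Nil
  show ?case
    by (intro disjI2 exI[of _ "{}"] exI[of _
      "0::nat"]) (simp add: normal_word_def letters_def disjoint4_def)
next
  case (Cons l w)
  note rp = compat_prefix[where p = "[l]", simplified]
  have v: "valid r w" using Cons.prems by simp
  from Cons.IH[OF v] show ?case
  proof (elim disjE exE conjE)
    assume "\<forall>f :: word \<Rightarrow> 'k. compat r f \<longrightarrow> f w = 0"
    then show ?thesis using rp by blast
  next
    fix A B S T n
    assume nz: "A \<union> B \<union> S \<union> T \<subseteq> {1..r}" "disjoint4 A B S T"
       "\<forall>f :: word \<Rightarrow> 'k. compat r f \<longrightarrow> f w = (loop_op ^^ n) f (normal_word A B S T)"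
       "length w = 2 * n + length (normal_word A B S T)"
       "\<forall>x. endp x w = endp x (normal_word A B S T)"
    \<comment> \<open>The induction hypothesis puts the loops behind \<open>l\<close>; by centrality
      they may stand in front of it.\<close>
    have cp: "(loop_op ^^ n) (\<lambda>w. f (l # w)) v = (loop_op ^^ n) f (l # v)" if f: "compat r f"
      for f :: "word \<Rightarrow> 'k" and n v
    proof (induction n arbitrary: v)
      case (Suc n)
      have 1: "1 \<in> {1..r}" using Cons.prems by auto
      note g = compat_loop_op_pow[OF f, of n]
      have "loop_op ((loop_op ^^ n) (\<lambda>w. f (l # w))) v = loop_op ((loop_op ^^ n) f) (l # v)"
        using compat_central[OF g 1, of "[l]" v]
        by (simp add: loop_op_def[of "(loop_op ^^ n) (\<lambda>w. f (l # w))"] Suc)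
      then show ?case by simp
    qed simp
    have lw: "f (l # w) = (loop_op ^^ n) f (l # normal_word A B S T)" if f: "compat r f" for f ::
      "word \<Rightarrow> 'k"
      using nz(3)[rule_format, OF rp[OF f]] cp[OF f] by simp
    have e: "endp x (l # w) = endp x (l # normal_word A B S T)" for x using nz(5) by simp
    have "fst l \<in> {1..r}" using Cons.prems by simp
    from compat_normal_form_step[OF this nz(1,2), where 'k = 'k] show ?thesis
    proof (elim disjE exE conjE)
      assume z: "\<forall>f :: word \<Rightarrow> 'k. compat r f \<longrightarrow> f (l # normal_word A B S T) = 0"
      have "f (l # w) = 0" if "compat r f" for f :: "word \<Rightarrow> 'k"
        using lw[OF that] z[rule_format, OF compat_loop_op_pow[OF that]] by simp
      then show ?thesis by simp
    next
      fix A' B' S' T' m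
      assume h: "A' \<union> B' \<union> S' \<union> T' \<subseteq> {1..r}" "disjoint4 A' B' S' T'"
       "\<forall>f :: word \<Rightarrow> 'k. compat r f \<longrightarrow> f (l # normal_word A B S T) =
         (loop_op ^^ m) f (normal_word A' B' S' T')"
       "Suc (length (normal_word A B S T)) = 2 * m + length (normal_word A' B' S' T')"
       "\<forall>x. endp x (l # normal_word A B S T) = endp x (normal_word A' B' S' T')"
      have "f (l # w) = (loop_op ^^ (m + n)) f (normal_word A' B' S' T')" if "compat r f" for f ::
        "word \<Rightarrow> 'k"
        using lw[OF that] h(3) compat_loop_op_pow[OF that] by (simp add: funpow_add)
      moreover have "length (l # w) = 2 * (m + n) + length (normal_word A' B' S' T')"
        using nz(4) h(4) by simp
      moreover have "\<forall>x. endp x (l # w) = endp x (normal_word A' B' S' T')" using e h(5) by simp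
      ultimately show ?thesis using h(1,2)
        by (intro disjI2 exI[of _ A'] exI[of _ B'] exI[of _ S'] exI[of _ T'] exI[of _ "m + n"]) simp
    qed
  qed
qed

section \<open>Functions on the vertices of a cube\<close>

text \<open>Adding or removing \<open>a\<close> is an involution without fixed points that reverses
  the sign of \<open>h\<close>. The sets without \<open>a\<close> and those with \<open>a\<close>
  are summed separately, so characteristic 2 is no exception.\<close>

lemma sum_toggle_cancel:
  fixes h :: "'a set \<Rightarrow> 'b::ab_group_add"
  assumes "finite C"
    and "\<And>Z. Z \<in> C \<Longrightarrow> a \<notin> Z \<Longrightarrow> insert a Z \<in> C \<and> h (insert a Z) = - h Z"
    and "\<And>Z. Z \<in> C \<Longrightarrow> a \<in> Z \<Longrightarrow> Z - {a} \<in> C"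
  shows "sum h C = 0"
proof -
  let ?C = "{Z \<in> C. a \<notin> Z}"
  have C: "C = ?C \<union> insert a ` ?C"
  proof (intro equalityI subsetI)
    fix Z assume Z: "Z \<in> C"
    show "Z \<in> ?C \<union> insert a ` ?C"
    proof (cases "a \<in> Z")
      case True
      then have "Z = insert a (Z - {a})" "Z - {a} \<in> ?C" using Z assms(3) by auto
      then show ?thesis by blast
    qed (use Z in simp)
  qed (use assms(2) in auto)
  have "inj_on (insert a) ?C" by (auto simp: inj_on_def)
  then have "sum h (insert a ` ?C) = (\<Sum>Z\<in>?C. - h Z)"
    by (simp add: sum.reindex assms(2) cong: sum.cong_simp)
  moreover have "sum h C = sum h ?C + sum h (insert a ` ?C)"
    by (subst C, rule sum.union_disjoint) (use assms(1) in auto)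
  ultimately show ?thesis by (simp add: sum_negf)
qed

text \<open>If \<open>T \<noteq> U\<close>, toggling an element of \<open>U - T\<close> cancels all
  terms.\<close>

lemma sum_alternating_interval:
  assumes "finite U" "T \<subseteq> U"
  shows "(\<Sum>Z | T \<subseteq> Z \<and> Z \<subseteq> U. (- 1) ^ card Z) = (if T =
    U then (- 1) ^ card U else 0 :: 'k::comm_ring_1)"
proof (cases "T = U")
  case True
  then have "{Z. T \<subseteq> Z \<and> Z \<subseteq> U} = {U}" by auto
  then show ?thesis using True by simp
next
  case False
  then obtain a where a: "a \<in> U" "a \<notin> T" using assms by auto
  have "(\<Sum>Z | T \<subseteq> Z \<and> Z \<subseteq> U. (- 1) ^ card Z :: 'k) = 0"
  proof (rule sum_toggle_cancel[where a = a])
    show "finite {Z. T \<subseteq> Z \<and> Z \<subseteq> U}" using assms(1) by simp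
    show "insert a Z \<in> {Z. T \<subseteq> Z \<and> Z \<subseteq> U} \<and> (- 1) ^ card (insert a Z) = - ((- 1) ^ card Z :: 'k)"
      if "Z \<in> {Z. T \<subseteq> Z \<and> Z \<subseteq> U}" "a \<notin> Z" for Z
    proof -
      have "finite Z" using that assms(1) by (auto intro: finite_subset)
      then show ?thesis using that a by auto
    qed
  qed (use a in auto)
  then show ?thesis using False by simp
qed

text \<open>Here \<open>(- 1) ^ card U\<close> times the inner sum is the coefficient of
  \<open>h\<close>, as a multilinear polynomial, at the product of the z_i with i in
  \<open>U\<close>; evaluation at \<open>Z\<close> adds up the coefficients of the subsets of
  \<open>Z\<close>. After exchanging the sums, the alternating sum over the sets between
  \<open>Y\<close> and \<open>Z\<close> leaves only \<open>Y = Z\<close>.\<close>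

lemma subset_moebius_inversion:
  fixes h :: "'a set \<Rightarrow> 'k::comm_ring_1"
  assumes "finite Z"
  shows "(\<Sum>U\<in>Pow Z. (- 1) ^ card U * (\<Sum>Y\<in>Pow U. (- 1) ^ card Y * h Y)) = h Z"
proof -
  have "(\<Sum>U\<in>Pow Z. (- 1) ^ card U * (\<Sum>Y\<in>Pow U. (- 1) ^ card Y * h Y)) =
    (\<Sum>U\<in>Pow Z. \<Sum>Y | Y \<in> Pow Z \<and> Y \<subseteq> U. (- 1) ^ card U * ((- 1) ^ card Y * h Y))"
  proof (rule sum.cong)
    fix U assume "U \<in> Pow Z"
    then have "Pow U = {Y. Y \<in> Pow Z \<and> Y \<subseteq> U}" by auto
    then show "(- 1) ^ card U * (\<Sum>Y\<in>Pow U. (- 1) ^ card Y * h Y) =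
      (\<Sum>Y | Y \<in> Pow Z \<and> Y \<subseteq> U. (- 1) ^ card U * ((- 1) ^ card Y * h Y))"
      by (simp only: sum_distrib_left)
  qed simp
  also have "\<dots> = (\<Sum>Y\<in>Pow Z. \<Sum>U | U \<in> Pow Z \<and> Y \<subseteq> U. (- 1) ^ card U * ((- 1) ^ card Y * h Y))"
    by (rule sum.swap_restrict) (use assms in auto)
  also have "\<dots> = (\<Sum>Y\<in>Pow Z. if Y = Z then h Y else 0)"
  proof (rule sum.cong)
    fix Y assume Y: "Y \<in> Pow Z"
    have "{U. U \<in> Pow Z \<and> Y \<subseteq> U} = {U. Y \<subseteq> U \<and> U \<subseteq> Z}" by auto
    then have "(\<Sum>U | U \<in> Pow Z \<and> Y \<subseteq> U. (- 1) ^ card U * ((- 1) ^ card Y * h Y)) =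
      (\<Sum>U | Y \<subseteq> U \<and> U \<subseteq> Z. (- 1) ^ card U) * ((- 1) ^ card Y * h Y)"
      by (simp add: sum_distrib_right)
    also have "\<dots> = (if Y = Z then h Y else 0)"
      using Y assms by (simp add: sum_alternating_interval flip: mult.assoc power_add)
    finally show "(\<Sum>U | U \<in> Pow Z \<and> Y \<subseteq> U. (- 1) ^ card U * ((- 1) ^ card Y * h Y)) =
      (if Y = Z then h Y else 0)" .
  qed simp
  also have "\<dots> = h Z" using assms by simp
  finally show ?thesis .
qed

definition indic :: "'a set \<Rightarrow> 'a set \<Rightarrow> 'a set \<Rightarrow> 'k::comm_ring_1" where
  "indic S T Z = (if S \<subseteq> Z \<and> T \<inter> Z = {} then 1 else 0)"

text \<open>The function \<open>indic S T\<close> is a monomial of degree $|S| + |T|$ in the coordinates of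
  $\{0,1\}^R$ and their complements $1 - z_i$. By \<open>split\<close>, \<open>m\<close> is a linear functional on the
  polynomials of degree at most \<open>d\<close>. The assumption \<open>pair\<close> says that the product of the given
  polynomial with the indicator function of \<open>G\<close> has degree at most \<open>d\<close>. This product is a
  combination of monomials \<open>indic U {}\<close> with \<open>G U\<close>, and the remaining part is a combination of
  \<open>indic {} U\<close> with \<open>\<not> G (R - U)\<close>.\<close>

lemma cube_functional_vanishes:
  fixes R :: "'a set" and m :: "'a set \<Rightarrow> 'a set \<Rightarrow> 'k::comm_ring_1" and c :: "'p \<Rightarrow> 'k"
  assumes R: "finite R" and P: "finite P"
    and ST: "\<And>p. p \<in> P \<Longrightarrow> S p \<subseteq> R \<and> T p \<subseteq> R \<and> S p \<inter> T p = {} \<and> card (S p) + card (T p) \<le> d"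
    and split: "\<And>S T i. S \<subseteq> R \<Longrightarrow> T \<subseteq> R \<Longrightarrow> S \<inter> T = {} \<Longrightarrow> i \<in> R - (S \<union> T) \<Longrightarrow>
       card S + card T < d \<Longrightarrow> m S T = m (insert i S) T + m S (insert i T)"
    and G: "\<And>Y Z. Y \<subseteq> Z \<Longrightarrow> Z \<subseteq> R \<Longrightarrow> G Y \<Longrightarrow> G Z"
    and mG: "\<And>U. U \<subseteq> R \<Longrightarrow> G U \<Longrightarrow> m U {} = 0"
    and mG': "\<And>U. U \<subseteq> R \<Longrightarrow> \<not> G (R - U) \<Longrightarrow> m {} U = 0"
    and pair: "\<And>U. U \<subseteq> R \<Longrightarrow> d < card U \<Longrightarrow>
       (\<Sum>Z\<in>Pow U. (- 1) ^ card Z * (if G Z then \<Sum>p\<in>P. c p * indic (S p) (T p) Z else 0)) = 0"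
  shows "(\<Sum>p\<in>P. c p * m (S p) (T p)) = 0"
proof -
  define \<phi> :: "'a set \<Rightarrow> 'k" where "\<phi> Z = (\<Sum>p\<in>P. c p * indic (S p) (T p) Z)" for Z
  define D where "D = {U. U \<subseteq> R \<and> card U \<le> d}"
  \<comment> \<open>The coefficient of \<open>h\<close> at the product of the 1 - z_i with i in
    \<open>U\<close>, that is, at \<open>indic {} U\<close>. Passing to complements exchanges z_i
    and 1 - z_i.\<close>
  define \<mu> :: "('a set \<Rightarrow> 'k) \<Rightarrow> 'a set \<Rightarrow> 'k"
    where "\<mu> h U = (- 1) ^ card U * (\<Sum>Z\<in>Pow U. (- 1) ^ card Z * h (R - Z))" for h U
  \<comment> \<open>\<open>L\<close> discards all coefficients above degree \<open>d\<close>, so it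
    is linear on arbitrary functions, including products with the indicator function of
    \<open>G\<close>.\<close>
  define L where "L h = (\<Sum>U\<in>D. \<mu> h U * m {} U)" for h
  have fD: "finite D" unfolding D_def using R by simp
  have fin: "finite U" if "U \<subseteq> R" for U using that R finite_subset by blast
  have Lsum: "L (\<lambda>Z. \<Sum>q\<in>Q. a q * h q Z) = (\<Sum>q\<in>Q. a q * L (h q))"
    for Q :: "'q set" and a h
  proof -
    have "\<mu> (\<lambda>Z. \<Sum>q\<in>Q. a q * h q Z) U = (\<Sum>q\<in>Q. a q * \<mu> (h q) U)" for U
      unfolding \<mu>_def sum_distrib_left
      by (subst sum.swap) (simp add: mult_ac)
    then show ?thesis unfolding L_def
      by (simp add: sum_distrib_right sum_distrib_left mult.assoc) (rule sum.swap)
  qed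
  have Lcong: "L h = L h'" if "\<And>Z. Z \<subseteq> R \<Longrightarrow> h Z = h' Z" for h h'
    unfolding L_def \<mu>_def using that by (simp cong: sum.cong)
  have Ladd: "L (\<lambda>Z. h Z + h' Z) = L h + L h'" for h h'
    unfolding L_def \<mu>_def by (simp add: algebra_simps sum.distrib)
  \<comment> \<open>On the monomials \<open>indic {} T\<close> this is the definition of
    \<open>L\<close>. Larger \<open>S\<close> are reached through 1 = z_i + (1 - z_i), which is the
    polynomial counterpart of \<open>split\<close>.\<close>
  have Lind: "L (indic S T) = m S T"
    if "S \<subseteq> R" "T \<subseteq> R" "S \<inter> T = {}" "card S + card T \<le> d" for S T
    using fin[OF that(1)] that
  proof (induction S arbitrary: T rule: finite_induct)
    case empty
    have mu: "\<mu> (indic {} T) U = (if U = T then 1 else 0)" if U: "U \<in> D" for U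
    proof -
      have fU: "finite U" using U fin by (auto simp: D_def)
      have "(\<Sum>Z\<in>Pow U. (- 1) ^ card Z * indic {} T (R - Z)) =
        (\<Sum>Z\<in>Pow U. if T \<subseteq> Z then (- 1) ^ card Z else 0 :: 'k)"
        by (rule sum.cong) (use empty.prems(2) in \<open>auto simp: indic_def\<close>)
      also have "\<dots> = (\<Sum>Z | T \<subseteq> Z \<and> Z \<subseteq> U. (- 1) ^ card Z)"
        using fU by (simp flip: sum.inter_filter) (rule sum.cong; auto)
      also have "\<dots> = (if U = T then (- 1) ^ card U else 0)"
      proof (cases "T \<subseteq> U")
        case False
        then have "{Z. T \<subseteq> Z \<and> Z \<subseteq> U} = {}" by auto
        then show ?thesis using False by (simp only: sum.empty) auto
      qed (use fU in \<open>auto simp: sum_alternating_interval\<close>)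
      finally show ?thesis unfolding \<mu>_def by (simp flip: power_add)
    qed
    have "T \<in> D" using empty.prems by (simp add: D_def)
    have "L (indic {} T) = (\<Sum>U\<in>D. if U = T then m {} U else 0)"
      unfolding L_def by (rule sum.cong) (simp_all add: mu)
    also have "\<dots> = m {} T" using fD \<open>T \<in> D\<close> by simp
    finally show ?case .
  next
    case (insert i S)
    have fT: "finite T" using insert.prems fin by blast
    have iT: "i \<notin> T" using insert.prems by auto
    have "L (indic S T) = L (\<lambda>Z. indic (insert i S) T Z + indic S (insert i T) Z)"
      by (rule Lcong) (auto simp: indic_def)
    also have "\<dots> = L (indic (insert i S) T) + L (indic S (insert i T))" by (rule Ladd)
    finally have 1: "L (indic S T) = L (indic (insert i S) T) + L (indic S (insert i T))" .
    have "L (indic S T) = m S T"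
      by (rule insert.IH) (use insert.prems insert.hyps in auto)
    moreover have "L (indic S (insert i T)) = m S (insert i T)"
      by (rule insert.IH) (use insert.prems insert.hyps iT fT in auto)
    moreover have "m S T = m (insert i S) T + m S (insert i T)"
      by (rule split) (use insert.prems insert.hyps iT fT in auto)
    ultimately show ?case using 1 by simp
  qed
  have "(\<Sum>p\<in>P. c p * m (S p) (T p)) = (\<Sum>p\<in>P. c p * L (indic (S p) (T p)))"
    by (rule sum.cong) (simp_all add: Lind ST)
  also have "\<dots> = L \<phi>" unfolding \<phi>_def[abs_def] by (rule Lsum[symmetric])
  also have "\<dots> = L (\<lambda>Z. (if G Z then \<phi> Z else 0) + (if G Z then 0 else \<phi> Z))"
    by (rule Lcong) simp
  also have "\<dots> = L (\<lambda>Z. if G Z then \<phi> Z else 0) + L (\<lambda>Z. if G Z then 0 else \<phi> Z)"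
    by (rule Ladd)
  \<comment> \<open>The coefficient at \<open>U\<close> involves only values at sets that contain
    \<open>R - U\<close>. If \<open>G (R - U)\<close>, these values are all zero because
    \<open>G\<close> is upward closed; otherwise \<open>mG'\<close> applies. Degrees above
    \<open>d\<close> are absent by the truncation.\<close>
  also have "L (\<lambda>Z. if G Z then 0 else \<phi> Z) = 0" unfolding L_def
  proof (rule sum.neutral, rule ballI)
    fix U assume "U \<in> D"
    then have U: "U \<subseteq> R" by (simp add: D_def)
    show "\<mu> (\<lambda>Z. if G Z then 0 else \<phi> Z) U * m {} U = 0"
    proof (cases "G (R - U)")
      case True
      have "\<mu> (\<lambda>Z. if G Z then 0 else \<phi> Z) U = 0"
      proof -
        have "G (R - Z)" if "Z \<in> Pow U" for Z by (rule G[OF _ _ True]) (use that in auto)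
        then show ?thesis unfolding \<mu>_def by simp
      qed
      then show ?thesis by simp
    qed (simp add: mG' U)
  qed
  \<comment> \<open>This part is expanded in the other monomials \<open>indic U {}\<close>, where
    \<open>L\<close> is known only up to degree \<open>d\<close>. This is where \<open>pair\<close>
    enters: it makes the coefficients of higher degree vanish. For \<open>U\<close> outside
    \<open>G\<close> the coefficient vanishes because no subset of \<open>U\<close> satisfies
    \<open>G\<close>.\<close>
  also have "L (\<lambda>Z. if G Z then \<phi> Z else 0) = 0"
  proof -
    define \<nu> where "\<nu> U = (- 1) ^ card U * (\<Sum>Y\<in>Pow U. (- 1) ^ card Y * (if G Y then \<phi> Y else 0))" for U
    have "L (\<lambda>Z. if G Z then \<phi> Z else 0) = L (\<lambda>Z. \<Sum>U\<in>Pow R. \<nu> U * indic U {} Z)"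
    proof (rule Lcong)
      fix Z assume Z: "Z \<subseteq> R"
      have "(\<Sum>U\<in>Pow R. \<nu> U * indic U {} Z) = (\<Sum>U\<in>Pow R. if U \<in> Pow Z then \<nu> U else 0)"
        by (rule sum.cong) (auto simp: indic_def)
      also have "\<dots> = (\<Sum>U\<in>Pow Z. \<nu> U)"
        using R Z by (subst sum.inter_restrict[symmetric]) (auto simp: Int_absorb1 intro: sum.cong)
      also have "\<dots> = (if G Z then \<phi> Z else 0)"
        unfolding \<nu>_def by (rule subset_moebius_inversion[OF fin[OF Z]])
      finally show "(if G Z then \<phi> Z else 0) = (\<Sum>U\<in>Pow R. \<nu> U * indic U {} Z)" ..
    qed
    also have "\<dots> = (\<Sum>U\<in>Pow R. \<nu> U * L (indic U {}))" by (rule Lsum)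
    also have "\<dots> = 0"
    proof (rule sum.neutral, rule ballI)
      fix U assume "U \<in> Pow R"
      then have U: "U \<subseteq> R" by simp
      consider "d < card U" | "card U \<le> d" "G U" | "\<not> G U" by linarith
      then show "\<nu> U * L (indic U {}) = 0"
      proof cases
        case 1
        then show ?thesis using pair[OF U 1] unfolding \<nu>_def \<phi>_def
          by (simp only: mult_zero_left mult_zero_right)
      next
        case 2
        then show ?thesis using Lind[of U "{}"] mG[OF U] U by simp
      next
        case 3
        have "\<not> G Y" if "Y \<in> Pow U" for Y using G[of Y U] 3 U that by auto
        then show ?thesis by (simp add: \<nu>_def)
      qed
    qed
    finally show ?thesis .
  qed
  finally show ?thesis by simp
qed

section \<open>Unit cubes and the trace\<close>

lemma step_commute: "fst l \<noteq> fst l' \<Longrightarrow> step l (step l' x) = step l' (step l x)"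
  by (auto simp: step_def inc_def dec_def fun_upd_twist)

lemma step_inverse: "step (i, s) (step (i, \<not> s) x) = x"
  by (cases s) (simp_all add: step_def inc_def dec_def)

lemma step_Zlat: "x \<in> Zlat r \<Longrightarrow> fst l \<in> {1..r} \<Longrightarrow> step l x \<in> Zlat r"
  by (auto simp: step_def inc_def dec_def Zlat_def)

lemma endp_Zlat: "x \<in> Zlat r \<Longrightarrow> valid r w \<Longrightarrow> endp x w \<in> Zlat r"
  by (induction w arbitrary: x) (auto simp: step_Zlat)

lemma compat_suffix:
  assumes "compat r f"
  shows "compat r (\<lambda>w. f (w @ p))"
proof (rule compatI)
  fix u v i j assume "i \<in> {1..r}" "j \<in> {1..r}"
  from compat_loop[OF assms this, of u "v @ p"]
  show "f ((u @ (i, True) # (i, False) # v) @ p) + f ((u @ (i, False) # (i, True) # v) @ p) =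
    f ((u @ (j, True) # (j, False) # v) @ p) + f ((u @ (j, False) # (j, True) # v) @ p)"
    by (simp only: append_assoc append_Cons)
next
  fix u v and l l' :: "nat \<times> bool" assume "fst l \<noteq> fst l'"
  from compat_swap[OF assms this, of u "v @ p"]
  show "f ((u @ l # l' # v) @ p) = f ((u @ l' # l # v) @ p)"
    by (simp only: append_assoc append_Cons)
next
  fix u v and l :: "nat \<times> bool"
  show "f ((u @ l # l # v) @ p) = 0"
    using compat_square[OF assms, of u l "v @ p"] by (simp only: append_assoc append_Cons)
qed

lemma compat_sum:
  assumes "\<And>z. z \<in> C \<Longrightarrow> compat r (f z)"
  shows "compat r (\<lambda>w. \<Sum>z\<in>C. a z * f z w)"
proof (rule compatI)
  fix u v i j assume ij: "i \<in> {1..r}" "j \<in> {1..r}"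
  show "(\<Sum>z\<in>C. a z * f z (u @ (i, True) # (i, False) # v)) +
      (\<Sum>z\<in>C. a z * f z (u @ (i, False) # (i, True) # v)) =
    (\<Sum>z\<in>C. a z * f z (u @ (j, True) # (j, False) # v)) +
      (\<Sum>z\<in>C. a z * f z (u @ (j, False) # (j, True) # v))"
    unfolding sum.distrib[symmetric] distrib_left[symmetric]
    by (intro sum.cong refl arg_cong[where f = "(*) _"] compat_loop[OF assms] ij)
next
  fix u v and l l' :: "nat \<times> bool" assume "fst l \<noteq> fst l'"
  then show "(\<Sum>z\<in>C. a z * f z (u @ l # l' # v)) = (\<Sum>z\<in>C. a z * f z (u @ l' # l # v))"
    by (intro sum.cong refl arg_cong[where f = "(*) _"] compat_swap[OF assms])
next
  fix u v and l :: "nat \<times> bool"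
  show "(\<Sum>z\<in>C. a z * f z (u @ l # l # v)) = 0"
    by (rule sum.neutral) (simp add: compat_square[OF assms])
qed

section \<open>Evaluation of words on a unit cube\<close>

definition in_cube :: "nat \<Rightarrow> (nat \<Rightarrow> int) \<Rightarrow> (nat \<Rightarrow> int) \<Rightarrow> bool" where
  "in_cube r z x \<longleftrightarrow> (\<forall>i\<in>{1..r}. z i \<le> x i \<and> x i \<le> z i + 1)"

primrec walk_in :: "nat \<Rightarrow> (nat \<Rightarrow> int) \<Rightarrow> (nat \<Rightarrow> int) \<Rightarrow> word \<Rightarrow> bool" where
  "walk_in r z x [] \<longleftrightarrow> in_cube r z x"
| "walk_in r z x (l # w) \<longleftrightarrow> in_cube r z x \<and> walk_in r z (step l x) w"

lemma walk_in_in_cube: "walk_in r z x w \<Longrightarrow> in_cube r z x"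
  by (cases w) auto

lemma walk_in_append: "walk_in r z x (u @ v) \<longleftrightarrow> walk_in r z x u \<and> walk_in r z (endp x u) v"
  by (induction u arbitrary: x) (auto dest: walk_in_in_cube)

lemma walk_in_endp: "walk_in r z x w \<Longrightarrow> in_cube r z (endp x w)"
  by (induction w arbitrary: x) auto

text \<open>A matrix entry of the representation with a line at every vertex of the cube, on which
  every edge acts as 1. Invalid words are sent to 0 explicitly, since \<open>in_cube\<close> ignores
  coordinates outside {1..r}.\<close>

definition cube_eval :: "nat \<Rightarrow> (nat \<Rightarrow> int) \<Rightarrow> (nat \<Rightarrow> int) \<Rightarrow> word \<Rightarrow> 'k::comm_ring_1" where
  "cube_eval r z x w = (if valid r w \<and> walk_in r z x w then 1 else 0)"

lemma cube_eval_append: "cube_eval r z x (u @ v) = cube_eval r z x u * cube_eval r z (endp x u) v"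
  by (auto simp: cube_eval_def walk_in_append)

text \<open>Each coordinate of the intermediate vertex is a coordinate of one of the two
  ends.\<close>

lemma in_cube_swap:
  assumes "fst l \<noteq> fst l'" "in_cube r z y" "in_cube r z (step l' (step l y))"
  shows "in_cube r z (step l y)"
proof -
  have "z i \<le> step l y i \<and> step l y i \<le> z i + 1" if i: "i \<in> {1..r}" for i
  proof (cases "i = fst l")
    case True
    then have "step l' (step l y) i = step l y i" using assms(1)
      by (auto simp: step_def inc_def dec_def)
    then show ?thesis using assms(3) i unfolding in_cube_def by metis
  next
    case False
    then have "step l y i = y i" by (auto simp: step_def inc_def dec_def)
    then show ?thesis using assms(2) i unfolding in_cube_def by metis
  qed
  then show ?thesis by (simp add: in_cube_def)
qed

lemma step_apply: "step (i, s) y j = (if j = i then if s then y i + 1 else y i - 1 else y j)"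
  by (simp add: step_def inc_def dec_def)

lemma in_cube_step:
  assumes "i \<in> {1..r}" "in_cube r z y"
  shows "in_cube r z (step (i, s) y) \<longleftrightarrow> y i = (if s then z i else z i + 1)"
proof
  have y: "z i \<le> y i" "y i \<le> z i + 1" using assms unfolding in_cube_def by blast+
  {
    assume "in_cube r z (step (i, s) y)"
    then have "z i \<le> step (i, s) y i" "step (i, s) y i \<le> z i + 1"
      using assms(1) unfolding in_cube_def by blast+
    then show "y i = (if s then z i else z i + 1)" using y by (simp add: step_apply split: if_splits)
  next
    assume "y i = (if s then z i else z i + 1)"
    then show "in_cube r z (step (i, s) y)"
      using assms(2) by (simp add: in_cube_def step_apply)
  }
qed

lemma in_cube_loop:
  assumes "i \<in> {1..r}" "in_cube r z y"
  shows "in_cube r z (step (i, True) y) \<longleftrightarrow> \<not> in_cube r z (step (i, False) y)"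
proof -
  have "z i \<le> y i" "y i \<le> z i + 1" using assms unfolding in_cube_def by blast+
  then show ?thesis by (auto simp: in_cube_step[OF assms])
qed

text \<open>A cube around \<open>x\<close> contains exactly one of the two neighbours of
  \<open>x\<close> in direction \<open>i\<close>, so exactly one half of the loop survives, whatever
  \<open>i\<close> is.\<close>

lemma cube_eval_loop:
  assumes "i \<in> {1..r}"
  shows "cube_eval r z x ((i, True) # (i, False) # v) +
    cube_eval r z x ((i, False) # (i, True) # v) = cube_eval r z x v"
  using in_cube_loop[OF assms, of z x] step_inverse[of i False x] step_inverse[of i True x] assms
  by (auto simp: cube_eval_def dest: walk_in_in_cube)

text \<open>Squares vanish because the cube has width one, both ways around a square lie in the cube
  or neither does, and every loop acts as the identity.\<close>

lemma compat_cube_eval: "compat r (cube_eval r z x)"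
proof (rule compatI)
  fix u v i j assume ij: "i \<in> {1..r}" "j \<in> {1..r}"
  show "cube_eval r z x (u @ (i, True) # (i, False) # v) +
    cube_eval r z x (u @ (i, False) # (i, True) # v) =
    cube_eval r z x (u @ (j, True) # (j, False) # v) + cube_eval r z x (u @ (j, False) # (j, True) # v)"
    by (simp only: cube_eval_append[of _ _ _ u] distrib_left[symmetric] cube_eval_loop ij)
next
  fix u v and l l' :: "nat \<times> bool" assume d: "fst l \<noteq> fst l'"
  have "walk_in r z y (l # l' # v) \<longleftrightarrow> walk_in r z y (l' # l # v)" for y
    using in_cube_swap[OF d, of r z y] in_cube_swap[OF d[symmetric], of r z y] step_commute[OF d, of y]
    by (auto dest: walk_in_in_cube)
  then have "cube_eval r z y (l # l' # v) = cube_eval r z y (l' # l # v)" for y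
    unfolding cube_eval_def by simp
  then show "cube_eval r z x (u @ l # l' # v) = cube_eval r z x (u @ l' # l # v)"
    unfolding cube_eval_append[of _ _ _ u] by (rule arg_cong)
next
  fix u v and l :: "nat \<times> bool"
  have "\<not> walk_in r z y (l # l # v)" if "fst l \<in> {1..r}" for y
  proof
    assume "walk_in r z y (l # l # v)"
    then have "in_cube r z y" "in_cube r z (step l (step l y))" by (auto dest: walk_in_in_cube)
    then have "z (fst l) \<le> y (fst l)" "y (fst l) \<le> z (fst l) + 1"
      "z (fst l) \<le> step l (step l y) (fst l)" "step l (step l y) (fst l) \<le> z (fst l) + 1"
      using that unfolding in_cube_def by blast+
    then show False by (auto simp: step_def inc_def dec_def split: if_splits)
  qed
  then show "cube_eval r z x (u @ l # l # v) = 0"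
    by (auto simp: cube_eval_def walk_in_append)
qed

lemma loop_op_cube_eval: "1 \<le> r \<Longrightarrow> (loop_op ^^ n) (cube_eval r z x) = cube_eval r z x"
proof (induction n)
  case (Suc n)
  have "loop_op (cube_eval r z x) = cube_eval r z x"
    by (rule ext) (use Suc.prems in \<open>simp add: loop_op_def cube_eval_loop\<close>)
  then show ?case using Suc by simp
qed simp

lemma walk_in_map:
  assumes "distinct is" "set is \<subseteq> {1..r}"
  shows "walk_in r z x (map (\<lambda>i. (i, s)) is) \<longleftrightarrow>
    in_cube r z x \<and> (\<forall>i\<in>set is. x i = (if s then z i else z i + 1))"
  using assms
proof (induction "is" arbitrary: x)
  case (Cons i "is")
  have a: "in_cube r z (step (i, s) x) \<longleftrightarrow> x i = (if s then z i else z i + 1)" if "in_cube r z x"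
    using in_cube_step[OF _ that] Cons.prems by simp
  have b: "walk_in r z (step (i, s) x) (map (\<lambda>i. (i, s)) is) \<longleftrightarrow>
      in_cube r z (step (i, s) x) \<and> (\<forall>j\<in>set is. x j = (if s then z j else z j + 1))"
  proof -
    have "step (i, s) x j = x j" if "j \<in> set is" for j
      using that Cons.prems by (auto simp: step_apply)
    then show ?thesis using Cons.IH[of "step (i, s) x"] Cons.prems by simp
  qed
  have "walk_in r z x (map (\<lambda>i. (i, s)) (i # is)) \<longleftrightarrow> in_cube r z x \<and>
      in_cube r z (step (i, s) x) \<and> (\<forall>j\<in>set is. x j = (if s then z j else z j + 1))"
    by (simp only: list.map walk_in.simps b)
  also have "\<dots> \<longleftrightarrow> in_cube r z x \<and> x i = (if s then z i else z i + 1) \<and>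
      (\<forall>j\<in>set is. x j = (if s then z j else z j + 1))"
    using a by blast
  finally show ?case by (simp only: list.set ball_simps)
qed simp

lemma walk_in_letters:
  "K \<subseteq> {1..r} \<Longrightarrow> walk_in r z x (letters K s) \<longleftrightarrow>
    in_cube r z x \<and> (\<forall>i\<in>K. x i = (if s then z i else z i + 1))"
  unfolding letters_def using walk_in_map[of "sorted_list_of_set K" r z x s] finite_subset[of K
    "{1..r}"]
  by simp

lemma count_letters: "finite K \<Longrightarrow> count_list (letters K s) (j, t) = (if j \<in> K \<and> s = t then 1 else 0)"
  by (subst count_list_restrict) (simp add: restrict_letters)

lemma endp_letters: "finite K \<Longrightarrow> endp x (letters K s) i =
    x i + (if i \<in> K then if s then 1 else - 1 else 0)"
  by (simp add: endp_apply count_letters)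

lemma finite_index_sets:
  "A \<union> B \<union> S \<union> T \<subseteq> {1..r::nat} \<Longrightarrow> finite A \<and> finite B \<and> finite S \<and> finite T"
  using finite_subset[of "A \<union> B \<union> S \<union> T" "{1..r}"] by simp

lemma endp_normal_word:
  assumes "A \<union> B \<union> S \<union> T \<subseteq> {1..r}" "disjoint4 A B S T"
  shows "endp x (normal_word A B S T) i = x i + (if i \<in> A then 1 else 0) - (if i \<in> B then 1 else 0)"
proof -
  have "finite A" "finite B" "finite S" "finite T"
    using finite_index_sets[OF assms(1)] by simp_all
  then show ?thesis using assms(2) by (auto simp: normal_word_def endp_letters disjoint4_def)
qed

lemma length_normal_word:
  assumes "A \<union> B \<union> S \<union> T \<subseteq> {1..r}" "disjoint4 A B S T"
  shows "length (normal_word A B S T) = card A + card B + 2 * card S + 2 * card T"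
proof -
  have "finite A" "finite B" "finite S" "finite T"
    using finite_index_sets[OF assms(1)] by simp_all
  moreover have "(A \<union> S) \<inter> T = {}" "A \<inter> S = {}" "B \<inter> S =
    {}" using assms(2) by (auto simp: disjoint4_def)
  ultimately have "card (A \<union> S \<union> T) = card A + card S + card T" "card (B \<union> S) = card B + card S"
    by (simp_all add: card_Un_disjoint)
  then show ?thesis using \<open>finite A\<close> \<open>finite B\<close> \<open>finite S\<close> \<open>finite T\<close>
    by (simp add: normal_word_def length_letters)
qed

lemma valid_normal_word: "A \<union> B \<union> S \<union> T \<subseteq> {1..r} \<Longrightarrow> valid r (normal_word A B S T)"
  using finite_index_sets[of A B S T r] by (simp add: normal_word_def valid_letters)

text \<open>For each index the first letter decides: a step down requires \<open>x\<close> on the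
  upper side of the cube, a step up on the lower side, and the following letters stay inside. For
  cubes written as \<open>lower x Z\<close>, the conditions on \<open>S\<close> and \<open>T\<close>
  become the monomial \<open>indic S T\<close>, while those on \<open>A\<close> and \<open>B\<close>
  are common to all words with the same ends.\<close>

lemma walk_in_normal_word:
  assumes sub: "A \<union> B \<union> S \<union> T \<subseteq> {1..r}" and d: "disjoint4 A B S T"
  shows "walk_in r z x (normal_word A B S T) \<longleftrightarrow>
    in_cube r z x \<and> (\<forall>i\<in>B \<union> S. x i = z i + 1) \<and> (\<forall>i\<in>A \<union> T. x i = z i)"
proof -
  have f: "finite A" "finite B" "finite S" "finite T"
    using finite_index_sets[OF sub] by simp_all
  let ?x = "endp x (letters (B \<union> S) False)"
  let ?x' = "endp ?x (letters (A \<union> S \<union> T) True)"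
  have x: "?x i = (if i \<in> B \<union> S then x i - 1 else x i)" for i
    using f by (simp add: endp_letters)
  have x': "?x' i = (if i \<in> B then x i - 1 else if i \<in> A \<union> T then x i + 1 else x i)" for i
    using f d unfolding disjoint4_def by (auto simp: endp_letters)
  have "walk_in r z x (normal_word A B S T) \<longleftrightarrow>
    (in_cube r z x \<and> (\<forall>i\<in>B \<union> S. x i = z i + 1)) \<and>
    (in_cube r z ?x \<and> (\<forall>i\<in>A \<union> S \<union> T. ?x i = z i)) \<and>
    (in_cube r z ?x' \<and> (\<forall>i\<in>T. ?x' i = z i + 1))"
    unfolding normal_word_def walk_in_append
    using walk_in_letters[of "B \<union> S" r z x False] walk_in_letters[of "A \<union> S \<union> T" r z ?x True]
      walk_in_letters[of T r z ?x' False] sub by simp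
  also have "\<dots> \<longleftrightarrow> in_cube r z x \<and> (\<forall>i\<in>B \<union> S. x i = z i + 1) \<and> (\<forall>i\<in>A \<union> T. x i = z i)"
    (is "?L \<longleftrightarrow> ?R")
  proof
    assume ?L
    then show ?R using d unfolding x disjoint4_def by (auto split: if_splits)
  next
    assume R: ?R
    then have c: "z i \<le> x i \<and> x i \<le> z i + 1" if
      "i \<in> {1..r}" for i using that unfolding in_cube_def by blast
    have "in_cube r z ?x" unfolding in_cube_def x using R c by auto
    moreover have "in_cube r z ?x'" unfolding in_cube_def x' using R c by auto
    moreover have "\<forall>i\<in>A \<union> S \<union> T. ?x i = z i" unfolding x using R d by (auto simp: disjoint4_def)
    moreover have "\<forall>i\<in>T. ?x' i = z i + 1" unfolding x' using R d by (auto simp: disjoint4_def)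
    ultimately show ?L using R by blast
  qed
  finally show ?thesis .
qed

text \<open>The unit cubes that contain $x$ are represented by their least vertices.\<close>

definition lower :: "(nat \<Rightarrow> int) \<Rightarrow> nat set \<Rightarrow> nat \<Rightarrow> int" where
  "lower x Z i = (if i \<in> Z then x i - 1 else x i)"

definition cubes :: "nat \<Rightarrow> (nat \<Rightarrow> int) \<Rightarrow> (nat \<Rightarrow> int) set" where
  "cubes r x = lower x ` Pow {1..r}"

lemma finite_cubes [simp]: "finite (cubes r x)"
  by (simp add: cubes_def)

lemma inj_lower: "inj (lower x)"
proof (rule injI)
  fix Y Z assume eq: "lower x Y = lower x Z"
  have "i \<in> K \<longleftrightarrow> lower x K i \<noteq> x i" for i K by (simp add: lower_def)
  then show "Y = Z" using eq by (metis subsetI subset_antisym)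
qed

lemma in_cube_lower: "Z \<subseteq> {1..r} \<Longrightarrow> in_cube r (lower x Z) x"
  by (simp add: in_cube_def lower_def)

lemma cubes_iff:
  assumes "x \<in> Zlat r"
  shows "z \<in> cubes r x \<longleftrightarrow> z \<in> Zlat r \<and> in_cube r z x"
proof
  assume "z \<in> cubes r x"
  then show "z \<in> Zlat r \<and> in_cube r z x" using assms in_cube_lower
    by (auto simp: cubes_def Zlat_def) (auto simp: lower_def)
next
  assume z: "z \<in> Zlat r \<and> in_cube r z x"
  have "z = lower x {i \<in> {1..r}. z i \<noteq> x i}"
  proof
    fix i
    show "z i = lower x {i \<in> {1..r}. z i \<noteq> x i} i"
    proof (cases "i \<in> {1..r}")
      case True
      then have "z i \<le> x i" "x i \<le> z i + 1" using z unfolding in_cube_def by blast+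
      then show ?thesis using True by (auto simp: lower_def)
    next
      case False
      then show ?thesis using z assms by (auto simp: Zlat_def lower_def)
    qed
  qed
  then show "z \<in> cubes r x" unfolding cubes_def by blast
qed

section \<open>Signs, weights and the trace of a closed word\<close>

definition psign :: "nat \<Rightarrow> (nat \<Rightarrow> int) \<Rightarrow> 'k::comm_ring_1" where
  "psign r z = (if even (\<Sum>i\<in>{1..r}. z i) then 1 else - 1)"

lemma psign_square: "psign r z * psign r z = 1"
  by (simp add: psign_def)

lemma psign_lower:
  assumes "Z \<subseteq> {1..r}"
  shows "psign r (lower x Z) = psign r x * (- 1) ^ card Z"
proof -
  have fin: "finite Z" using assms finite_subset by blast
  have "(\<Sum>i\<in>{1..r}. lower x Z i) = (\<Sum>i\<in>{1..r}. x i - (if i \<in> Z then 1 else 0))"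
    by (rule sum.cong) (auto simp: lower_def)
  also have "\<dots> = (\<Sum>i\<in>{1..r}. x i) - (\<Sum>i\<in>{1..r}. if i \<in> Z then 1 else 0)"
    by (simp add: sum_subtractf)
  also have "(\<Sum>i\<in>{1..r}. if i \<in> Z then 1 else 0 :: int) = int (card Z)"
    using assms by (simp add: sum.If_cases Int_absorb1)
  finally have "(\<Sum>i\<in>{1..r}. lower x Z i) = (\<Sum>i\<in>{1..r}. x i) - int (card Z)" .
  then show ?thesis by (auto simp: psign_def)
qed

text \<open>\<open>shift r 1 z\<close> is the greatest vertex of the cube; for a down-closed
  \<open>D\<close> the condition says that the whole cube lies in \<open>D\<close>.\<close>

definition cweight :: "nat \<Rightarrow> (nat \<Rightarrow> int) set \<Rightarrow> (nat \<Rightarrow> int) \<Rightarrow> 'k::comm_ring_1" where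
  "cweight r D z = (if shift r 1 z \<in> D then psign r z else 0)"

definition ctrace :: "nat \<Rightarrow> (nat \<Rightarrow> int) set \<Rightarrow> (nat \<Rightarrow> int) \<Rightarrow> word \<Rightarrow> 'k::comm_ring_1" where
  "ctrace r D x w = (\<Sum>z\<in>cubes r x. cweight r D z * cube_eval r z x w)"

lemma compat_ctrace: "compat r (ctrace r D x)"
  unfolding ctrace_def[abs_def] by (rule compat_sum) (rule compat_cube_eval)

lemma ctrace_loop:
  assumes "i \<in> {1..r}"
  shows "ctrace r D x (u @ (i, True) # (i, False) # v) +
    ctrace r D x (u @ (i, False) # (i, True) # v) = ctrace r D x (u @ v)"
  unfolding ctrace_def
  by (simp add: cube_eval_append[of _ _ _ u] cube_eval_loop[OF assms] flip: sum.distrib distrib_left)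

text \<open>A cube that contributes to either side contains both \<open>x\<close> and
  \<open>y\<close>. On these common cubes the value of a concatenation is a product of two scalars,
  which commute.\<close>

lemma ctrace_cyclic:
  assumes x: "x \<in> Zlat r" and v: "valid r u" "valid r v" and e: "endp x u = y" "endp y v = x"
  shows "ctrace r D x (u @ v) = (ctrace r D y (v @ u) :: 'k::comm_ring_1)"
proof -
  have y: "y \<in> Zlat r" using endp_Zlat[OF x v(1)] e by simp
  let ?C = "cubes r x \<inter> cubes r y"
  have C: "z \<in> ?C" if "z \<in> cubes r x" "cube_eval r z x (u @ v) \<noteq> (0 :: 'k)" for z
  proof -
    have "in_cube r z y" using that(2) e(1) by
      (auto simp: cube_eval_def walk_in_append dest: walk_in_in_cube split: if_splits)
    then show ?thesis using that(1) by (simp add: cubes_iff[OF x] cubes_iff[OF y])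
  qed
  have C': "z \<in> ?C" if "z \<in> cubes r y" "cube_eval r z y (v @ u) \<noteq> (0 :: 'k)" for z
  proof -
    have "in_cube r z x" using that(2) e(2) by
      (auto simp: cube_eval_def walk_in_append dest: walk_in_in_cube split: if_splits)
    then show ?thesis using that(1) by (simp add: cubes_iff[OF x] cubes_iff[OF y])
  qed
  have "ctrace r D x (u @ v) = (\<Sum>z\<in>?C. cweight r D z * cube_eval r z x (u @ v) :: 'k)"
    unfolding ctrace_def by (rule sum.mono_neutral_right) (use C in \<open>auto, metis mult_zero_right\<close>)
  also have "\<dots> = (\<Sum>z\<in>?C. cweight r D z * cube_eval r z y (v @ u))"
    by (rule sum.cong) (simp_all add: cube_eval_append e)
  also have "\<dots> = ctrace r D y (v @ u)"
    unfolding ctrace_def by (rule sum.mono_neutral_left) (use C' in \<open>auto, metis mult_zero_right\<close>)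
  finally show ?thesis .
qed

lemma shift_Zlat: "shift r n x \<in> Zlat r"
  by (simp add: shift_def Zlat_def)

lemma shift_inverse: "x \<in> Zlat r \<Longrightarrow> shift r (- 1) (shift r 1 x) = x"
  by (auto simp: shift_def Zlat_def)

text \<open>Coordinate \<open>i\<close> is constant along \<open>w\<close>, so only its initial
  value matters for the position of the cube in this direction.\<close>

lemma walk_in_unused:
  assumes "restrict i w = []" "\<And>j. j \<in> {1..r} \<Longrightarrow> j \<noteq> i \<Longrightarrow> z j = z' j" "z i \<le> x i" "x i \<le> z i + 1"
    "z' i \<le> x i" "x i \<le> z' i + 1"
  shows "walk_in r z x w \<longleftrightarrow> walk_in r z' x w"
  using assms
proof (induction w arbitrary: x)
  case (Cons l w)
  have "fst l \<noteq> i" "restrict i w = []" using Cons.prems(1) by (auto split: if_splits)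
  moreover from this have "step l x i = x i" by (auto simp: step_def inc_def dec_def)
  ultimately have "walk_in r z (step l x) w \<longleftrightarrow> walk_in r z' (step l x) w"
    using Cons by simp
  moreover have "in_cube r z x \<longleftrightarrow> in_cube r z' x"
    unfolding in_cube_def using Cons.prems by metis
  ultimately show ?case by simp
next
  case Nil
  then show ?case unfolding walk_in.simps in_cube_def by metis
qed

lemma length_restrict: "length (restrict i w) = count_list w (i, True) + count_list w (i, False)"
proof (induction w)
  case (Cons l w)
  then show ?case by (cases l; cases "snd l") auto
qed simp

text \<open>A closed word contains as many \<open>(i, True)\<close> as \<open>(i, False)\<close>. If
  every index occurred, its length would be at least \<open>2 * r\<close>.\<close>

lemma exists_unused_index:
  assumes "valid r w" "endp x w = x" "length w = 2 * (r - 1)" "1 \<le> r"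
  shows "\<exists>i\<in>{1..r}. restrict i w = []"
proof (rule ccontr)
  assume n: "\<not> ?thesis"
  have "2 \<le> length (restrict i w)" if "i \<in> {1..r}" for i
  proof -
    have "x i = x i + int (count_list w (i, True)) - int (count_list w (i, False))"
      using endp_apply[of x w i] assms(2) by simp
    then have "count_list w (i, True) = count_list w (i, False)" by simp
    moreover have "length (restrict i w) \<noteq> 0" using n that by auto
    ultimately show ?thesis unfolding length_restrict by presburger
  qed
  then have "(\<Sum>i\<in>{1..r}. 2) \<le> (\<Sum>i\<in>{1..r}. length (restrict i w))" by (intro sum_mono)
  then show False using length_eq_restrict[OF assms(1)] assms(3,4) by simp
qed

lemma ctrace_vanishes:
  assumes r: "1 \<le> r" and D: "down_closed r D" and x: "x \<in> Zlat r" "x \<notin> D - shift r (- 1) ` D"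
    and w: "valid r w" "endp x w = x" "length w = 2 * (r - 1)"
  shows "ctrace r D x w = (0 :: 'k::comm_ring_1)"
proof (cases "x \<in> D")
  case False
  \<comment> \<open>The greatest vertex of a cube around \<open>x\<close> lies above
    \<open>x\<close>, and \<open>D\<close> is down-closed.\<close>
  have "shift r 1 z \<notin> D" if "z \<in> cubes r x" for z
  proof
    assume s: "shift r 1 z \<in> D"
    have "x i \<le> shift r 1 z i" for i
    proof (cases "i \<in> {1..r}")
      case True
      have "in_cube r z x" using that cubes_iff[OF x(1)] by blast
      then have "x i \<le> z i + 1" using True unfolding in_cube_def by blast
      then show ?thesis using True by (simp add: shift_def)
    qed (use x in \<open>auto simp: shift_def Zlat_def\<close>)
    then have "x \<in> D" using D s x(1) unfolding down_closed_def by (auto simp: le_fun_def)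
    then show False using False by simp
  qed
  then show ?thesis by (simp add: ctrace_def cweight_def)
next
  case True
  then obtain t where t: "t \<in> D" "x = shift r (- 1) t" using x by auto
  have tZ: "t \<in> Zlat r" using D t by (auto simp: down_closed_def)
  \<comment> \<open>Now \<open>t\<close> is \<open>x\<close> raised by one in every coordinate. It
    lies in \<open>D\<close> and above the greatest vertex of every cube around \<open>x\<close>, so
    no weight is cut off.\<close>
  have psign_weight: "cweight r D z = (psign r z :: 'k)" if "z \<in> cubes r x" for z
  proof -
    have "shift r 1 z i \<le> t i" for i
    proof (cases "i \<in> {1..r}")
      case True
      have "in_cube r z x" using that cubes_iff[OF x(1)] by blast
      then have "z i \<le> x i" using True unfolding in_cube_def by blast
      then show ?thesis using True t by (simp add: shift_def)
    qed (use tZ in \<open>auto simp: shift_def Zlat_def\<close>)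
    then have "shift r 1 z \<in> D" using D t shift_Zlat unfolding down_closed_def
      by (auto simp: le_fun_def)
    then show ?thesis by (simp add: cweight_def)
  qed
  obtain i where i: "i \<in> {1..r}" "restrict i w = []" using exists_unused_index[OF w r] by blast
  have "ctrace r D x w = (\<Sum>z\<in>cubes r x. psign r z * cube_eval r z x w :: 'k)"
    unfolding ctrace_def by (simp add: psign_weight)
  also have "\<dots> = (\<Sum>Z\<in>Pow {1..r}. psign r (lower x Z) * cube_eval r (lower x Z) x w)"
    unfolding cubes_def by (subst sum.reindex) (auto intro: inj_on_subset[OF inj_lower])
  also have "\<dots> = 0"
  proof (rule sum_toggle_cancel[where a = i])
    fix Z assume Z: "Z \<in> Pow {1..r}" "i \<notin> Z"
    have fin: "finite Z" using Z finite_subset by blast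
    have "walk_in r (lower x (insert i Z)) x w \<longleftrightarrow> walk_in r (lower x Z) x w"
      by (rule walk_in_unused[OF i(2)]) (auto simp: lower_def)
    then have "cube_eval r (lower x (insert i Z)) x w =
      (cube_eval r (lower x Z) x w :: 'k)" by (simp add: cube_eval_def)
    moreover have "psign r (lower x (insert i Z)) = (- psign r (lower x Z) :: 'k)"
      using Z i fin by (simp add: psign_lower)
    ultimately show "insert i Z \<in> Pow {1..r} \<and>
      psign r (lower x (insert i Z)) * cube_eval r (lower x (insert i Z)) x w =
         - (psign r (lower x Z) * cube_eval r (lower x Z) x w :: 'k)" using Z i by simp
  qed auto
  finally show ?thesis .
qed

section \<open>The radical of the trace on words\<close>

lemma loop_op_pow_vanishes:
  assumes r: "1 \<le> r" and van: "\<And>u v. valid r u \<Longrightarrow> endp x u \<notin> X \<Longrightarrow> f (u @ v) = 0"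
    and u: "valid r u" "endp x u \<notin> X"
  shows "(loop_op ^^ n) f (u @ v) = 0"
  using u
proof (induction n arbitrary: u)
  case (Suc n)
  \<comment> \<open>A loop inserted at the start returns to \<open>x\<close>, so the longer word
    still passes through the vertex outside \<open>X\<close>.\<close>
  have "(loop_op ^^ n) f (([(1, s), (1, \<not> s)] @ u) @ v) = 0" for s
    by (rule Suc.IH) (use Suc.prems r step_inverse[of 1 "\<not> s" x] in auto)
  from this[of True] this[of False] show ?case by (simp add: loop_op_def[of "(loop_op ^^ n) f"])
qed (simp add: van)

text \<open>The ends determine \<open>A\<close> and \<open>B\<close>. Hence among the normal forms
  of all words from \<open>x\<close> to \<open>y\<close> only \<open>S\<close>, \<open>T\<close> and
  the number of loops vary.\<close>

lemma normal_word_endpoints: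
  assumes sub: "A \<union> B \<union> S \<union> T \<subseteq> {1..r}" and d: "disjoint4 A B S T"
    and e: "endp x (normal_word A B S T) = y"
  shows "A = {i\<in>{1..r}. y i = x i + 1}" "B = {i\<in>{1..r}. y i = x i - 1}"
    "\<And>i. i \<notin> A \<Longrightarrow> i \<notin> B \<Longrightarrow> y i = x i"
proof -
  have y: "y i = x i + (if i \<in> A then 1 else 0) - (if i \<in> B then 1 else 0)" for i
    using endp_normal_word[OF sub d, of x i] e by simp
  show "A = {i\<in>{1..r}. y i = x i + 1}" "B = {i\<in>{1..r}. y i = x i - 1}"
    using sub d by (auto simp: y disjoint4_def)
  show "y i = x i" if "i \<notin> A" "i \<notin> B" for i using that by (simp add: y)
qed

text \<open>The return word goes up along \<open>B\<close> and \<open>R - U\<close>, then down along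
  \<open>A\<close> and \<open>R - U\<close>. This fixes the side of the cube in every direction
  outside \<open>U\<close> and leaves the directions in \<open>U\<close> free, so a sum over the
  cubes around \<open>x\<close> becomes a sum over the subsets of \<open>U\<close>. With the signs
  from \<open>cweight\<close> it will be a Moebius coefficient at \<open>U\<close>.\<close>

lemma pairing_reindex:
  assumes x: "x \<in> Zlat r" and U: "U \<subseteq> R" and ABR: "A \<union> B \<union> R = {1..r}" "A \<inter> B = {}" "A \<inter> R =
    {}" "B \<inter> R = {}"
    and y: "\<And>i. y i = x i + (if i \<in> A then 1 else 0) - (if i \<in> B then 1 else 0)"
  shows "(\<Sum>z\<in>cubes r x. h z * cube_eval r z y (letters (B \<union> (R - U)) True @ letters (A \<union>
    (R - U)) False)) =
    (\<Sum>Z\<in>Pow U. h (lower x (B \<union> Z)) :: 'k::comm_ring_1)"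
proof -
  let ?v = "letters (B \<union> (R - U)) True @ letters (A \<union> (R - U)) False"
  have fin: "finite A" "finite B" "finite R" "finite U"
    using ABR(1) U finite_index_sets[of A B R U r] by auto
  have sub: "B \<union> (R - U) \<subseteq> {1..r}" "A \<union> (R - U) \<subseteq> {1..r}" using ABR(1) by auto
  have finv: "finite (B \<union> (R - U))" "finite (A \<union> (R - U))" using fin by auto
  have yR: "y i = x i" if "i \<in> R" for i using y[of i] that ABR by auto
  have yA: "y i = x i + 1" if "i \<in> A" for i using y[of i] that ABR by auto
  have yB: "y i = x i - 1" if "i \<in> B" for i using y[of i] that ABR by auto
  have valid: "valid r ?v" using sub finv by (simp add: valid_letters)
  let ?y = "endp y (letters (B \<union> (R - U)) True)"
  have y': "?y i = (if i \<in> B \<union> (R - U) then y i + 1 else y i)" for i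
    using finv by (simp add: endp_letters)
  have walk_in: "walk_in r z y ?v \<longleftrightarrow> in_cube r z y \<and> (\<forall>i\<in>B \<union> (R - U). y i = z i) \<and>
      in_cube r z ?y \<and> (\<forall>i\<in>A \<union> (R - U). ?y i = z i + 1)" for z
    unfolding walk_in_append walk_in_letters[OF sub(1)] walk_in_letters[OF sub(2)] by simp
  have one: "cube_eval r (lower x (B \<union> Z)) y ?v = (1 :: 'k)" if Z: "Z \<subseteq> U" for Z
  proof -
    have Z': "Z \<inter> A = {}" "Z \<inter> B = {}" "Z \<inter> (R - U) = {}" "Z \<subseteq> R" using Z U ABR by auto
    have c: "in_cube r (lower x (B \<union> Z)) y"
      unfolding in_cube_def using Z'(1,2) ABR(2) by (auto simp: lower_def y)
    moreover have b: "\<forall>i\<in>B \<union> (R - U). y i = lower x (B \<union> Z) i"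
      using Z' yB yR by (auto simp: lower_def)
    moreover have "in_cube r (lower x (B \<union> Z)) ?y"
    proof -
      have "walk_in r (lower x (B \<union> Z)) y (letters (B \<union> (R - U)) True)"
        unfolding walk_in_letters[OF sub(1)] using b c by simp
      then show ?thesis by (rule walk_in_endp)
    qed
    moreover have "\<forall>i\<in>A \<union> (R - U). ?y i = lower x (B \<union> Z) i + 1"
    proof
      fix i assume i: "i \<in> A \<union> (R - U)"
      show "?y i = lower x (B \<union> Z) i + 1"
      proof (cases "i \<in> A")
        case True
        then have "i \<notin> B" "i \<notin> R" "i \<notin> Z" using ABR Z' by auto
        then show ?thesis using True yA[of i] by (simp add: y' lower_def)
      next
        case False
        then have "i \<in> R" "i \<notin> U" "i \<notin> Z" "i \<notin> B" using i ABR Z' by auto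
        then show ?thesis using yR[of i] by (simp add: y' lower_def)
      qed
    qed
    ultimately show ?thesis using valid by (simp add: cube_eval_def walk_in)
  qed
  have zero: "cube_eval r z y ?v = (0 :: 'k)" if z:
    "z \<in> cubes r x - (\<lambda>Z. lower x (B \<union> Z)) ` Pow U" for z
  proof (rule ccontr)
    assume "cube_eval r z y ?v \<noteq> (0 :: 'k)"
    then have i: "walk_in r z y ?v" by (auto simp: cube_eval_def split: if_splits)
    then have i2: "\<forall>i\<in>B \<union> (R - U). y i = z i" "\<forall>i\<in>A \<union> (R - U). ?y i = z i + 1"
      unfolding walk_in by blast+
    obtain W where W: "W \<subseteq> {1..r}" "z = lower x W" using z by (auto simp: cubes_def)
    have "B \<subseteq> W"
    proof
      fix i assume "i \<in> B"
      then have "z i = x i - 1" using i2(1) yB by force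
      then show "i \<in> W" using W(2) by (auto simp: lower_def split: if_splits)
    qed
    moreover have "i \<notin> W" if "i \<in> R - U" for i
    proof -
      have "z i = x i" using i2(1) yR that by force
      then show ?thesis using W(2) by (auto simp: lower_def split: if_splits)
    qed
    moreover have "i \<notin> W" if "i \<in> A" for i
    proof -
      have "?y i = x i + 1" using yA[OF that] ABR that by (auto simp: y')
      then have "z i = x i" using i2(2) that by force
      then show ?thesis using W(2) by (auto simp: lower_def split: if_splits)
    qed
    ultimately have "W = B \<union> (W - B)" "W - B \<subseteq> U" using W(1) ABR(1) by blast+
    then have "z \<in> (\<lambda>Z. lower x (B \<union> Z)) ` Pow U" using W(2) by (metis PowI image_eqI)
    then show False using z by blast
  qed
  have inj: "inj_on (\<lambda>Z. lower x (B \<union> Z)) (Pow U)"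
  proof (rule inj_onI)
    fix Y Z assume h: "Y \<in> Pow U" "Z \<in> Pow U" "lower x (B \<union> Y) = lower x (B \<union> Z)"
    then have "B \<union> Y = B \<union> Z" using inj_lower by (metis injD)
    then show "Y = Z" using h(1,2) U ABR(4) by blast
  qed
  have subc: "(\<lambda>Z. lower x (B \<union> Z)) ` Pow U \<subseteq> cubes r x"
    using U ABR(1) unfolding cubes_def by blast
  have "(\<Sum>z\<in>cubes r x. h z * cube_eval r z y ?v) =
    (\<Sum>z\<in>(\<lambda>Z. lower x (B \<union> Z)) ` Pow U. h z * cube_eval r z y ?v)"
    by (rule sum.mono_neutral_right[OF finite_cubes subc]) (simp add: zero)
  also have "\<dots> = (\<Sum>Z\<in>Pow U. h (lower x (B \<union> Z)) * cube_eval r (lower x (B \<union> Z)) y ?v)"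
    by (simp add: sum.reindex[OF inj])
  also have "\<dots> = (\<Sum>Z\<in>Pow U. h (lower x (B \<union> Z)))"
    by (rule sum.cong) (simp_all only: one Pow_iff mult_1_right)
  finally show ?thesis .
qed

text \<open>The radical condition speaks only of return words of the exact complementary length.
  Shorter ones are padded by loops, which the trace does not see.\<close>

lemma ctrace_pad:
  assumes r: "1 \<le> r"
    and hyp: "\<And>v. valid r v \<Longrightarrow> endp y v = x \<Longrightarrow> l + length v = N \<Longrightarrow>
       (\<Sum>p\<in>P. c p * ctrace r D x (w p @ v)) = (0 :: 'k::comm_ring_1)"
    and v: "valid r v" "endp y v = x" "l + length v + 2 * k = N"
  shows "(\<Sum>p\<in>P. c p * ctrace r D x (w p @ v)) = 0"
  using v
proof (induction k arbitrary: v)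
  case (Suc k)
  have "(\<Sum>p\<in>P. c p * ctrace r D x (w p @ (1, s) # (1, \<not> s) # v)) = 0" for s
    by (rule Suc.IH) (use Suc.prems r step_inverse[of 1 "\<not> s" y] in auto)
  from this[of True] this[of False]
  have "(\<Sum>p\<in>P. c p * (ctrace r D x (w p @ (1, True) # (1, False) # v) +
    ctrace r D x (w p @ (1, False) # (1, True) # v))) = 0"
    by (simp add: distrib_left sum.distrib)
  moreover have "1 \<in> {1..r}" using r by simp
  ultimately show ?case by (simp only: ctrace_loop)
qed (use hyp in simp)

text \<open>The core of the non-degeneracy: the combination of the \<open>w p\<close> is a
  homogeneous element of the radical with ends \<open>x\<close> and \<open>y\<close>, and
  \<open>f\<close> stands for an arbitrary functional on the quotient. Normal forms turn the words
  into monomials in the coordinates of \<open>R\<close>, and \<open>cube_functional_vanishes\<close>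
  concludes.\<close>

lemma radical_annihilated:
  fixes f :: "word \<Rightarrow> 'k::comm_ring_1" and c :: "'p \<Rightarrow> 'k"
  assumes r: "1 \<le> r" and D: "down_closed r D" and x: "x \<in> Zlat r" and P: "finite P"
    and w: "\<And>p. p \<in> P \<Longrightarrow> valid r (w p) \<and> endp x (w p) = y \<and> length (w p) = l"
    and f: "compat r f"
    and van: "\<And>u v. valid r u \<Longrightarrow> endp x u \<notin> D - shift r (- 1) ` D \<Longrightarrow> f (u @ v) = 0"
    and hyp: "\<And>v. valid r v \<Longrightarrow> endp y v = x \<Longrightarrow> l + length v = 2 * (r - 1) \<Longrightarrow>
       (\<Sum>p\<in>P. c p * ctrace r D x (w p @ v)) = 0"
  shows "(\<Sum>p\<in>P. c p * f (w p)) = 0"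
proof -
  define P' where "P' = {p \<in> P. \<not> (\<forall>g :: word \<Rightarrow> 'k. compat r g \<longrightarrow> g (w p) = 0)}"
  have P': "P' \<subseteq> P" "finite P'" using P by (auto simp: P'_def)
  have zero: "g (w p) = 0" if "p \<in> P - P'" "compat r g" for p and g :: "word \<Rightarrow> 'k"
    using that by (auto simp: P'_def)
  have sumP: "(\<Sum>p\<in>P. c p * g (w p)) = (\<Sum>p\<in>P'. c p * g (w p))" if "compat r g" for g :: "word \<Rightarrow> 'k"
    by (rule sum.mono_neutral_right) (use P P' zero[OF _ that] in auto)
  show ?thesis
  proof (cases "P' = {}")
    case True
    then show ?thesis using sumP[OF f] by simp
  next
    case False
    define A where "A = {i\<in>{1..r}. y i = x i + 1}"
    define B where "B = {i\<in>{1..r}. y i = x i - 1}"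
    define R where "R = {1..r} - A - B"
    have "\<forall>p\<in>P'. \<exists>q. case q of (S, T, n) \<Rightarrow> A \<union> B \<union> S \<union> T \<subseteq> {1..r} \<and> disjoint4 A B S T \<and>
       (\<forall>g :: word \<Rightarrow> 'k. compat r g \<longrightarrow> g (w p) = (loop_op ^^ n) g (normal_word A B S T)) \<and>
       l = 2 * n + length (normal_word A B S T) \<and> endp x (normal_word A B S T) = y"
    proof
      fix p assume p: "p \<in> P'"
      have wp: "valid r (w p)" "endp x (w p) = y" "length (w p) = l" using p P' w by auto
      have "\<not> (\<forall>g :: word \<Rightarrow> 'k. compat r g \<longrightarrow> g (w p) = 0)" using p by (simp add: P'_def)
      with compat_normal_form[OF wp(1), where 'k = 'k]
      show "\<exists>q. case q of (S, T, n) \<Rightarrow> A \<union> B \<union> S \<union> T \<subseteq> {1..r} \<and> disjoint4 A B S T \<and>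
         (\<forall>g :: word \<Rightarrow> 'k. compat r g \<longrightarrow> g (w p) = (loop_op ^^ n) g (normal_word A B S T)) \<and>
         l = 2 * n + length (normal_word A B S T) \<and> endp x (normal_word A B S T) = y"
      proof (elim disjE exE conjE)
        assume "\<forall>g :: word \<Rightarrow> 'k. compat r g \<longrightarrow> g (w p) = 0"
          "\<not> (\<forall>g :: word \<Rightarrow> 'k. compat r g \<longrightarrow> g (w p) = 0)"
        then show ?thesis by contradiction
      next
        fix A' B' S T n
        assume q: "A' \<union> B' \<union> S \<union> T \<subseteq> {1..r}" "disjoint4 A' B' S T"
          "\<forall>g :: word \<Rightarrow> 'k. compat r g \<longrightarrow> g (w p) = (loop_op ^^ n) g (normal_word A' B' S T)"
          "length (w p) = 2 * n + length (normal_word A' B' S T)"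
          "\<forall>x. endp x (w p) = endp x (normal_word A' B' S T)"
        have e: "endp x (normal_word A' B' S T) = y" using q(5) wp(2) by simp
        have "A' = A" "B' = B" using normal_word_endpoints[OF q(1,2) e] by (simp_all only: A_def B_def)
        then show ?thesis using q e wp(3) by (intro exI[of _ "(S, T, n)"]) simp
      qed
    qed
    then obtain q where q: "\<forall>p\<in>P'. case q p of (S, T, n) \<Rightarrow> A \<union> B \<union> S \<union> T \<subseteq> {1..r} \<and> disjoint4 A B S T \<and>
       (\<forall>g :: word \<Rightarrow> 'k. compat r g \<longrightarrow> g (w p) = (loop_op ^^ n) g (normal_word A B S T)) \<and>
       l = 2 * n + length (normal_word A B S T) \<and> endp x (normal_word A B S T) = y"
      by (rule bchoice[THEN exE])
    define S where "S p = fst (q p)" for p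
    define T where "T p = fst (snd (q p))" for p
    define n where "n p = snd (snd (q p))" for p
    have q': "A \<union> B \<union> S p \<union> T p \<subseteq> {1..r}" "disjoint4 A B (S p) (T p)"
       "\<And>g :: word \<Rightarrow> 'k. compat r g \<Longrightarrow> g (w p) = (loop_op ^^ n p) g (normal_word A B (S p) (T p))"
       "l = 2 * n p + length (normal_word A B (S p) (T p))" "endp x (normal_word A B (S p) (T p)) = y"
      if "p \<in> P'" for p
      using bspec[OF q that] by (simp_all add: S_def T_def n_def split: prod.splits)
    \<comment> \<open>Since \<open>x\<close>, \<open>y\<close> and the length \<open>l\<close> are
      fixed, all words in \<open>P'\<close> have the same number \<open>d\<close> of loops, whether
      these occur in \<open>S\<close>, in \<open>T\<close> or as central factors; \<open>ld\<close>
      below shows that the division is exact.\<close>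
    define d where "d = (l - card A - card B) div 2"
    have l: "l = card A + card B + 2 * (n p + card (S p) + card (T p))" if "p \<in> P'" for p
      using q'(4)[OF that] length_normal_word[OF q'(1,2)[OF that]] by simp
    have d: "d = n p + card (S p) + card (T p)" if "p \<in> P'" for p
      using l[OF that] by (simp add: d_def)
    obtain p0 where p0: "p0 \<in> P'" using False by blast
    have ld: "l = card A + card B + 2 * d" using l[OF p0] d[OF p0] by simp
    have AB: "A \<inter> B = {}" "A \<union> B \<subseteq> {1..r}" by (auto simp: A_def B_def)
    have R: "finite R" "R \<subseteq> {1..r}" "A \<inter> R = {}" "B \<inter> R = {}" "A \<union> B \<union> R = {1..r}"
      using AB by (auto simp: R_def)
    have fAB: "finite A" "finite B" by (simp_all add: A_def B_def)
    have cardR: "card A + card B + card R = r"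
    proof -
      have "card (A \<union> B \<union> R) = card A + card B + card R"
        using AB R fAB by (subst card_Un_disjoint; (subst card_Un_disjoint)?) auto
      then show ?thesis using R(5) by simp
    qed
    have y: "y i = x i + (if i \<in> A then 1 else 0) - (if i \<in> B then 1 else 0)" for i
      using endp_normal_word[OF q'(1,2)[OF p0], of x i] q'(5)[OF p0] by simp
    have d4: "disjoint4 A B S T \<and> A \<union> B \<union> S \<union> T \<subseteq> {1..r}" if "S \<subseteq> R" "T \<subseteq> R" "S \<inter> T = {}" for S T
      using that AB R unfolding disjoint4_def by blast
    have ST: "S p \<subseteq> R \<and> T p \<subseteq> R \<and> S p \<inter> T p = {} \<and> card (S p) + card (T p) \<le> d" if "p \<in> P'" for p
      using q'(1,2)[OF that] d[OF that] R(5) unfolding disjoint4_def by auto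
    \<comment> \<open>The normal word is padded with central loops to the common length
      \<open>l\<close>.\<close>
    define m where "m S T = (loop_op ^^ (d - card S - card T)) f (normal_word A B S T)" for S T
    \<comment> \<open>The cubes that contain both \<open>x\<close> and \<open>y\<close> are
      \<open>lower x (B \<union> U)\<close> with \<open>U \<subseteq> R\<close>; \<open>G\<close> is
      the condition from the weight for these.\<close>
    define G where "G U \<longleftrightarrow> shift r 1 (lower x (B \<union> U)) \<in> D" for U
    have zcZ: "lower x Z \<in> Zlat r" if "Z \<subseteq> {1..r}" for Z
      using that cubes_iff[OF x, of "lower x Z"] by (auto simp: cubes_def)
    note fcop = compat_loop_op_pow[OF f]
    have van': "(loop_op ^^ k) f (u @ v) = 0" if "valid r u"
      "endp x u \<notin> D - shift r (- 1) ` D" for u v k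
      by (rule loop_op_pow_vanishes[where x = x and X =
        "D - shift r (- 1) ` D", OF r _ that]) (rule van)
    have "(\<Sum>p\<in>P'. c p * m (S p) (T p)) = 0"
    proof (rule cube_functional_vanishes[where R = R and d = d and G = G])
      \<comment> \<open>One padding loop is given the index \<open>i\<close> and split into its two
        halves: ba joins \<open>S\<close> and ab joins \<open>T\<close>.\<close>
      show "m S T = m (insert i S) T + m S (insert i T)"
        if s: "S \<subseteq> R" "T \<subseteq> R" "S \<inter> T = {}" "i \<in> R - (S \<union> T)" "card S + card T < d" for S T i
      proof -
        have fin: "finite S" "finite T" using s R finite_subset by blast+
        define k where "k = d - card S - card T - 1"
        have k: "d - card S - card T = Suc k" "d - card (insert i S) - card T = k"
          "d - card S - card (insert i T) = k" using s fin by (auto simp: k_def)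
        have i: "i \<in> {1..r}" "i \<notin> A" "i \<notin> B" "i \<notin> S" "i \<notin> T" using s R by auto
        let ?g = "(loop_op ^^ k) f"
        have "?g ((i, True) # (i, False) # normal_word A B S T) = ?g (normal_word A B S (insert i T))"
          by (rule compat_restrict_eq[OF fcop]) (use i fin fAB in \<open>auto simp: restrict_normal_word\<close>)
        moreover have "?g ((i, False) # (i, True) # normal_word A B S T) =
          ?g (normal_word A B (insert i S) T)"
          by (rule compat_restrict_eq[OF fcop]) (use i fin fAB in \<open>auto simp: restrict_normal_word\<close>)
        moreover have "m S T = ?g ((i, True) # (i, False) # normal_word A B S T) +
          ?g ((i, False) # (i, True) # normal_word A B S T)"
          using compat_central[OF fcop i(1), of k "[]" "normal_word A B S T"]
          by (simp only: m_def k append_Nil funpow.simps o_apply)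
        ultimately show ?thesis by (simp only: m_def k add.commute)
      qed
      show "G Z" if "Y \<subseteq> Z" "Z \<subseteq> R" "G Y" for Y Z
      proof -
        have "shift r 1 (lower x (B \<union> Z)) \<le> shift r 1 (lower x (B \<union> Y))"
          using that(1) by (auto simp: le_fun_def shift_def lower_def)
        then show ?thesis using that(3) D shift_Zlat unfolding G_def down_closed_def by blast
      qed
      \<comment> \<open>The normal word first descends to the least vertex of the cube. By
        \<open>G U\<close> this vertex is one of \<open>D\<close> shifted by -1, hence outside the
        Cubist set.\<close>
      show "m U {} = 0" if U: "U \<subseteq> R" "G U" for U
      proof -
        have BU: "B \<union> U \<subseteq> {1..r}" "finite (B \<union> U)" using U R AB fAB finite_subset by auto
        have "endp x (letters (B \<union> U) False) = lower x (B \<union> U)"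
          by (rule ext) (simp only: endp_letters[OF BU(2)], simp add: lower_def)
        moreover have "lower x (B \<union> U) \<in> shift r (- 1) ` D"
          using U(2) shift_inverse[OF zcZ[OF BU(1)]] unfolding G_def by (metis image_eqI)
        ultimately have "endp x (letters (B \<union> U) False) \<notin> D - shift r (- 1) ` D" by simp
        then show ?thesis unfolding m_def normal_word_def
          by (intro van') (use BU in \<open>simp_all add: valid_letters\<close>)
      qed
      \<comment> \<open>Here each index in \<open>U\<close> contributes ab, so up to commutations
        the word first climbs along \<open>A \<union> U\<close>. It reaches the greatest vertex of
        the cube belonging to \<open>R - U\<close>, which is not in \<open>D\<close>.\<close>
      show "m {} U = 0" if U: "U \<subseteq> R" "\<not> G (R - U)" for U
      proof -
        have AU: "A \<union> U \<subseteq> {1..r}" "finite (A \<union> U)" using U R AB fAB finite_subset by auto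
        have BU: "finite (B \<union> U)" "finite U" using U R fAB finite_subset by auto
        have "endp x (letters (A \<union> U) True) = shift r 1 (lower x (B \<union> (R - U)))"
        proof
          fix i
          have "i \<in> A \<union> U \<longleftrightarrow> i \<in> {1..r} \<and> i \<notin> B \<union> (R - U)" using AU R AB U by blast
          moreover have "x i = 0" if "i \<notin> {1..r}" using x that by (auto simp: Zlat_def)
          ultimately show "endp x (letters (A \<union> U) True) i = shift r 1 (lower x (B \<union> (R - U))) i"
            unfolding endp_letters[OF AU(2)] shift_def lower_def by auto
        qed
        then have "endp x (letters (A \<union> U) True) \<notin> D - shift r (- 1) ` D"
          using U(2) by (simp add: G_def)
        then have "(loop_op ^^ k) f (letters (A \<union> U) True @ letters (B \<union> U) False) = 0" for k
          by (intro van') (use AU in \<open>simp_all add: valid_letters\<close>)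
        moreover have "(loop_op ^^ k) f (normal_word A B {} U) =
          (loop_op ^^ k) f (letters (A \<union> U) True @ letters (B \<union> U) False)" for k
        proof (rule compat_restrict_eq[OF fcop])
          fix i
          show "restrict i (normal_word A B {} U) =
            restrict i (letters (A \<union> U) True @ letters (B \<union> U) False)"
            using AB(1) R(3,4) U(1) fAB BU AU by (auto simp: restrict_normal_word restrict_letters)
        qed
        ultimately show ?thesis by (simp add: m_def)
      qed
      show "(\<Sum>Z\<in>Pow U. (- 1) ^ card Z * (if G Z then \<Sum>p\<in>P'. c p * indic (S p) (T p) Z else 0)) = 0"
        if U: "U \<subseteq> R" "d < card U" for U
      proof -
        \<comment> \<open>The return word that leaves exactly the directions in \<open>U\<close>
          free.\<close>
        define v where "v = letters (B \<union> (R - U)) True @ letters (A \<union> (R - U)) False"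
        have fv: "finite (B \<union> (R - U))" "finite (A \<union> (R - U))" "finite U" "finite (R - U)"
          using fAB R U finite_subset by auto
        have vv: "valid r v" using fv AB R by (auto simp: v_def valid_letters)
        have end_v: "endp y v = x"
        proof
          fix i
          have d: "\<not> (i \<in> A \<and> i \<in> B)" "\<not> (i \<in> A \<and> i \<in> R)" "\<not> (i \<in> B \<and> i \<in> R)" using AB R by auto
          show "endp y v i = x i"
            unfolding v_def endp_simps endp_letters[OF fv(1)] endp_letters[OF fv(2)] y using d by auto
        qed
        have lv: "length v = card A + card B + 2 * (card R - card U)"
        proof -
          have "card (B \<union> (R - U)) = card B + card (R - U)" "card (A \<union> (R - U)) = card A + card (R - U)"
            using fAB fv R by (auto intro!: card_Un_disjoint)
          moreover have "card (R - U) = card R - card U" using U fv by (simp add: card_Diff_subset)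
          ultimately show ?thesis using fv by (simp add: v_def length_letters)
        qed
        have "card U \<le> card R" using U R by (simp add: card_mono)
        \<comment> \<open>The missing length is nonnegative precisely because
          \<open>d < card U\<close>; this is where the value 2(r-1) is decisive.\<close>
        then have "l + length v + 2 * (card U - d - 1) = 2 * (r - 1)"
          using lv ld U(2) cardR by linarith
        from ctrace_pad[OF r hyp vv end_v this]
        have 1: "(\<Sum>p\<in>P. c p * ctrace r D x (w p @ v)) = 0" .
        have 2: "(\<Sum>p\<in>P. c p * ctrace r D x (w p @ v)) = (\<Sum>p\<in>P'. c p * ctrace r D x (w p @ v))"
          by (rule sumP) (rule compat_suffix[OF compat_ctrace])
        define h where "h z = (\<Sum>p\<in>P'. c p * (cweight r D z * cube_eval r z x (w p)))" for z
        have "(\<Sum>p\<in>P'. c p * ctrace r D x (w p @ v)) =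
          (\<Sum>p\<in>P'. \<Sum>z\<in>cubes r x. c p * (cweight r D z * cube_eval r z x (w p)) * cube_eval r z y v)"
        proof (rule sum.cong)
          fix p assume "p \<in> P'"
          then have "endp x (w p) = y" using w P' by auto
          then show "c p * ctrace r D x (w p @ v) =
            (\<Sum>z\<in>cubes r x. c p * (cweight r D z * cube_eval r z x (w p)) * cube_eval r z y v)"
            by (simp add: ctrace_def cube_eval_append sum_distrib_left mult.assoc)
        qed simp
        also have "\<dots> = (\<Sum>z\<in>cubes r x. h z * cube_eval r z y v)"
          by (subst sum.swap) (simp add: h_def sum_distrib_right)
        also have "\<dots> = (\<Sum>Z\<in>Pow U. h (lower x (B \<union> Z)))"
          unfolding v_def by (rule pairing_reindex[OF x U(1) R(5) AB(1) R(3,4) y])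
        finally have 3: "(\<Sum>Z\<in>Pow U. h (lower x (B \<union> Z))) = 0" using 1 2 by simp
        \<comment> \<open>The sign common to all cubes in the sum; it squares to 1 and can be
          cancelled.\<close>
        define s where "s = (psign r x * (- 1) ^ card B :: 'k)"
        have "s * s = (psign r x * psign r x) * ((- 1) ^ card B * (- 1) ^ card B)"
          by (simp only: s_def mult_ac)
        then have ss: "s * s = 1" by (simp add: psign_square flip: power_mult_distrib)
        have h: "h (lower x (B \<union> Z)) = s * ((- 1) ^ card Z * (if G Z then \<Sum>p\<in>P'. c p * indic (S p)
          (T p) Z else 0))"
          if Z: "Z \<in> Pow U" for Z
        proof -
          have ZR: "Z \<subseteq> R" and BZ: "B \<union> Z \<subseteq> {1..r}" and fZ: "finite Z"
            using Z U R AB fv finite_subset by auto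
          have evZ: "cube_eval r (lower x (B \<union> Z)) x (w p) =
            (indic (S p) (T p) Z :: 'k)" if p: "p \<in> P'" for p
          proof -
            note qp = q'[OF p]
            have "cube_eval r (lower x (B \<union> Z)) x (w p) =
                ((loop_op ^^ n p) (cube_eval r (lower x (B \<union> Z)) x) (normal_word A B (S p)
                  (T p)) :: 'k)"
              by (rule qp(3)[OF compat_cube_eval])
            also have "\<dots> = (cube_eval r (lower x (B \<union> Z)) x (normal_word A B (S p) (T p)) :: 'k)"
              by (simp only: loop_op_cube_eval[OF r])
            also have "\<dots> = indic (S p) (T p) Z"
            proof -
              have "walk_in r (lower x (B \<union> Z)) x (normal_word A B (S p) (T p)) \<longleftrightarrow> S p \<subseteq> Z \<and>
                T p \<inter> Z = {}"
                unfolding walk_in_normal_word[OF qp(1,2)]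
                  using in_cube_lower[OF BZ, of x] qp(2) AB ZR R ST[OF p]
                unfolding disjoint4_def lower_def by auto
              then show ?thesis
                using valid_normal_word[OF qp(1)] by (simp add: cube_eval_def indic_def)
            qed
            finally show ?thesis .
          qed
          have "card (B \<union> Z) = card B + card Z" using fAB fZ ZR R by (intro card_Un_disjoint) auto
          then have "cweight r D (lower x (B \<union> Z)) = (if G Z then s * (- 1) ^ card Z else 0 :: 'k)"
            unfolding cweight_def G_def psign_lower[OF BZ] s_def by (simp add: power_add mult.assoc)
          then show ?thesis unfolding h_def
            by (simp add: evZ sum_distrib_left mult_ac cong: sum.cong_simp)
        qed
        have "s * (\<Sum>Z\<in>Pow U. (- 1) ^ card Z * (if G Z then \<Sum>p\<in>P'. c p * indic (S p)
          (T p) Z else 0)) = 0"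
          unfolding sum_distrib_left using 3 by (simp only: h cong: sum.cong)
        then have "s * s * (\<Sum>Z\<in>Pow U. (- 1) ^ card Z * (if G Z then \<Sum>p\<in>P'. c p * indic (S p)
          (T p) Z else 0)) = 0"
          by (simp only: mult.assoc mult_zero_right)
        then show ?thesis by (simp only: ss mult_1_left)
      qed
    qed (use P' R ST in auto)
    moreover have "(\<Sum>p\<in>P'. c p * f (w p)) = (\<Sum>p\<in>P'. c p * m (S p) (T p))"
    proof (rule sum.cong)
      fix p assume p: "p \<in> P'"
      have "d - card (S p) - card (T p) = n p" using d[OF p] by simp
      then show "c p * f (w p) = c p * m (S p) (T p)" using q'(3)[OF p f] by (simp add: m_def)
    qed simp
    ultimately show ?thesis using sumP[OF f] by simp
  qed
qed

section \<open>Quotients of algebras without unit\<close>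

text \<open>The record has no negation, so additive inverses are expressed through the scalar
  -1.\<close>

locale nu_alg =
  fixes A :: "('k::field, 'a) nu_algebra"
  assumes zero_closed: "alg_zero A \<in> alg_carrier A"
    and add_closed: "\<And>x y. x \<in> alg_carrier A \<Longrightarrow> y \<in> alg_carrier A \<Longrightarrow> alg_add A x y \<in> alg_carrier A"
    and scale_closed: "\<And>c x. x \<in> alg_carrier A \<Longrightarrow> alg_scale A c x \<in> alg_carrier A"
    and mult_closed: "\<And>x y. x \<in> alg_carrier A \<Longrightarrow> y \<in> alg_carrier A \<Longrightarrow> alg_mult A x y \<in> alg_carrier A"
    and add_assoc: "\<And>x y z. x \<in> alg_carrier A \<Longrightarrow> y \<in> alg_carrier A \<Longrightarrow> z \<in> alg_carrier A \<Longrightarrow>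
      alg_add A (alg_add A x y) z = alg_add A x (alg_add A y z)"
    and add_commute: "\<And>x y. x \<in> alg_carrier A \<Longrightarrow> y \<in> alg_carrier A \<Longrightarrow> alg_add A x y = alg_add A y x"
    and add_zero: "\<And>x. x \<in> alg_carrier A \<Longrightarrow> alg_add A x (alg_zero A) = x"
    and add_neg: "\<And>x. x \<in> alg_carrier A \<Longrightarrow> alg_add A x (alg_scale A (- 1) x) = alg_zero A"
    and scale_add: "\<And>c x y. x \<in> alg_carrier A \<Longrightarrow> y \<in> alg_carrier A \<Longrightarrow>
      alg_scale A c (alg_add A x y) = alg_add A (alg_scale A c x) (alg_scale A c y)"
    and mult_add_left: "\<And>x y z. x \<in> alg_carrier A \<Longrightarrow> y \<in> alg_carrier A \<Longrightarrow> z \<in> alg_carrier A \<Longrightarrow>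
      alg_mult A (alg_add A x y) z = alg_add A (alg_mult A x z) (alg_mult A y z)"
    and mult_add_right: "\<And>x y z. x \<in> alg_carrier A \<Longrightarrow> y \<in> alg_carrier A \<Longrightarrow> z \<in> alg_carrier A \<Longrightarrow>
      alg_mult A z (alg_add A x y) = alg_add A (alg_mult A z x) (alg_mult A z y)"
    and mult_scale_left: "\<And>c x y. x \<in> alg_carrier A \<Longrightarrow> y \<in> alg_carrier A \<Longrightarrow>
      alg_mult A (alg_scale A c x) y = alg_scale A c (alg_mult A x y)"
    and mult_scale_right: "\<And>c x y. x \<in> alg_carrier A \<Longrightarrow> y \<in> alg_carrier A \<Longrightarrow>
      alg_mult A x (alg_scale A c y) = alg_scale A c (alg_mult A x y)"
    and mult_assoc: "\<And>x y z. x \<in> alg_carrier A \<Longrightarrow> y \<in> alg_carrier A \<Longrightarrow> z \<in> alg_carrier A \<Longrightarrow>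
      alg_mult A (alg_mult A x y) z = alg_mult A x (alg_mult A y z)"
begin

lemmas closed = zero_closed add_closed scale_closed mult_closed

lemma zero_add: "x \<in> alg_carrier A \<Longrightarrow> alg_add A (alg_zero A) x = x"
  using add_commute add_zero zero_closed by metis

lemma add_left_commute:
  "x \<in> alg_carrier A \<Longrightarrow> y \<in> alg_carrier A \<Longrightarrow> z \<in> alg_carrier A \<Longrightarrow>
    alg_add A x (alg_add A y z) = alg_add A y (alg_add A x z)"
  using add_assoc add_commute by metis

lemma add_cancel:
  assumes "x \<in> alg_carrier A" "y \<in> alg_carrier A" "alg_add A x y = x"
  shows "y = alg_zero A"
proof -
  let ?n = "alg_scale A (- 1) x"
  have n: "?n \<in> alg_carrier A" using assms closed by blast
  have "y = alg_add A (alg_add A x ?n) y" using assms by (simp add: add_neg zero_add)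
  also have "\<dots> = alg_add A ?n (alg_add A x y)"
    using assms(1,2) n by (simp only: add_commute[of x ?n] add_assoc)
  also have "\<dots> = alg_zero A" unfolding assms(3)
    using assms(1) n by (simp only: add_commute[of ?n x] add_neg)
  finally show ?thesis .
qed

lemma mult_zero_right: "x \<in> alg_carrier A \<Longrightarrow> alg_mult A x (alg_zero A) = alg_zero A"
  using add_cancel[of "alg_mult A x (alg_zero A)" "alg_mult A x (alg_zero A)"]
    mult_add_right[of "alg_zero A" "alg_zero A" x] add_zero closed by simp

lemma mult_zero_left: "x \<in> alg_carrier A \<Longrightarrow> alg_mult A (alg_zero A) x = alg_zero A"
  using add_cancel[of "alg_mult A (alg_zero A) x" "alg_mult A (alg_zero A) x"]
    mult_add_left[of "alg_zero A" "alg_zero A" x] add_zero closed by simp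

lemma subspaceD:
  assumes "alg_subspace A V"
  shows "x \<in> V \<Longrightarrow> x \<in> alg_carrier A" "alg_zero A \<in> V" "x \<in> V \<Longrightarrow> y \<in> V \<Longrightarrow> alg_add A x y \<in> V"
    "x \<in> V \<Longrightarrow> alg_scale A c x \<in> V"
  using assms by (auto simp: alg_subspace_def)

lemma carrier_ideal: "alg_ideal A (alg_carrier A)"
  using closed by (auto simp: alg_ideal_def alg_subspace_def)

lemma genideal_ideal:
  assumes "S \<subseteq> alg_carrier A"
  shows "alg_ideal A (alg_genideal A S)"
proof -
  have "alg_genideal A S \<subseteq> alg_carrier A"
    unfolding alg_genideal_def using carrier_ideal assms by blast
  then show ?thesis
    unfolding alg_ideal_def[of A "alg_genideal A S"] alg_subspace_def[of A "alg_genideal A S"]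
    by (auto simp: alg_genideal_def alg_ideal_def alg_subspace_def)
qed

lemma genideal_contains: "S \<subseteq> alg_genideal A S"
  by (auto simp: alg_genideal_def)

lemma genideal_least: "alg_ideal A I \<Longrightarrow> S \<subseteq> I \<Longrightarrow> alg_genideal A S \<subseteq> I"
  by (auto simp: alg_genideal_def)

lemma span_contains: "S \<subseteq> alg_span A S"
  by (auto simp: alg_span_def)

lemma span_least: "alg_subspace A V \<Longrightarrow> S \<subseteq> V \<Longrightarrow> alg_span A S \<subseteq> V"
  by (auto simp: alg_span_def)

lemma span_subspace:
  assumes "S \<subseteq> alg_carrier A"
  shows "alg_subspace A (alg_span A S)"
proof -
  have "alg_subspace A (alg_carrier A)" using carrier_ideal by (simp add: alg_ideal_def)
  then have "alg_span A S \<subseteq> alg_carrier A"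
    unfolding alg_span_def using assms by blast
  then show ?thesis
    unfolding alg_subspace_def[of A "alg_span A S"]
    by (auto simp: alg_span_def alg_subspace_def)
qed

text \<open>The elements all of whose multiples lie in the span form a subspace, and it contains
  \<open>S\<close>.\<close>

lemma span_ideal:
  assumes S: "S \<subseteq> alg_carrier A"
    and m: "\<And>a s. a \<in> alg_carrier A \<Longrightarrow> s \<in> S \<Longrightarrow> alg_mult A a s \<in> S \<and> alg_mult A s a \<in> S"
  shows "alg_ideal A (alg_span A S)"
proof -
  note sp = span_subspace[OF S]
  let ?V = "{x \<in> alg_carrier A. \<forall>a\<in>alg_carrier A. alg_mult A a x \<in> alg_span A S \<and>
    alg_mult A x a \<in> alg_span A S}"
  have "alg_subspace A ?V"
    unfolding alg_subspace_def using subspaceD[OF sp] closed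
    by (auto simp: mult_zero_left mult_zero_right mult_add_left mult_add_right mult_scale_left
      mult_scale_right)
  moreover have "S \<subseteq> ?V" using S m span_contains by blast
  ultimately have "alg_span A S \<subseteq> ?V" by (rule span_least)
  then show ?thesis using sp unfolding alg_ideal_def by blast
qed

text \<open>Associativity and symmetry together allow a factor to be moved cyclically, which gives
  both sides of the ideal property. To pass a form to a quotient it is then enough to test
  generators of the ideal.\<close>

lemma radical_ideal:
  assumes bil: "alg_bilinear_form A B" and assoc: "alg_associative_form A B"
    and sym: "alg_symmetric_form A B"
  shows "alg_ideal A {x \<in> alg_carrier A. \<forall>b\<in>alg_carrier A. B x b = 0}" (is "alg_ideal A ?N")
proof -
  have add: "B (alg_add A x y) b = B x b + B y b" "B (alg_scale A c x) b = c * B x b"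
    if "x \<in> alg_carrier A" "y \<in> alg_carrier A" "b \<in> alg_carrier A" for x y b c
    using bil that unfolding alg_bilinear_form_def by blast+
  have as: "B (alg_mult A x y) b = B x (alg_mult A y b)"
    if "x \<in> alg_carrier A" "y \<in> alg_carrier A" "b \<in> alg_carrier A" for x y b
    using assoc that unfolding alg_associative_form_def by blast
  have sy: "B x b = B b x" if "x \<in> alg_carrier A" "b \<in> alg_carrier A" for x b
    using sym that unfolding alg_symmetric_form_def by blast
  have "B (alg_zero A) b = 0" if "b \<in> alg_carrier A" for b
  proof -
    have "B (alg_zero A) b + B (alg_zero A) b = B (alg_zero A) b"
      using add(1)[OF zero_closed zero_closed that] unfolding add_zero[OF zero_closed] by (rule HOL.sym)
    then show ?thesis by (simp only: add_cancel_left_right)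
  qed
  then have "alg_subspace A ?N"
    unfolding alg_subspace_def using closed add by auto
  moreover have "alg_mult A a x \<in> ?N \<and> alg_mult A x a \<in> ?N" if a: "a \<in> alg_carrier A"
    and x: "x \<in> ?N" for a x
  proof -
    have xC: "x \<in> alg_carrier A" and z: "\<And>b. b \<in> alg_carrier A \<Longrightarrow> B x b = 0" using x by auto
    have "B (alg_mult A a x) b = 0" if b: "b \<in> alg_carrier A" for b
    proof -
      have "B (alg_mult A a x) b = B a (alg_mult A x b)" by (rule as[OF a xC b])
      also have "\<dots> = B (alg_mult A x b) a" by (rule sy[OF a mult_closed[OF xC b]])
      also have "\<dots> = B x (alg_mult A b a)" by (rule as[OF xC b a])
      also have "\<dots> = 0" by (rule z[OF mult_closed[OF b a]])
      finally show ?thesis .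
    qed
    moreover have "B (alg_mult A x a) b = 0" if b: "b \<in> alg_carrier A" for b
      unfolding as[OF xC a b] by (rule z[OF mult_closed[OF a b]])
    ultimately show ?thesis using a xC closed by simp
  qed
  ultimately show ?thesis unfolding alg_ideal_def by blast
qed

end

locale nu_alg_ideal = nu_alg +
  fixes I
  assumes ideal: "alg_ideal A I"
begin

lemma I_subspace: "alg_subspace A I"
  using ideal by (simp add: alg_ideal_def)

lemmas I_D = subspaceD[OF I_subspace]

lemma I_mult: "a \<in> alg_carrier A \<Longrightarrow> x \<in> I \<Longrightarrow> alg_mult A a x \<in> I \<and> alg_mult A x a \<in> I"
  using ideal by (simp add: alg_ideal_def)

lemma mem_coset: "y \<in> alg_coset A I a \<longleftrightarrow> (\<exists>i\<in>I. y = alg_add A a i)"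
  by (auto simp: alg_coset_def)

lemma coset_self: "a \<in> alg_carrier A \<Longrightarrow> a \<in> alg_coset A I a"
  unfolding mem_coset using I_D(2) add_zero by metis

lemma coset_eq:
  assumes a: "a \<in> alg_carrier A" and b: "b \<in> alg_coset A I a"
  shows "alg_coset A I b = alg_coset A I a"
proof -
  obtain i where i: "i \<in> I" "b = alg_add A a i" using b mem_coset by blast
  have iC: "i \<in> alg_carrier A" using i I_D by blast
  let ?n = "alg_scale A (- 1) i"
  have n: "?n \<in> I" using i I_D by blast
  show ?thesis
  proof (intro equalityI subsetI)
    fix y assume "y \<in> alg_coset A I b"
    then obtain j where "j \<in> I" "y = alg_add A b j" using mem_coset by blast
    then show "y \<in> alg_coset A I a" unfolding mem_coset
      using i iC a I_D add_assoc by (intro bexI[of _ "alg_add A i j"]) auto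
  next
    fix y assume "y \<in> alg_coset A I a"
    then obtain j where j: "j \<in> I" "y = alg_add A a j" using mem_coset by blast
    then have jC: "j \<in> alg_carrier A" "?n \<in> alg_carrier A" using n I_D by blast+
    have "alg_add A b (alg_add A ?n j) = alg_add A a (alg_add A (alg_add A i ?n) j)"
      using i iC jC a closed by (simp add: add_assoc)
    also have "\<dots> = y" using j jC iC by (simp add: add_neg zero_add)
    finally show "y \<in> alg_coset A I b" unfolding mem_coset
      using n j I_D by (intro bexI[of _ "alg_add A ?n j"]) auto
  qed
qed

lemma coset_zero: "alg_coset A I (alg_zero A) = I"
  using I_D(1) zero_add by (auto simp: alg_coset_def image_iff)

lemma coset_eq_zero_iff:
  assumes "a \<in> alg_carrier A"
  shows "alg_coset A I a = alg_coset A I (alg_zero A) \<longleftrightarrow> a \<in> I"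
proof
  assume "alg_coset A I a = alg_coset A I (alg_zero A)"
  then show "a \<in> I" using coset_self[OF assms] coset_zero by simp
next
  assume "a \<in> I"
  then show "alg_coset A I a = alg_coset A I (alg_zero A)"
    using coset_eq[OF zero_closed, of a] coset_zero by simp
qed

lemma coset_add_mem:
  assumes "a \<in> alg_carrier A" "b \<in> alg_carrier A" "x \<in> alg_coset A I a" "y \<in> alg_coset A I b"
  shows "alg_add A x y \<in> alg_coset A I (alg_add A a b)"
proof -
  obtain i j where i: "i \<in> I" "x = alg_add A a i" and j: "j \<in> I" "y = alg_add A b j"
    using assms mem_coset by blast
  have "alg_add A x y = alg_add A (alg_add A a b) (alg_add A i j)"
    using assms(1,2) I_D(1)[OF i(1)] I_D(1)[OF j(1)]
    by (simp add: i(2) j(2) add_closed add_assoc add_left_commute[of i b])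
  then show ?thesis unfolding mem_coset using I_D(3)[OF i(1) j(1)] by blast
qed

lemma coset_scale_mem:
  assumes "a \<in> alg_carrier A" "x \<in> alg_coset A I a"
  shows "alg_scale A c x \<in> alg_coset A I (alg_scale A c a)"
proof -
  obtain i where i: "i \<in> I" "x = alg_add A a i" using assms mem_coset by blast
  have "alg_scale A c x = alg_add A (alg_scale A c a) (alg_scale A c i)"
    unfolding i(2) by (rule scale_add[OF assms(1) I_D(1)[OF i(1)]])
  then show ?thesis unfolding mem_coset using I_D(4)[OF i(1)] by blast
qed

lemma coset_mult_mem:
  assumes "a \<in> alg_carrier A" "b \<in> alg_carrier A" "x \<in> alg_coset A I a" "y \<in> alg_coset A I b"
  shows "alg_mult A x y \<in> alg_coset A I (alg_mult A a b)"
proof -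
  obtain i j where i: "i \<in> I" "x = alg_add A a i" and j: "j \<in> I" "y = alg_add A b j"
    using assms mem_coset by blast
  let ?k = "alg_add A (alg_mult A a j) (alg_mult A i (alg_add A b j))"
  have C: "i \<in> alg_carrier A" "j \<in> alg_carrier A" using i j I_D by blast+
  have bj: "alg_add A b j \<in> alg_carrier A" using C assms(2) closed by blast
  have "alg_mult A x y = alg_add A (alg_mult A a (alg_add A b j)) (alg_mult A i (alg_add A b j))"
    unfolding i(2) j(2) by (rule mult_add_left[OF assms(1) C(1) bj])
  also have "\<dots> = alg_add A (alg_mult A a b) ?k"
    unfolding mult_add_right[OF assms(2) C(2) assms(1)]
    by (rule add_assoc) (use C assms(1,2) bj closed in blast)+
  finally have "alg_mult A x y = alg_add A (alg_mult A a b) ?k" .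
  moreover have "?k \<in> I"
    using I_D(3)[of "alg_mult A a j" "alg_mult A i (alg_add A b j)"]
      I_mult[OF assms(1) j(1)] I_mult[OF bj i(1)] by simp
  ultimately show ?thesis unfolding mem_coset by blast
qed

lemma UN_const_eq: "X \<noteq> {} \<Longrightarrow> (\<And>x. x \<in> X \<Longrightarrow> F x = c) \<Longrightarrow> (\<Union>x\<in>X. F x) = c"
  by auto

lemma quotient_simps:
  assumes a: "a \<in> alg_carrier A" and b: "b \<in> alg_carrier A"
  shows "alg_add (alg_quotient A I) (alg_coset A I a) (alg_coset A I b) = alg_coset A I (alg_add A a b)"
    and "alg_mult (alg_quotient A I) (alg_coset A I a) (alg_coset A I b) =
      alg_coset A I (alg_mult A a b)"
    and "alg_scale (alg_quotient A I) c (alg_coset A I a) = alg_coset A I (alg_scale A c a)"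
proof -
  have ne: "alg_coset A I a \<noteq> {}" "alg_coset A I b \<noteq> {}" using coset_self a b by blast+
  show "alg_add (alg_quotient A I) (alg_coset A I a) (alg_coset A I b) = alg_coset A I (alg_add A a b)"
    unfolding alg_quotient_def nu_algebra.select_convs
    by (rule UN_const_eq[OF ne(1)], rule UN_const_eq[OF ne(2)],
        rule coset_eq[OF add_closed[OF a b] coset_add_mem[OF a b]])
  show "alg_mult (alg_quotient A I) (alg_coset A I a) (alg_coset A I b) =
    alg_coset A I (alg_mult A a b)"
    unfolding alg_quotient_def nu_algebra.select_convs
    by (rule UN_const_eq[OF ne(1)], rule UN_const_eq[OF ne(2)],
        rule coset_eq[OF mult_closed[OF a b] coset_mult_mem[OF a b]])
  show "alg_scale (alg_quotient A I) c (alg_coset A I a) = alg_coset A I (alg_scale A c a)"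
    unfolding alg_quotient_def nu_algebra.select_convs
    by (rule UN_const_eq[OF ne(1)], rule coset_eq[OF scale_closed[OF a] coset_scale_mem[OF a]])
qed

lemma quotient_carrier: "alg_carrier (alg_quotient A I) = alg_coset A I ` alg_carrier A"
  and quotient_zero: "alg_zero (alg_quotient A I) = alg_coset A I (alg_zero A)"
  by (simp_all add: alg_quotient_def)

lemma quotient_nu_alg: "nu_alg (alg_quotient A I)"
proof unfold_locales
  fix X Y assume "X \<in> alg_carrier (alg_quotient A I)" "Y \<in> alg_carrier (alg_quotient A I)"
  then obtain a b where "X = alg_coset A I a" "Y =
    alg_coset A I b" "a \<in> alg_carrier A" "b \<in> alg_carrier A"
    unfolding quotient_carrier by blast
  then show "alg_add (alg_quotient A I) X Y = alg_add (alg_quotient A I) Y X"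
    by (simp only: quotient_simps add_commute[of a b])
qed (unfold quotient_carrier quotient_zero, ((elim imageE)?,
  simp only: quotient_simps closed add_assoc add_zero add_neg scale_add
    mult_add_left mult_add_right mult_scale_left mult_scale_right mult_assoc imageI)+)

text \<open>The form is evaluated on chosen representatives. Independence in the first argument is
  \<open>rad\<close>; symmetry carries it over to the second.\<close>

lemma quotient_form:
  assumes bil: "alg_bilinear_form A B" and assoc: "alg_associative_form A B"
    and sym: "alg_symmetric_form A B"
    and rad: "\<And>i b. i \<in> I \<Longrightarrow> b \<in> alg_carrier A \<Longrightarrow> B i b = 0"
  obtains B' where "alg_bilinear_form (alg_quotient A I) B'"
    "alg_associative_form (alg_quotient A I) B'"
    "alg_symmetric_form (alg_quotient A I) B'"
    "\<And>a b. a \<in> alg_carrier A \<Longrightarrow> b \<in> alg_carrier A \<Longrightarrow> B' (alg_coset A I a) (alg_coset A I b) = B a b"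
proof -
  define rep where "rep X = (SOME a. a \<in> alg_carrier A \<and> a \<in> X)" for X
  define B' where "B' X Y = B (rep X) (rep Y)" for X Y
  have rep: "rep (alg_coset A I a) \<in> alg_carrier A \<and> rep (alg_coset A I a) \<in> alg_coset A I a"
    if "a \<in> alg_carrier A" for a
    unfolding rep_def by (rule someI[of _ a]) (simp add: coset_self that)
  have shift: "B x b = B a b" if ab: "a \<in> alg_carrier A" "b \<in> alg_carrier A"
    and x: "x \<in> alg_coset A I a" for a b x
  proof -
    obtain i where i: "i \<in> I" "x = alg_add A a i" using x mem_coset by blast
    have iC: "i \<in> alg_carrier A" by (rule I_D(1)[OF i(1)])
    have "B x b = B a b + B i b"
      unfolding i(2)
      by (rule bil[unfolded alg_bilinear_form_def, THEN conjunct1, THEN bspec, OF ab(1),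
            THEN bspec, OF iC, THEN bspec, OF ab(2), THEN conjunct1])
    then show ?thesis using rad[OF i(1) ab(2)] by simp
  qed
  have sym': "B a b = B b a" if "a \<in> alg_carrier A" "b \<in> alg_carrier A" for a b
    using sym that unfolding alg_symmetric_form_def by blast
  have B': "B' (alg_coset A I a) (alg_coset A I b) = B a b"
    if a: "a \<in> alg_carrier A" and b: "b \<in> alg_carrier A" for a b
  proof -
    let ?a = "rep (alg_coset A I a)" and ?b = "rep (alg_coset A I b)"
    have a': "?a \<in> alg_carrier A" "?a \<in> alg_coset A I a" using rep[OF a] by simp_all
    have b': "?b \<in> alg_carrier A" "?b \<in> alg_coset A I b" using rep[OF b] by simp_all
    have "B ?a ?b = B a ?b" by (rule shift[OF a b'(1) a'(2)])
    also have "\<dots> = B ?b a" by (rule sym'[OF a b'(1)])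
    also have "\<dots> = B b a" by (rule shift[OF b a b'(2)])
    also have "\<dots> = B a b" by (rule sym'[OF b a])
    finally show ?thesis unfolding B'_def .
  qed
  show ?thesis
  proof (rule that[of B'])
    show "alg_bilinear_form (alg_quotient A I) B'"
      unfolding alg_bilinear_form_def
    proof (intro conjI ballI allI)
      fix X Y Z t
      assume "X \<in> alg_carrier (alg_quotient A I)" "Y \<in> alg_carrier (alg_quotient A I)"
        "Z \<in> alg_carrier (alg_quotient A I)"
      then obtain a b c where *: "X = alg_coset A I a" "Y = alg_coset A I b" "Z = alg_coset A I c"
        and C: "a \<in> alg_carrier A" "b \<in> alg_carrier A" "c \<in> alg_carrier A"
        unfolding quotient_carrier by blast
      show "B' (alg_add (alg_quotient A I) X Y) Z = B' X Z + B' Y Z"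
        "B' X (alg_add (alg_quotient A I) Y Z) = B' X Y + B' X Z"
        using bil C unfolding alg_bilinear_form_def * by (simp_all add: quotient_simps B' closed)
    next
      fix X Y t
      assume "X \<in> alg_carrier (alg_quotient A I)" "Y \<in> alg_carrier (alg_quotient A I)"
      then obtain a b where *: "X = alg_coset A I a" "Y = alg_coset A I b"
        and C: "a \<in> alg_carrier A" "b \<in> alg_carrier A"
        unfolding quotient_carrier by blast
      show "B' (alg_scale (alg_quotient A I) t X) Y = t * B' X Y"
        "B' X (alg_scale (alg_quotient A I) t Y) = t * B' X Y"
        using bil C unfolding alg_bilinear_form_def * by (simp_all add: quotient_simps B' closed)
    qed
    show "alg_associative_form (alg_quotient A I) B'"
      unfolding alg_associative_form_def
    proof (intro ballI)
      fix X Y Z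
      assume "X \<in> alg_carrier (alg_quotient A I)" "Y \<in> alg_carrier (alg_quotient A I)"
        "Z \<in> alg_carrier (alg_quotient A I)"
      then obtain a b c where *: "X = alg_coset A I a" "Y = alg_coset A I b" "Z = alg_coset A I c"
        and C: "a \<in> alg_carrier A" "b \<in> alg_carrier A" "c \<in> alg_carrier A"
        unfolding quotient_carrier by blast
      have "B (alg_mult A a b) c = B a (alg_mult A b c)"
        using assoc C unfolding alg_associative_form_def by blast
      then show "B' (alg_mult (alg_quotient A I) X Y) Z = B' X (alg_mult (alg_quotient A I) Y Z)"
        unfolding * using C by (simp only: quotient_simps B' closed)
    qed
    show "alg_symmetric_form (alg_quotient A I) B'"
      unfolding alg_symmetric_form_def quotient_carrier using B' sym' by auto
  qed (rule B')
qed

end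

section \<open>Path algebras\<close>

lemma lookup_scale: "Poly_Mapping.lookup (Poly_Mapping.map ((*) c) f) k =
    (c :: 'k::field) * Poly_Mapping.lookup f k"
  by (simp add: Poly_Mapping.map.rep_eq when_def)

lemma poly_mapping_sum_single:
  fixes f :: "'a \<Rightarrow>\<^sub>0 'k::field"
  shows "finite K \<Longrightarrow> Poly_Mapping.keys f \<subseteq> K \<Longrightarrow>
    f = (\<Sum>k\<in>K. Poly_Mapping.single k (Poly_Mapping.lookup f k))"
  by (rule poly_mapping_eqI)
    (auto simp: lookup_sum lookup_single when_def in_keys_iff)

definition lin_ext :: "('a \<Rightarrow> 'k::field) \<Rightarrow> ('a \<Rightarrow>\<^sub>0 'k) \<Rightarrow> 'k" where
  "lin_ext t f = (\<Sum>k\<in>Poly_Mapping.keys f. Poly_Mapping.lookup f k * t k)"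

lemma lin_ext_superset:
  "finite K \<Longrightarrow> Poly_Mapping.keys f \<subseteq> K \<Longrightarrow> lin_ext t f = (\<Sum>k\<in>K. Poly_Mapping.lookup f k * t k)"
  unfolding lin_ext_def by (rule sum.mono_neutral_left) (auto simp: in_keys_iff)

lemma lin_ext_add: "lin_ext t (f + g) = lin_ext t f + lin_ext t g"
proof -
  let ?K = "Poly_Mapping.keys f \<union> Poly_Mapping.keys g"
  have "Poly_Mapping.keys (f + g) \<subseteq> ?K" by (rule Poly_Mapping.keys_add)
  then show ?thesis
    by (simp add: lin_ext_superset[of ?K] lookup_add distrib_right sum.distrib)
qed

lemma lin_ext_scale: "lin_ext t (Poly_Mapping.map ((*) c) f) = c * lin_ext t f"
proof -
  have "Poly_Mapping.keys (Poly_Mapping.map ((*) c) f) \<subseteq> Poly_Mapping.keys f"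
    by (auto simp: in_keys_iff lookup_scale)
  then show ?thesis
    by (simp add: lin_ext_superset[of "Poly_Mapping.keys f"] lookup_scale sum_distrib_left mult.assoc)
qed

lemma lin_ext_single [simp]: "lin_ext t (Poly_Mapping.single k c) = c * t k"
  by (simp add: lin_ext_def)

lemma lin_ext_zero [simp]: "lin_ext t 0 = 0"
  by (simp add: lin_ext_def)

text \<open>Restricting single terms to the keys of \<open>f\<close> makes the membership of
  \<open>f\<close> in the carrier available for each path, without any closure condition in
  \<open>P\<close>.\<close>

lemma poly_mapping_additive_induct:
  fixes f :: "'a \<Rightarrow>\<^sub>0 'k::field"
  assumes "P 0" "\<And>k c. k \<in> Poly_Mapping.keys f \<Longrightarrow> P (Poly_Mapping.single k c)" "\<And>f g. P f \<Longrightarrow> P g \<Longrightarrow>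
    P (f + g)"
  shows "P f"
proof -
  have "P (\<Sum>k\<in>K. Poly_Mapping.single k (Poly_Mapping.lookup f k))"
    if "finite K" "K \<subseteq> Poly_Mapping.keys f" for K
    using that by (induction K rule: finite_induct) (auto intro: assms)
  from this[of "Poly_Mapping.keys f"] show ?thesis
    using poly_mapping_sum_single[of "Poly_Mapping.keys f" f] by simp
qed

text \<open>The end is read off from \<open>head\<close> even for lists that are not walks, so the
  rules below have no side conditions.\<close>

definition path_end :: "('v, 'e) pre_digraph \<Rightarrow> 'v \<Rightarrow> 'e list \<Rightarrow> 'v" where
  "path_end Q u p = last (pre_digraph.awalk_verts Q u p)"

lemma path_end_Nil [simp]: "path_end Q u [] = u"
  by (simp add: path_end_def pre_digraph.awalk_verts.simps)

lemma path_end_Cons [simp]: "path_end Q u (e # p) = path_end Q (head Q e) p"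
  by (simp add: path_end_def pre_digraph.awalk_verts.simps pre_digraph.awalk_verts_non_Nil)

lemma path_end_append [simp]: "path_end Q u (p @ q) = path_end Q (path_end Q u p) q"
  by (induction p arbitrary: u) auto

definition path_prod :: "('v, 'e) pre_digraph \<Rightarrow> ('v, 'e) qpath \<Rightarrow> ('v, 'e) qpath \<Rightarrow> 'k \<Rightarrow>
    (('v, 'e) qpath \<Rightarrow>\<^sub>0 'k::field)" where
  "path_prod Q p q c = (if path_end Q (fst p) (snd p) =
    fst q then Poly_Mapping.single (fst p, snd p @ snd q) c else 0)"

lemma path_prod_add: "path_prod Q p q (c + d) = path_prod Q p q c + path_prod Q p q d"
  by (simp add: path_prod_def single_add)

lemma path_prod_zero [simp]: "path_prod Q p q 0 = 0"
  by (simp add: path_prod_def)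

lemma path_mult_path_prod:
  "path_mult Q f g = (\<Sum>p\<in>Poly_Mapping.keys f. \<Sum>q\<in>Poly_Mapping.keys g.
     path_prod Q p q (Poly_Mapping.lookup f p * Poly_Mapping.lookup g q))"
  unfolding path_mult_def path_prod_def path_end_def by (simp add: case_prod_beta cong: if_cong)

text \<open>Summing over common supersets of the supports makes bilinearity a termwise
  statement.\<close>

lemma path_mult_superset:
  assumes "finite K" "Poly_Mapping.keys f \<subseteq> K" "finite L" "Poly_Mapping.keys g \<subseteq> L"
  shows "path_mult Q f g = (\<Sum>p\<in>K. \<Sum>q\<in>L. path_prod Q p q
    (Poly_Mapping.lookup f p * Poly_Mapping.lookup g q))"
proof -
  have "(\<Sum>q\<in>Poly_Mapping.keys g. path_prod Q p q (Poly_Mapping.lookup f p * Poly_Mapping.lookup g q)) =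
    (\<Sum>q\<in>L. path_prod Q p q (Poly_Mapping.lookup f p * Poly_Mapping.lookup g q))" for p
    by (rule sum.mono_neutral_left) (use assms in \<open>auto simp: in_keys_iff\<close>)
  moreover have "(\<Sum>p\<in>Poly_Mapping.keys f. \<Sum>q\<in>L. path_prod Q p q
    (Poly_Mapping.lookup f p * Poly_Mapping.lookup g q)) =
    (\<Sum>p\<in>K. \<Sum>q\<in>L. path_prod Q p q (Poly_Mapping.lookup f p * Poly_Mapping.lookup g q))"
    by (rule sum.mono_neutral_left) (use assms in \<open>auto simp: in_keys_iff\<close>)
  ultimately show ?thesis unfolding path_mult_path_prod by simp
qed

lemma path_mult_add_left: "path_mult Q (f + g) h = path_mult Q f h + path_mult Q g h"
proof -
  let ?K = "Poly_Mapping.keys f \<union> Poly_Mapping.keys g" and ?L = "Poly_Mapping.keys h"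
  have "Poly_Mapping.keys (f + g) \<subseteq> ?K" by (rule Poly_Mapping.keys_add)
  then show ?thesis
    by (simp add: path_mult_superset[of ?K _ ?L] lookup_add distrib_right path_prod_add sum.distrib)
qed

lemma path_mult_add_right: "path_mult Q h (f + g) = path_mult Q h f + path_mult Q h g"
proof -
  let ?K = "Poly_Mapping.keys f \<union> Poly_Mapping.keys g" and ?L = "Poly_Mapping.keys h"
  have "Poly_Mapping.keys (f + g) \<subseteq> ?K" by (rule Poly_Mapping.keys_add)
  then show ?thesis
    by (simp add: path_mult_superset[of ?L _ ?K] lookup_add distrib_left path_prod_add sum.distrib)
qed

lemma path_mult_zero [simp]: "path_mult Q 0 g = 0" "path_mult Q f 0 = 0"
  by (simp_all add: path_mult_path_prod)

lemma path_mult_single: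
  "path_mult Q (Poly_Mapping.single p c) (Poly_Mapping.single q d) = path_prod Q p q (c * d)"
  by (subst path_mult_superset[of "{p}" _ "{q}"]) auto

lemma scale_add': "Poly_Mapping.map ((*) c) (f + g) =
    Poly_Mapping.map ((*) c) f + Poly_Mapping.map ((*) (c :: 'k::field)) g"
  by (rule poly_mapping_eqI) (simp add: lookup_scale lookup_add distrib_left)

lemma scale_path_prod: "Poly_Mapping.map ((*) c) (path_prod Q p q d) = path_prod Q p q (c * d)"
  by (rule poly_mapping_eqI) (auto simp: lookup_scale path_prod_def lookup_single when_def)

lemma scale_single: "Poly_Mapping.map ((*) c) (Poly_Mapping.single k d) =
    Poly_Mapping.single k ((c::'k::field) * d)"
  by (rule poly_mapping_eqI) (auto simp: lookup_scale lookup_single when_def)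

lemma scale_zero: "Poly_Mapping.map ((*) (c::'k::field)) 0 = 0"
  by (rule poly_mapping_eqI) (simp add: lookup_scale)

lemma path_mult_scale_left:
  "path_mult Q (Poly_Mapping.map ((*) c) f) g = Poly_Mapping.map ((*) c) (path_mult Q f g)"
proof (induction f rule: poly_mapping_additive_induct)
  case (2 k d)
  show ?case
    by (induction g rule: poly_mapping_additive_induct)
      (simp_all add: scale_zero scale_single path_mult_single scale_path_prod path_mult_add_right
        scale_add' mult.assoc)
qed (simp_all add: scale_zero scale_add' path_mult_add_left)

lemma path_mult_scale_right:
  "path_mult Q f (Poly_Mapping.map ((*) c) g) = Poly_Mapping.map ((*) c) (path_mult Q f g)"
proof (induction f rule: poly_mapping_additive_induct)
  case (2 k d)
  show ?case
    by (induction g rule: poly_mapping_additive_induct)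
      (simp_all add: scale_zero scale_single path_mult_single scale_path_prod path_mult_add_right
        scale_add' mult.left_commute)
qed (simp_all add: scale_zero scale_add' path_mult_add_left)

lemma path_mult_assoc: "path_mult Q (path_mult Q f g) h = path_mult Q f (path_mult Q g h)"
proof (induction f rule: poly_mapping_additive_induct)
  case (2 p c)
  show ?case
  proof (induction g rule: poly_mapping_additive_induct)
    case (2 q d)
    show ?case
    proof (induction h rule: poly_mapping_additive_induct)
      case (2 s e)
      show ?case by (auto simp: path_mult_single path_prod_def mult.assoc)
    qed (simp_all add: path_mult_add_right)
  qed (simp_all add: path_mult_add_left path_mult_add_right)
qed (simp_all add: path_mult_add_left)

section \<open>Words as paths in the quiver of U_r\<close>

fun arrow_of :: "(nat \<Rightarrow> int) \<Rightarrow> nat \<times> bool \<Rightarrow> arrow" where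
  "arrow_of x (i, s) = (if s then ArrA x i else ArrB x i)"

fun letter :: "arrow \<Rightarrow> nat \<times> bool" where
  "letter (ArrA x i) = (i, True)"
| "letter (ArrB x i) = (i, False)"

primrec arrows_of :: "(nat \<Rightarrow> int) \<Rightarrow> word \<Rightarrow> arrow list" where
  "arrows_of x [] = []"
| "arrows_of x (l # w) = arrow_of x l # arrows_of (step l x) w"

lemma arrows_of_append: "arrows_of x (u @ v) = arrows_of x u @ arrows_of (endp x u) v"
  by (induction u arbitrary: x) auto

lemma letter_arrow_of [simp]: "letter (arrow_of x l) = l"
  by (cases l) auto

lemma map_letter_arrows_of [simp]: "map letter (arrows_of x w) = w"
  by (induction w arbitrary: x) auto

lemma length_arrows_of [simp]: "length (arrows_of x w) = length w"
  by (induction w arbitrary: x) auto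

lemma target_arrow_of [simp]: "arrow_target (arrow_of x l) = step l x"
  by (cases l) (simp add: step_def)

lemma source_arrow_of [simp]: "arrow_source (arrow_of x l) = x"
  by (cases l) simp

lemma path_end_arrows_of [simp]: "path_end (U_quiver r) x (arrows_of x w) = endp x w"
  by (induction w arbitrary: x) (auto simp: U_quiver_def)

lemma arrow_of_in_arcs: "arrow_of x l \<in> arcs (U_quiver r) \<longleftrightarrow> x \<in> Zlat r \<and> fst l \<in> {1..r}"
  by (cases l) (auto simp: U_quiver_def)

lemma arrow_of_cases: "e \<in> arcs (U_quiver r) \<Longrightarrow> e = arrow_of (arrow_source e) (letter e)"
  by (auto simp: U_quiver_def)

lemma letter_index: "e \<in> arcs (U_quiver r) \<Longrightarrow> fst (letter e) \<in> {1..r}"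
  by (auto simp: U_quiver_def)

lemma cas_arrows_of: "set p \<subseteq> arcs (U_quiver r) \<Longrightarrow> pre_digraph.cas (U_quiver r) x p y \<Longrightarrow>
    p = arrows_of x (map letter p)"
proof (induction p arbitrary: x)
  case (Cons e p)
  have e: "e = arrow_of (arrow_source e) (letter e)" using Cons.prems arrow_of_cases by auto
  have "arrow_source e = x" "pre_digraph.cas (U_quiver r) (arrow_target e) p y"
    using Cons.prems by (auto simp: pre_digraph.cas.simps U_quiver_def)
  moreover from this e have "arrow_target e = step (letter e) x" by (metis target_arrow_of)
  ultimately show ?case using Cons e by simp
qed simp

lemma qpaths_U:
  "(x, p) \<in> qpaths (U_quiver r) \<longleftrightarrow> x \<in> Zlat r \<and> (\<exists>w. valid r w \<and> p = arrows_of x w)"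
proof
  assume "(x, p) \<in> qpaths (U_quiver r)"
  then obtain y where y: "x \<in> Zlat r" "set p \<subseteq> arcs (U_quiver r)" "pre_digraph.cas (U_quiver r) x p y"
    by (auto simp: qpaths_def pre_digraph.awalk_def U_quiver_def)
  have "valid r (map letter p)"
  proof -
    have "fst (letter e) \<in> {1..r}" if "e \<in> set p" for e
      using y(2) that letter_index[of e r] by blast
    then show ?thesis unfolding valid_def set_map by blast
  qed
  then show "x \<in> Zlat r \<and> (\<exists>w. valid r w \<and> p = arrows_of x w)" using y cas_arrows_of by blast
next
  assume "x \<in> Zlat r \<and> (\<exists>w. valid r w \<and> p = arrows_of x w)"
  then obtain w where w: "x \<in> Zlat r" "valid r w" "p = arrows_of x w" by blast
  have "set (arrows_of x w) \<subseteq> arcs (U_quiver r) \<and>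
    pre_digraph.cas (U_quiver r) x (arrows_of x w) (endp x w)"
    using w(1,2)
  proof (induction w arbitrary: x)
    case (Cons l w)
    then have "arrow_of x l \<in> arcs (U_quiver r)"
      "step l x \<in> Zlat r" by (auto simp: arrow_of_in_arcs step_Zlat)
    then show ?case using Cons by (auto simp: pre_digraph.cas.simps U_quiver_def)
  qed (simp add: pre_digraph.cas.simps)
  then show "(x, p) \<in> qpaths (U_quiver r)"
    using w by (auto simp: qpaths_def pre_digraph.awalk_def U_quiver_def)
qed

definition wpath :: "(nat \<Rightarrow> int) \<Rightarrow> word \<Rightarrow> 'k::field U_path_elem" where
  "wpath x w = Poly_Mapping.single (x, arrows_of x w) 1"

lemma wpath_mult: "path_mult (U_quiver r) (wpath x u) (wpath y v) = (if endp x u =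
    y then wpath x (u @ v) else 0)"
  by (auto simp: wpath_def path_mult_single path_prod_def arrows_of_append)

abbreviation PA :: "nat \<Rightarrow> ('k::field, 'k U_path_elem) nu_algebra" where
  "PA r \<equiv> path_algebra (U_quiver r)"

lemma PA_simps [simp]:
  "alg_zero (PA r) = 0" "alg_add (PA r) = (+)" "alg_scale (PA r) = (\<lambda>c. Poly_Mapping.map ((*) c))"
  "alg_mult (PA r) = path_mult (U_quiver r)"
  by (simp_all add: path_algebra_def)

lemma PA_carrier: "alg_carrier (PA r) = {f. Poly_Mapping.keys f \<subseteq> qpaths (U_quiver r)}"
  by (simp add: path_algebra_def)

lemma PA_zero: "0 \<in> alg_carrier (PA r)"
  by (simp add: PA_carrier)

lemma PA_add: "f \<in> alg_carrier (PA r) \<Longrightarrow> g \<in> alg_carrier (PA r) \<Longrightarrow> f + g \<in> alg_carrier (PA r)"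
  using Poly_Mapping.keys_add[of f g] by (auto simp: PA_carrier)

lemma PA_sum: "(\<And>a. a \<in> S \<Longrightarrow> h a \<in> alg_carrier (PA r)) \<Longrightarrow> (\<Sum>a\<in>S. h a) \<in> alg_carrier (PA r)"
  by (induction S rule: infinite_finite_induct) (auto simp: PA_zero PA_add)

lemma PA_scale: "f \<in> alg_carrier (PA r) \<Longrightarrow> Poly_Mapping.map ((*) c) f \<in> alg_carrier (PA r)"
  by (auto simp: PA_carrier in_keys_iff lookup_scale)

lemma PA_wpath: "x \<in> Zlat r \<Longrightarrow> valid r w \<Longrightarrow> wpath x w \<in> alg_carrier (PA r)"
  by (auto simp: PA_carrier wpath_def qpaths_U)

lemma PA_path_prod:
  assumes "p \<in> qpaths (U_quiver r)" "q \<in> qpaths (U_quiver r)"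
  shows "path_prod (U_quiver r) p q c \<in> alg_carrier (PA r)"
proof (cases p; cases q)
  fix x a y b assume *: "p = (x, a)" "q = (y, b)"
  obtain w v where w: "x \<in> Zlat r" "valid r w" "a = arrows_of x w"
    and v: "valid r v" "b = arrows_of y v"
    using assms by (auto simp: * qpaths_U)
  have "(x, arrows_of x (w @ v)) \<in> qpaths (U_quiver r)"
    using w v by (auto simp: qpaths_U simp del: append_assoc intro!: exI[of _ "w @ v"])
  then show ?thesis using w v by (auto simp: * path_prod_def PA_carrier arrows_of_append)
qed

lemma PA_mult: "f \<in> alg_carrier (PA r) \<Longrightarrow> g \<in> alg_carrier (PA r) \<Longrightarrow>
    path_mult (U_quiver r) f g \<in> alg_carrier (PA r)"
  unfolding path_mult_path_prod by (intro PA_sum PA_path_prod) (auto simp: PA_carrier)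

lemma nu_alg_PA: "nu_alg (PA r)"
proof (unfold_locales, unfold PA_simps)
  show "x + Poly_Mapping.map ((*) (- 1)) x = 0" for x :: "'a U_path_elem"
    by (rule poly_mapping_eqI) (simp add: lookup_add lookup_scale)
qed (simp_all add: PA_zero PA_add PA_scale PA_mult add.assoc add.commute scale_add' path_mult_add_left
    path_mult_add_right path_mult_scale_left path_mult_scale_right path_mult_assoc)

section \<open>The defining relations in terms of words\<close>

definition loops :: "(nat \<Rightarrow> int) \<Rightarrow> nat \<Rightarrow> 'k::field U_path_elem" where
  "loops x i = wpath x [(i, False), (i, True)] + wpath x [(i, True), (i, False)]"

lemma path_ab_wpath: "path_a x i = wpath x [(i, True)]" "path_b x i =
    wpath x [(i, False)]" "path_e x = wpath x []"
  "inc i x = step (i, True) x" "dec i x = step (i, False) x"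
  by (simp_all add: path_a_def path_b_def path_e_def wpath_def step_def)

text \<open>Treating both kinds of arrows as letters merges the six families into three: squares,
  anticommutators and differences of consecutive loops.\<close>

lemma U_relations_eq:
  "(U_relations r :: 'k::field U_path_elem set) =
    {wpath x [l, l] | x l. x \<in> Zlat r \<and> fst l \<in> {1..r}} \<union>
    {wpath x [l, l'] + wpath x [l', l] | x l l'. x \<in> Zlat r \<and> fst l \<in> {1..r} \<and> fst l' \<in> {1..r} \<and>
      fst l \<noteq> fst l'} \<union>
    {loops x i - loops x (i + 1) | x i. x \<in> Zlat r \<and> 1 \<le> i \<and> i < r}"
  (is "_ = ?A \<union> ?B \<union> ?C")
proof -
  let ?a = "{wpath x [(i, True), (i, True)] | x i. x \<in> Zlat r \<and> i \<in> {1..r}}"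
  let ?b = "{wpath x [(i, False), (i, False)] | x i. x \<in> Zlat r \<and> i \<in> {1..r}}"
  define M where "M s t = {wpath x [(i, s), (j, t)] +
    wpath x [(j, t), (i, s)] :: 'k U_path_elem | x i j.
         x \<in> Zlat r \<and> i \<in> {1..r} \<and> j \<in> {1..r} \<and> i \<noteq> j}" for s t
  have "U_relations r = ?a \<union> ?b \<union> M True True \<union> M False False \<union> M True False \<union> ?C"
    unfolding U_relations_def Let_def path_ab_wpath wpath_mult loops_def M_def by simp
  moreover have "?A = ?a \<union> ?b" by (auto; metis (full_types))
  moreover have "?B = M True True \<union> M False False \<union> M True False"
  proof (intro equalityI subsetI)
    fix g assume "g \<in> ?B"
    then obtain x l l' where *: "g = wpath x [l, l'] + wpath x [l', l]" "x \<in> Zlat r"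
      "fst l \<in> {1..r}" "fst l' \<in> {1..r}" "fst l \<noteq> fst l'"
      by blast
    obtain i s j t where l: "l = (i, s)" "l' = (j, t)" by (cases l; cases l') auto
    have m1: "g \<in> M s t" unfolding M_def using * l by auto
    \<comment> \<open>The mixed relations are listed with a as the first letter of the first
      summand; the other order is the same sum.\<close>
    have "g = wpath x [(j, t), (i, s)] + wpath x [(i, s), (j, t)]" using * l by (simp only: add.commute)
    then have m2: "g \<in> M t s"
      unfolding M_def using *(2-5) l by (intro CollectI exI[of _ x] exI[of _ j] exI[of _ i]) simp
    show "g \<in> M True True \<union> M False False \<union> M True False"
      by (cases s; cases t; use m1 m2 in simp)
  next
    fix g assume "g \<in> M True True \<union> M False False \<union> M True False"
    then obtain s t where "g \<in> M s t" by blast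
    then obtain x i j where "g = wpath x [(i, s), (j, t)] + wpath x [(j, t), (i, s)]" "x \<in> Zlat r"
      "i \<in> {1..r}" "j \<in> {1..r}" "i \<noteq> j"
      unfolding M_def by blast
    then show "g \<in> ?B" by fastforce
  qed
  ultimately show ?thesis by (simp only: Un_assoc)
qed

section \<open>The bilinear form\<close>

text \<open>Moving along coordinate $i$ changes this sign at $j$ if and only if $i < j$; hence for
  $i \neq j$ the two ways around a square differ by exactly one sign, which turns
  anticommutation into commutation.\<close>

definition asign :: "(nat \<Rightarrow> int) \<Rightarrow> nat \<Rightarrow> 'k::comm_ring_1" where
  "asign x i = (if even (\<Sum>j\<in>{1..<i}. x j) then 1 else - 1)"

primrec wsign :: "(nat \<Rightarrow> int) \<Rightarrow> word \<Rightarrow> 'k::comm_ring_1" where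
  "wsign x [] = 1"
| "wsign x (l # w) = asign x (fst l) * wsign (step l x) w"

lemma wsign_append: "wsign x (u @ v) = wsign x u * wsign (endp x u) v"
  by (induction u arbitrary: x) (auto simp: mult.assoc)

lemma asign_square: "asign x i * asign x i = 1"
  by (simp add: asign_def)

lemma wsign_square: "wsign x w * wsign x w = (1 :: 'k::comm_ring_1)"
proof (induction w arbitrary: x)
  case (Cons l w)
  have "wsign x (l # w) * wsign x (l # w) = (asign x (fst l) * asign x (fst l)) * (wsign
    (step l x) w * wsign (step l x) w :: 'k)"
    by (simp add: mult_ac)
  also have "\<dots> = 1" by (simp only: asign_square Cons mult_1_left)
  finally show ?case .
qed simp

lemma asign_step:
  "asign (step (i, s) x) j = (if 1 \<le> i \<and> i < j then - asign x j else asign x j)"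
proof -
  have "(\<Sum>k\<in>{1..<j}. step (i, s) x k) = (\<Sum>k\<in>{1..<j}. x k + (if k = i then if s then 1 else - 1 else 0))"
    by (rule sum.cong) (auto simp: step_apply)
  also have "\<dots> = (\<Sum>k\<in>{1..<j}. x k) + (if i \<in> {1..<j} then if s then 1 else - 1 else 0)"
    by (simp add: sum.distrib)
  finally show ?thesis by (auto simp: asign_def)
qed

lemma wsign_swap:
  assumes "fst l \<noteq> fst l'" "1 \<le> fst l" "1 \<le> fst l'"
  shows "wsign x (u @ l # l' # v) = (- wsign x (u @ l' # l # v) :: 'k::comm_ring_1)"
proof -
  let ?y = "endp x u"
  obtain i s j t where l: "l = (i, s)" "l' = (j, t)" by (cases l; cases l')
  have e0: "asign ?y (fst l) * asign (step l ?y) (fst l') =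
    (- (asign ?y (fst l') * asign (step l' ?y) (fst l)) :: 'k)"
    using assms by (auto simp: l asign_step mult.commute)
  have e: "asign ?y (fst l) * (asign (step l ?y) (fst l') * c) =
    - (asign ?y (fst l') * (asign (step l' ?y) (fst l) * c))"
    for c :: 'k
    unfolding mult.assoc[symmetric] e0 by (rule mult_minus_left)
  show ?thesis
    by (simp only: wsign_append wsign.simps step_commute[OF assms(1), of ?y] e mult_minus_right)
qed

text \<open>\<open>asign\<close> at index \<open>i\<close> does not depend on coordinate
  \<open>i\<close>, so both letters of the loop carry the same sign and the signs cancel.\<close>

lemma wsign_loop: "wsign x (u @ (i, s) # (i, \<not> s) # v) = (wsign x (u @ v) :: 'k::comm_ring_1)"
proof -
  have st: "step (i, \<not> s) (step (i, s) y) = y" for y using step_inverse[of i "\<not> s" y] by simp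
  have ep: "asign y i * (asign (step (i, s) y) i * c) = c" for y and c :: 'k
    by (simp add: asign_step asign_square flip: mult.assoc)
  show ?thesis by (simp only: wsign_append wsign.simps fst_conv ep st)
qed

lemma path_mult_minus_left: "path_mult Q (f - g) h = path_mult Q f h - path_mult Q g h"
  using path_mult_add_left[of Q "f - g" g h] by (simp add: algebra_simps)

lemma path_mult_minus_right: "path_mult Q h (f - g) = path_mult Q h f - path_mult Q h g"
  using path_mult_add_right[of Q h "f - g" g] by (simp add: algebra_simps)

lemma loops_wpath_mult: "path_mult (U_quiver r) (loops x i) (wpath y v) =
    (if x = y then wpath x ((i, False) # (i, True) # v) + wpath x ((i, True) # (i, False) # v) else 0)"
  using step_inverse[of i True x] step_inverse[of i False x]
  by (simp add: loops_def path_mult_add_left wpath_mult)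

text \<open>Multiplication by \<open>wsign\<close> is the rescaling of the arrows: it turns
  functionals on the path algebra that kill the relations into compatible ones. Words that are not
  valid do not give paths and are sent to 0.\<close>

lemma compat_gauge:
  fixes \<mu> :: "'k::field U_path_elem \<Rightarrow> 'k"
  assumes x: "x \<in> Zlat r"
    and add: "\<And>f g. \<mu> (f + g) = \<mu> f + \<mu> g"
    and rel: "\<And>\<rho> f g. \<rho> \<in> U_relations r \<Longrightarrow> f \<in> alg_carrier (PA r) \<Longrightarrow> g \<in> alg_carrier (PA r) \<Longrightarrow>
      \<mu> (path_mult (U_quiver r) f (path_mult (U_quiver r) \<rho> g)) = 0"
  shows "compat r (\<lambda>w. if valid r w then wsign x w * \<mu> (wpath x w) else 0)"
proof (rule compatI)
  fix u v i j assume ij: "i \<in> {1..r}" "j \<in> {1..r}"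
  define h where "h i = \<mu> (wpath x (u @ (i, False) # (i, True) # v)) +
    \<mu> (wpath x (u @ (i, True) # (i, False) # v))" for i
  have hij: "h i = h j" if uv: "valid r u" "valid r v"
  proof -
    \<comment> \<open>The relations compare only loops with consecutive indices; a chain of them
      relates \<open>i\<close> and \<open>j\<close>.\<close>
    have step: "h (Suc k) = h k" if k: "1 \<le> k" "k < r" for k
    proof -
      let ?y = "endp x u"
      have y: "?y \<in> Zlat r" by (rule endp_Zlat[OF x uv(1)])
      have r: "(loops ?y k - loops ?y (Suc k) :: 'k U_path_elem) \<in> U_relations r" unfolding
        U_relations_eq using y k by auto
      have z: "\<mu> (path_mult (U_quiver r) (wpath x u) (path_mult (U_quiver r) (loops ?y k - loops ?y
        (Suc k)) (wpath ?y v))) = 0"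
        by (rule rel[OF r PA_wpath[OF x uv(1)] PA_wpath[OF y uv(2)]])
      let ?f = "\<lambda>k. wpath x (u @ (k, False) # (k, True) # v) +
        wpath x (u @ (k, True) # (k, False) # v) :: 'k U_path_elem"
      have "path_mult (U_quiver r) (wpath x u) (path_mult (U_quiver r) (loops ?y k - loops ?y
        (Suc k)) (wpath ?y v)) = ?f k - ?f (Suc k)"
        by (simp add: path_mult_minus_left path_mult_minus_right loops_wpath_mult
          path_mult_add_right wpath_mult)
      then have "\<mu> (?f k - ?f (Suc k)) = 0" using z by simp
      then have "\<mu> (?f k) = \<mu> (?f (Suc k))" using add[of "?f k - ?f (Suc k)" "?f (Suc k)"] by simp
      then show ?thesis unfolding h_def add by simp
    qed
    have hk: "h k = h 1" if "1 \<le> k" "k \<le> r" for k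
      using that
    proof (induction k rule: dec_induct)
      case (step n)
      then show ?case using \<open>\<And>k. 1 \<le> k \<Longrightarrow> k < r \<Longrightarrow> h (Suc k) = h k\<close>[of n] by simp
    qed simp
    show ?thesis using hk[of i] hk[of j] ij by simp
  qed
  show "(if valid r (u @ (i, True) # (i, False) # v) then wsign x (u @ (i, True) #
    (i, False) # v) * \<mu> (wpath x (u @ (i, True) # (i, False) # v)) else 0) +
      (if valid r (u @ (i, False) # (i, True) # v) then wsign x (u @ (i, False) #
        (i, True) # v) * \<mu> (wpath x (u @ (i, False) # (i, True) # v)) else 0) =
    (if valid r (u @ (j, True) # (j, False) # v) then wsign x (u @ (j, True) # (j, False) # v) * \<mu>
      (wpath x (u @ (j, True) # (j, False) # v)) else 0) +
      (if valid r (u @ (j, False) # (j, True) # v) then wsign x (u @ (j, False) #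
        (j, True) # v) * \<mu> (wpath x (u @ (j, False) # (j, True) # v)) else 0)"
  proof (cases "valid r u \<and> valid r v")
    case True
    have s: "wsign x (u @ (k, True) # (k, False) # v) = wsign x (u @ v)"
      "wsign x (u @ (k, False) # (k, True) # v) = wsign x (u @ v)" for k
      using wsign_loop[of x u k True v] wsign_loop[of x u k False v] by simp_all
    have "wsign x (u @ v) * h i = wsign x (u @ v) * h j" using hij True by simp
    then show ?thesis using True ij unfolding s h_def by (simp add: distrib_left add.commute)
  qed auto
next
  fix u v and l l' :: "nat \<times> bool" assume d: "fst l \<noteq> fst l'"
  show "(if valid r (u @ l # l' # v) then wsign x (u @ l # l' # v) * \<mu> (wpath x
    (u @ l # l' # v)) else 0) =
    (if valid r (u @ l' # l # v) then wsign x (u @ l' # l # v) * \<mu> (wpath x (u @ l' # l # v)) else 0)"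
  proof (cases "valid r (u @ l # l' # v)")
    case True
    then have uv: "valid r u" "valid r v" "fst l \<in> {1..r}" "fst l' \<in> {1..r}" by auto
    let ?y = "endp x u"
    let ?z = "step l' (step l ?y)"
    have y: "?y \<in> Zlat r" by (rule endp_Zlat[OF x uv(1)])
    have z: "?z \<in> Zlat r" using y uv by (auto intro!: step_Zlat)
    have zz: "step l (step l' ?y) = ?z" by (rule step_commute[OF d])
    have r: "(wpath ?y [l, l'] + wpath ?y [l', l] :: 'k U_path_elem) \<in> U_relations r" unfolding
      U_relations_eq using y uv d by blast
    have "\<mu> (path_mult (U_quiver r) (wpath x u) (path_mult (U_quiver r) (wpath ?y [l, l'] +
      wpath ?y [l', l]) (wpath ?z v))) = 0"
      by (rule rel[OF r PA_wpath[OF x uv(1)] PA_wpath[OF z uv(2)]])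
    then have "\<mu> (wpath x (u @ l # l' # v) + wpath x (u @ l' # l # v)) = 0"
      by (simp add: path_mult_add_left path_mult_add_right wpath_mult zz)
    then have "\<mu> (wpath x (u @ l # l' # v)) =
      - \<mu> (wpath x (u @ l' # l # v))" unfolding add by (simp add: eq_neg_iff_add_eq_0)
    then show ?thesis using wsign_swap[OF d, of x u v, where 'k = 'k] uv by simp
  qed auto
next
  fix u v and l :: "nat \<times> bool"
  show "(if valid r (u @ l # l # v) then wsign x (u @ l # l # v) * \<mu> (wpath x
    (u @ l # l # v)) else 0) = 0"
  proof (cases "valid r (u @ l # l # v)")
    case True
    then have uv: "valid r u" "valid r v" "fst l \<in> {1..r}" by auto
    let ?y = "endp x u"
    let ?z = "step l (step l ?y)"
    have y: "?y \<in> Zlat r" by (rule endp_Zlat[OF x uv(1)])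
    have z: "?z \<in> Zlat r" using y uv by (auto intro!: step_Zlat)
    have r: "(wpath ?y [l, l] :: 'k U_path_elem) \<in> U_relations r" unfolding U_relations_eq
      using y uv by blast
    have "\<mu> (path_mult (U_quiver r) (wpath x u) (path_mult (U_quiver r) (wpath ?y [l, l])
      (wpath ?z v))) = 0"
      by (rule rel[OF r PA_wpath[OF x uv(1)] PA_wpath[OF z uv(2)]])
    then show ?thesis by (simp add: wpath_mult)
  qed auto
qed

section \<open>The form on the path algebra\<close>

definition ptrace :: "nat \<Rightarrow> (nat \<Rightarrow> int) set \<Rightarrow> (nat \<Rightarrow> int, arrow) qpath \<Rightarrow> 'k::field" where
  "ptrace r D p = (let x = fst p; w = map letter (snd p) in
     if endp x w = x \<and> length w = 2 * (r - 1) then wsign x w * ctrace r D x w else 0)"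

definition beta :: "nat \<Rightarrow> (nat \<Rightarrow> int) set \<Rightarrow> 'k::field U_path_elem \<Rightarrow> 'k U_path_elem \<Rightarrow> 'k" where
  "beta r D f g = lin_ext (ptrace r D) (path_mult (U_quiver r) f g)"

lemma lin_ext_ptrace_wpath:
  "lin_ext (ptrace r D) (wpath x w) = (if endp x w = x \<and>
    length w = 2 * (r - 1) then wsign x w * ctrace r D x w else 0)"
  by (simp add: wpath_def ptrace_def Let_def)

lemma single_wpath:
  assumes "p \<in> qpaths (U_quiver r)"
  obtains x w where "x \<in> Zlat r" "valid r w" "Poly_Mapping.single p c =
    Poly_Mapping.map ((*) c) (wpath x w)"
proof -
  obtain x a where p: "p = (x, a)" by (cases p)
  then obtain w where w: "x \<in> Zlat r" "valid r w" "a =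
    arrows_of x w" using assms by (auto simp: qpaths_U)
  show ?thesis by (rule that[OF w(1,2)]) (simp add: p w(3) wpath_def scale_single)
qed

lemma beta_add: "beta r D (f + g) h = beta r D f h + beta r D g h" "beta r D h (f + g) =
    beta r D h f + beta r D h g"
  by (simp_all add: beta_def path_mult_add_left path_mult_add_right lin_ext_add)

lemma beta_scale: "beta r D (Poly_Mapping.map ((*) c) f) h = c * beta r D f h"
  "beta r D h (Poly_Mapping.map ((*) c) f) = c * beta r D h f"
  by (simp_all add: beta_def path_mult_scale_left path_mult_scale_right lin_ext_scale)

lemma beta_zero [simp]: "beta r D 0 h = 0" "beta r D h 0 = 0"
  by (simp_all add: beta_def)

lemma beta_bilinear: "alg_bilinear_form (PA r) (beta r D)"
  by (simp add: alg_bilinear_form_def beta_add beta_scale)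

lemma beta_associative: "alg_associative_form (PA r) (beta r D)"
  by (simp add: alg_associative_form_def beta_def path_mult_assoc)

lemma beta_wpath: "beta r D (wpath x u) (wpath y v) = (if endp x u = y \<and> endp y v = x \<and>
    length u + length v = 2 * (r - 1)
    then wsign x u * wsign y v * ctrace r D x (u @ v) else 0)"
  by (auto simp: beta_def wpath_mult lin_ext_ptrace_wpath wsign_append)

text \<open>By bilinearity it suffices to compare two paths, where this is
  \<open>ctrace_cyclic\<close>.\<close>

lemma beta_symmetric: "alg_symmetric_form (PA r) (beta r D)"
  unfolding alg_symmetric_form_def
proof (intro ballI)
  fix f g :: "'a U_path_elem" assume "f \<in> alg_carrier (PA r)" "g \<in> alg_carrier (PA r)"
  then have k: "Poly_Mapping.keys f \<subseteq> qpaths (U_quiver r)" "Poly_Mapping.keys g \<subseteq> qpaths (U_quiver r)"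
    by (simp_all add: PA_carrier)
  show "beta r D f g = beta r D g f"
  proof (induction f rule: poly_mapping_additive_induct)
    case (2 p c)
    obtain x u where p: "x \<in> Zlat r" "valid r u" "Poly_Mapping.single p c =
      Poly_Mapping.map ((*) c) (wpath x u)"
      using single_wpath k 2 by (metis subsetD)
    show ?case
    proof (induction g rule: poly_mapping_additive_induct)
      case (2 q d)
      obtain y v where q: "y \<in> Zlat r" "valid r v" "Poly_Mapping.single q d =
        Poly_Mapping.map ((*) d) (wpath y v)"
        using single_wpath k 2 by (metis subsetD)
      have "beta r D (wpath x u) (wpath y v) = (beta r D (wpath y v) (wpath x u) :: 'a)"
        using ctrace_cyclic[OF p(1,2) q(2), of y D] by (auto simp: beta_wpath mult.commute add.commute)
      then show ?case unfolding p(3) q(3) beta_scale by (simp add: mult_ac)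
    qed (simp_all add: beta_add)
  qed (simp_all add: beta_add)
qed

text \<open>The factor \<open>wsign\<close> in the form translates between the relations with signs
  and the sign-free ones of \<open>ctrace\<close>: an anticommutator pairs to zero because its two
  words have opposite signs and equal traces.\<close>

lemma beta_relations:
  fixes \<rho> :: "'k::field U_path_elem"
  assumes r: "1 \<le> r" and \<rho>: "\<rho> \<in> U_relations r" and g: "g \<in> alg_carrier (PA r)"
  shows "beta r D \<rho> g = 0"
proof (induction g rule: poly_mapping_additive_induct)
  case (2 p c)
  obtain y v where p: "y \<in> Zlat r" "valid r v" "Poly_Mapping.single p c =
    Poly_Mapping.map ((*) c) (wpath y v)"
    using single_wpath g 2 unfolding PA_carrier by (metis (no_types, lifting) mem_Collect_eq subsetD)
  have "beta r D \<rho> (wpath y v) = 0"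
    using \<rho> unfolding U_relations_eq
  proof (elim UnE CollectE exE conjE)
    fix x l assume "\<rho> = wpath x [l, l]"
    moreover have "ctrace r D x (l # l # v) = (0 :: 'k)"
      using compat_square[OF compat_ctrace, of r D x "[]" l v] by simp
    ultimately show ?thesis by (simp add: beta_wpath)
  next
    fix x l l' assume *: "\<rho> = wpath x [l, l'] + wpath x [l', l]" "fst l \<noteq> fst l'" "fst l \<in> {1..r}"
      "fst l' \<in> {1..r}"
    have "wsign x [l, l'] = - (wsign x [l', l] :: 'k)"
      using wsign_swap[OF *(2), of x "[]" "[]"] *(3,4) by simp
    moreover have "ctrace r D x (l # l' # v) = (ctrace r D x (l' # l # v) :: 'k)"
      using compat_swap[OF compat_ctrace *(2), of r D x "[]" v] by simp
    ultimately show ?thesis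
      by (simp add: *(1) beta_add beta_wpath step_commute[OF *(2), of x] del: wsign.simps)
  next
    fix x i assume *: "\<rho> = loops x i - loops x (i + 1)" "1 \<le> i" "i < r"
    \<comment> \<open>Inserting a loop leaves \<open>wsign\<close> and the total trace unchanged, so
      the value does not involve \<open>k\<close>.\<close>
    have lpk: "beta r D (loops x k) (wpath y v) =
      (if x = y \<and> endp x v = x \<and> length v + 2 =
        2 * (r - 1) then wsign x v * ctrace r D x v else 0 :: 'k)"
      if k: "k \<in> {1..r}" for k
    proof -
      have s: "wsign x [(k, True), (k, False)] = (1 :: 'k)" "wsign x [(k, False), (k, True)] =
        (1 :: 'k)"
        using wsign_loop[of x "[]" k True "[]"] wsign_loop[of x "[]" k False "[]"] by simp_all
      have e: "endp x [(k, True), (k, False)] = x" "endp x [(k, False), (k, True)] = x"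
        using step_inverse[of k True x] step_inverse[of k False x] by simp_all
      have t: "ctrace r D x ([(k, False), (k, True)] @ v) +
        ctrace r D x ([(k, True), (k, False)] @ v) = (ctrace r D x v :: 'k)"
        using ctrace_loop[OF k, of D x "[]" v] by (simp add: add.commute)
      show ?thesis unfolding loops_def beta_add beta_wpath e s t[symmetric]
        by (auto simp: distrib_left)
    qed
    have "i \<in> {1..r}" "i + 1 \<in> {1..r}" using *(2,3) by simp_all
    then have "beta r D (loops x i) (wpath y v) = (beta r D (loops x (i + 1)) (wpath y v) :: 'k)"
      by (simp only: lpk)
    then show ?thesis
      using beta_add(1)[of r D "loops x i - loops x (i + 1) :: 'k U_path_elem" "loops x (i + 1)"
        "wpath y v"] by (simp add: *(1))
  qed
  then show ?case by (simp add: p(3) beta_scale)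
qed (simp_all add: beta_add)

lemma beta_vertex:
  fixes g :: "'k::field U_path_elem"
  assumes r: "1 \<le> r" and D: "down_closed r D" and x: "x \<in> Zlat r - (D - shift r (- 1) ` D)"
    and g: "g \<in> alg_carrier (PA r)"
  shows "beta r D (path_e x) g = 0"
proof (induction g rule: poly_mapping_additive_induct)
  case (2 p c)
  obtain y v where p: "y \<in> Zlat r" "valid r v" "Poly_Mapping.single p c =
    Poly_Mapping.map ((*) c) (wpath y v)"
    using single_wpath g 2 unfolding PA_carrier by (metis (no_types, lifting) mem_Collect_eq subsetD)
  have "ctrace r D x v = (0 :: 'k)" if "endp x v = x" "length v = 2 * (r - 1)"
    using ctrace_vanishes[OF r D _ _ p(2) that] x by simp
  then have "beta r D (wpath x []) (wpath y v) = (0 :: 'k)" by (auto simp: beta_wpath)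
  then show ?case by (simp add: p(3) beta_scale path_ab_wpath)
qed (simp_all add: beta_add)

section \<open>The radical is contained in the kernel\<close>

lemma separating_functional:
  fixes J :: "('a \<Rightarrow>\<^sub>0 'k::field) set"
  assumes J: "0 \<in> J" "\<And>f g. f \<in> J \<Longrightarrow> g \<in> J \<Longrightarrow> f + g \<in> J" "\<And>c f. f \<in> J \<Longrightarrow> Poly_Mapping.map ((*) c) f \<in> J"
    and f: "f \<notin> J"
  obtains \<mu> :: "('a \<Rightarrow>\<^sub>0 'k) \<Rightarrow> 'k" where "\<And>f g. \<mu> (f + g) =
    \<mu> f + \<mu> g" "\<And>c f. \<mu> (Poly_Mapping.map ((*) c) f) = c * \<mu> f"
    "\<And>f. f \<in> J \<Longrightarrow> \<mu> f = 0" "\<mu> f \<noteq> 0"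
proof -
  interpret vector_space_pair "\<lambda>c. Poly_Mapping.map ((*) (c :: 'k)) :: ('a \<Rightarrow>\<^sub>0 'k) \<Rightarrow> _"
    "(*) :: 'k \<Rightarrow> 'k \<Rightarrow> 'k"
    by unfold_locales (auto intro!: poly_mapping_eqI simp: lookup_scale lookup_add algebra_simps)
  have sub: "vs1.subspace J" using J by (auto simp: vs1.subspace_def)
  \<comment> \<open>\<open>B\<close> is a basis of \<open>J\<close>. It stays independent after
    adding \<open>f\<close>, so a linear map can be prescribed as 0 on \<open>B\<close> and 1 at
    \<open>f\<close>, in any dimension.\<close>
  obtain B where B: "B \<subseteq> J" "vs1.independent B" "J \<subseteq> vs1.span B"
    using vs1.maximal_independent_subset by blast
  have "vs1.span B \<subseteq> J" using vs1.span_minimal[OF B(1) sub] .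
  then have fB: "f \<notin> vs1.span B" using f by blast
  then have "vs1.independent (insert f B)" using B(2) by (rule vs1.independent_insertI)
  from linear_independent_extend[OF this, of "\<lambda>x. if x = f then 1 else 0"] obtain \<mu>
    where \<mu>: "Vector_Spaces.linear (\<lambda>c. Poly_Mapping.map ((*) c)) (*) \<mu>" "\<forall>x\<in>insert f B. \<mu> x =
      (if x = f then 1 else 0)" by blast
  show ?thesis
  proof (rule that[of \<mu>])
    show "\<mu> (f + g) = \<mu> f + \<mu> g" for f g by (rule linear_add[OF \<mu>(1)])
    show "\<mu> (Poly_Mapping.map ((*) c) f) = c * \<mu> f" for c f by (rule linear_scale[OF \<mu>(1)])
    show "\<mu> g = 0" if "g \<in> J" for g
    proof (rule linear_eq_0_on_span[OF \<mu>(1)])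
      show "\<mu> b = 0" if "b \<in> B" for b using \<mu>(2) that fB vs1.span_base by fastforce
      show "g \<in> vs1.span B" using that B(3) by blast
    qed
    show "\<mu> f \<noteq> 0" using \<mu>(2) by simp
  qed
qed

lemma functional_eq_lin_ext:
  fixes \<mu> :: "('a \<Rightarrow>\<^sub>0 'k::field) \<Rightarrow> 'k"
  assumes "\<And>f g. \<mu> (f + g) = \<mu> f + \<mu> g" "\<And>c f. \<mu> (Poly_Mapping.map ((*) c) f) = c * \<mu> f"
  shows "\<mu> f = lin_ext (\<lambda>k. \<mu> (Poly_Mapping.single k 1)) f"
proof (induction f rule: poly_mapping_additive_induct)
  case 1
  have "\<mu> 0 + \<mu> 0 = \<mu> 0" using assms(1)[of 0 0] by simp
  then have "\<mu> 0 = 0" by (simp only: add_cancel_left_right)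
  then show ?case by simp
next
  case (2 k c)
  show ?case using assms(2)[of c "Poly_Mapping.single k 1"] by (simp add: scale_single)
qed (simp add: assms lin_ext_add)

text \<open>The vertex ideal is defined only as a span; it is an ideal because associativity turns a
  multiple of u e_x v into another product of this shape.\<close>

lemma U_alg_ideals:
  fixes r :: nat and X :: "(nat \<Rightarrow> int) set"
  defines "S \<equiv> (\<Union>x\<in>Zlat r - X. {alg_mult (U_alg r) (alg_mult (U_alg r) u (U_e r x)) v | u v.
             u \<in> alg_carrier (U_alg r) \<and> v \<in> alg_carrier (U_alg r)}) :: 'k::field U_path_elem set set"
  shows "nu_alg_ideal (PA r) (U_ideal r :: 'k U_path_elem set)" "nu_alg (U_alg r :: ('k, _) nu_algebra)"
    "S \<subseteq> alg_carrier (U_alg r)" "nu_alg_ideal (U_alg r) (alg_span (U_alg r) S)"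
proof -
  interpret P: nu_alg "PA r :: ('k, _) nu_algebra" by (rule nu_alg_PA)
  have R: "U_relations r \<subseteq> alg_carrier (PA r :: ('k, _) nu_algebra)"
  proof
    fix \<rho> :: "'k U_path_elem" assume "\<rho> \<in> U_relations r"
    then show "\<rho> \<in> alg_carrier (PA r)" unfolding U_relations_eq
    proof (elim UnE CollectE exE conjE)
      fix x i assume *: "\<rho> = loops x i - loops x (i + 1)" "x \<in> Zlat r" "1 \<le> i" "i < r"
      have l: "(loops x k :: 'k U_path_elem) \<in> alg_carrier (PA r)" if "k \<in> {1..r}" for k
        unfolding loops_def by (intro PA_add PA_wpath) (use *(2) that in auto)
      have "(loops x i + Poly_Mapping.map ((*) (- 1)) (loops x (i +
        1)) :: 'k U_path_elem) \<in> alg_carrier (PA r)"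
        by (intro PA_add PA_scale l) (use * in auto)
      moreover have "loops x i + Poly_Mapping.map ((*) (- 1)) (loops x (i + 1)) = \<rho>"
        by (rule poly_mapping_eqI) (simp add: *(1) lookup_add lookup_scale lookup_minus)
      ultimately show ?thesis by simp
    qed (auto intro!: PA_add PA_wpath)
  qed
  show I: "nu_alg_ideal (PA r) (U_ideal r :: 'k U_path_elem set)"
    unfolding U_ideal_def by unfold_locales (rule P.genideal_ideal[OF R])
  interpret I: nu_alg_ideal "PA r" "U_ideal r :: 'k U_path_elem set" by (rule I)
  show U: "nu_alg (U_alg r :: ('k, _) nu_algebra)"
    unfolding U_alg_def by (rule I.quotient_nu_alg)
  interpret U: nu_alg "U_alg r :: ('k, _) nu_algebra" by (rule U)
  have e: "(U_e r x :: 'k U_path_elem set) \<in> alg_carrier (U_alg r)" if "x \<in> Zlat r" for x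
    unfolding U_e_def U_alg_def I.quotient_carrier path_ab_wpath by (intro imageI PA_wpath that) simp
  show S: "S \<subseteq> alg_carrier (U_alg r)"
    unfolding S_def using e U.mult_closed by blast
  show "nu_alg_ideal (U_alg r) (alg_span (U_alg r) S)"
  proof unfold_locales
    show "alg_ideal (U_alg r) (alg_span (U_alg r) S)"
    proof (rule U.span_ideal[OF S])
      fix a s :: "'k U_path_elem set" assume a: "a \<in> alg_carrier (U_alg r)" and "s \<in> S"
      then obtain x u v where s: "x \<in> Zlat r - X" "u \<in> alg_carrier (U_alg r)"
        "v \<in> alg_carrier (U_alg r)"
        "s = alg_mult (U_alg r) (alg_mult (U_alg r) u (U_e r x)) v" unfolding S_def by blast
      have ex: "(U_e r x :: 'k U_path_elem set) \<in> alg_carrier (U_alg r)" using e s(1) by blast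
      have m: "alg_mult (U_alg r) u (U_e r x) \<in> alg_carrier (U_alg r)"
        by (rule U.mult_closed[OF s(2) ex])
      have "alg_mult (U_alg r) a s = alg_mult (U_alg r) (alg_mult (U_alg r) (alg_mult
        (U_alg r) a u) (U_e r x)) v"
        unfolding s(4) U.mult_assoc[OF a s(2) ex] U.mult_assoc[OF a m s(3)] ..
      moreover have "alg_mult (U_alg r) s a =
        alg_mult (U_alg r) (alg_mult (U_alg r) u (U_e r x)) (alg_mult (U_alg r) v a)"
        unfolding s(4) by (rule U.mult_assoc[OF m s(3) a])
      moreover have "alg_mult (U_alg r) a u \<in> alg_carrier (U_alg r)"
        "alg_mult (U_alg r) v a \<in> alg_carrier (U_alg r)"
        using U.mult_closed a s by blast+
      ultimately show "alg_mult (U_alg r) a s \<in> S \<and> alg_mult (U_alg r) s a \<in> S"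
        unfolding S_def using s by blast
    qed
  qed
qed

text \<open>A linear functional separating \<open>f\<close> from the kernel would be compatible
  after rescaling and would kill all paths through vertices outside \<open>X\<close>; by
  \<open>radical_annihilated\<close> it would then kill \<open>f\<close> as well.\<close>

lemma beta_nondegenerate:
  fixes f :: "'k::field U_path_elem"
  assumes r: "1 \<le> r" and D: "down_closed r D" and X: "X = D - shift r (- 1) ` D"
    and f: "f \<in> alg_carrier (PA r)" and rad: "\<And>g. g \<in> alg_carrier (PA r) \<Longrightarrow> beta r D f g = 0"
  shows "alg_coset (PA r) (U_ideal r) f \<in> U_vertex_ideal r X"
proof (rule ccontr)
  assume nf: "\<not> ?thesis"
  let ?S = "(\<Union>x\<in>Zlat r - X. {alg_mult (U_alg r) (alg_mult (U_alg r) u (U_e r x)) v | u v.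
             u \<in> alg_carrier (U_alg r) \<and> v \<in> alg_carrier (U_alg r)}) :: 'k U_path_elem set set"
  interpret P: nu_alg "PA r :: ('k, _) nu_algebra" by (rule nu_alg_PA)
  interpret I: nu_alg_ideal "PA r" "U_ideal r :: 'k U_path_elem set" by (rule U_alg_ideals)
  interpret V: nu_alg_ideal "U_alg r" "U_vertex_ideal r X :: 'k U_path_elem set set"
    unfolding U_vertex_ideal_def by (rule U_alg_ideals)
  let ?co = "alg_coset (PA r) (U_ideal r :: 'k U_path_elem set)"
  note q = I.quotient_simps[folded U_alg_def, unfolded PA_simps]
  \<comment> \<open>The kernel of the composite map from the path algebra to the quotient, so that
    the functional can be evaluated on single paths.\<close>
  define J where "J = {h \<in> alg_carrier (PA r). ?co h \<in> U_vertex_ideal r X}"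
  have J0: "0 \<in> J"
    using V.I_D(2) PA_zero I.quotient_zero by (simp add: J_def U_alg_def)
  have Ja: "g + h \<in> J" if "g \<in> J" "h \<in> J" for g h
    using that V.I_D(3)[of "?co g" "?co h"] PA_add unfolding J_def by (auto simp: q(1))
  have Js: "Poly_Mapping.map ((*) c) h \<in> J" if "h \<in> J" for c h
    using that V.I_D(4)[of "?co h" c] PA_scale unfolding J_def by (auto simp: q(3))
  have fJ: "f \<notin> J" using nf by (simp add: J_def)
  obtain \<mu> :: "'k U_path_elem \<Rightarrow> 'k" where \<mu>: "\<And>f g. \<mu> (f + g) = \<mu> f + \<mu> g"
    "\<And>c f. \<mu> (Poly_Mapping.map ((*) c) f) = c * \<mu> f" "\<And>f. f \<in> J \<Longrightarrow> \<mu> f = 0" "\<mu> f \<noteq> 0"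
    using separating_functional[OF J0 Ja Js fJ] by blast
  have IJ: "h \<in> J" if "h \<in> U_ideal r" for h
    using that V.I_D(2) I.coset_eq_zero_iff[of h] I.I_D(1)[of h] I.quotient_zero
    by (simp add: J_def U_alg_def)
  have rel: "\<mu> (path_mult (U_quiver r) g (path_mult (U_quiver r) \<rho> h)) = 0"
    if "\<rho> \<in> U_relations r" "g \<in> alg_carrier (PA r)" "h \<in> alg_carrier (PA r)" for \<rho> g h
  proof -
    have "\<rho> \<in> U_ideal r" using that(1) P.genideal_contains unfolding U_ideal_def by blast
    then have "path_mult (U_quiver r) \<rho> h \<in> U_ideal r" using I.I_mult[OF that(3)] by simp
    then have "path_mult (U_quiver r) g (path_mult (U_quiver r) \<rho> h) \<in> U_ideal r"
      using I.I_mult[OF that(2)] by simp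
    then show ?thesis using \<mu>(3) IJ by blast
  qed
  \<comment> \<open>The path equals u e v with the idempotent e at the end of \<open>u\<close>,
    hence lies in \<open>J\<close>.\<close>
  have van: "\<mu> (wpath x (u @ v)) = 0"
    if x: "x \<in> Zlat r" and uv: "valid r u" "valid r v" "endp x u \<notin> X" for x u v
  proof -
    let ?y = "endp x u"
    have y: "?y \<in> Zlat r" by (rule endp_Zlat[OF x uv(1)])
    have c: "(wpath x u :: 'k U_path_elem) \<in> alg_carrier (PA r)"
      "(wpath ?y [] :: 'k U_path_elem) \<in> alg_carrier (PA r)"
      "(wpath ?y v :: 'k U_path_elem) \<in> alg_carrier (PA r)"
      using x y uv by (auto intro!: PA_wpath)
    have cc: "?co (wpath x u) \<in> alg_carrier (U_alg r)" "?co (wpath ?y v) \<in> alg_carrier (U_alg r)"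
      using c unfolding U_alg_def I.quotient_carrier by blast+
    have "path_mult (U_quiver r) (wpath x u) (wpath ?y []) =
      (wpath x u :: 'k U_path_elem)" by (simp add: wpath_mult)
    moreover have "path_mult (U_quiver r) (wpath x u) (wpath ?y v) =
      (wpath x (u @ v) :: 'k U_path_elem)" by (simp add: wpath_mult)
    ultimately have "alg_mult (U_alg r) (alg_mult (U_alg r) (?co (wpath x u)) (U_e r ?y)) (?co
      (wpath ?y v)) = ?co (wpath x (u @ v))"
      unfolding U_e_def path_ab_wpath q(2)[OF c(1,2)] by (simp only: q(2)[OF c(1,3)])
    moreover have "alg_mult (U_alg r) (alg_mult (U_alg r) (?co (wpath x u)) (U_e r ?y)) (?co
      (wpath ?y v)) \<in> ?S"
      using cc y uv(3) by blast
    ultimately have "?co (wpath x (u @ v)) \<in> ?S" by (simp only:)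
    then have "?co (wpath x (u @ v)) \<in> U_vertex_ideal r X"
      unfolding U_vertex_ideal_def by (rule subsetD[OF V.span_contains])
    then have "wpath x (u @ v) \<in> J" using PA_wpath[OF x, of "u @ v"] uv by (simp add: J_def)
    then show ?thesis by (rule \<mu>(3))
  qed
  define w where "w k = map letter (snd k)" for k :: "(nat \<Rightarrow> int, arrow) qpath"
  define K where "K = Poly_Mapping.keys f"
  have K: "finite K" "K \<subseteq> qpaths (U_quiver r)" using f by (auto simp: K_def PA_carrier)
  have k: "k = (fst k, arrows_of (fst k) (w k))" "fst k \<in> Zlat r" "valid r (w k)" if "k \<in> K" for k
    using that K(2) qpaths_U[of "fst k" "snd k" r] unfolding w_def by (auto simp: prod_eq_iff)
  have single: "Poly_Mapping.single k 1 = wpath (fst k) (w k)" if "k \<in> K" for k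
    using k(1)[OF that] unfolding wpath_def by simp
  \<comment> \<open>\<open>f\<close> is split by start, end and length. A return path from
    \<open>y\<close> to \<open>x\<close> of the complementary length pairs nontrivially with at most
    one of these pieces, so each piece satisfies the radical condition by itself.\<close>
  define \<kappa> where "\<kappa> k = (fst k, endp (fst k) (w k), length (w k))" for k
  let ?h = "\<lambda>k. Poly_Mapping.lookup f k * \<mu> (Poly_Mapping.single k 1)"
  have "\<mu> f = (\<Sum>k\<in>K. ?h k)"
    using functional_eq_lin_ext[of \<mu> f] \<mu>(1,2) by (simp add: lin_ext_def K_def)
  also have "\<dots> = (\<Sum>t\<in>\<kappa> ` K. \<Sum>k | k \<in> K \<and> \<kappa> k = t. ?h k)"
    by (rule sum.image_gen[OF K(1)])
  also have "\<dots> = 0"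
  proof (rule sum.neutral, rule ballI)
    fix t assume "t \<in> \<kappa> ` K"
    then obtain k0 where k0: "k0 \<in> K" "t = \<kappa> k0" by blast
    define x where "x = fst k0"
    define y where "y = endp x (w k0)"
    define l where "l = length (w k0)"
    have x: "x \<in> Zlat r" using k(2)[OF k0(1)] by (simp add: x_def)
    have y: "y \<in> Zlat r" using endp_Zlat[OF x k(3)[OF k0(1)]] by (simp add: y_def)
    define P where "P = {k. k \<in> K \<and> \<kappa> k = t}"
    have P: "k \<in> P \<longleftrightarrow> k \<in> K \<and> fst k = x \<and> endp x (w k) = y \<and> length (w k) = l" for k
      by (auto simp: P_def k0(2) \<kappa>_def x_def y_def l_def)
    have fP: "finite P" using K by (simp add: P_def)
    let ?g = "\<lambda>w. if valid r w then wsign x w * \<mu> (wpath x w) else 0"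
    \<comment> \<open>The coefficients receive the sign of the path; together with the sign inside
      \<open>?g\<close> it squares to 1.\<close>
    have "(\<Sum>k\<in>P. (Poly_Mapping.lookup f k * wsign x (w k)) * ?g (w k)) = 0"
    proof (rule radical_annihilated[OF r D x fP])
      show "valid r (w k) \<and> endp x (w k) = y \<and> length (w k) = l" if "k \<in> P" for k
        using that k(3) by (simp add: P)
      show "compat r ?g" by (rule compat_gauge[OF x \<mu>(1) rel])
      show "?g (u @ v) = 0" if "valid r u" "endp x u \<notin> D - shift r (- 1) ` D" for u v
        using van[OF x that(1) _ that(2)[folded X]] by simp
      fix v assume v: "valid r v" "endp y v = x" "l + length v = 2 * (r - 1)"
      have "0 = beta r D f (wpath y v)" using rad[OF PA_wpath[OF y v(1)]] by simp
      also have "\<dots> = lin_ext (\<lambda>k. beta r D (Poly_Mapping.single k 1) (wpath y v)) f"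
        by (rule functional_eq_lin_ext) (simp_all add: beta_add beta_scale)
      also have "\<dots> = (\<Sum>k\<in>K. Poly_Mapping.lookup f k * beta r D (Poly_Mapping.single k 1) (wpath y v))"
        by (simp add: lin_ext_def K_def)
      also have "\<dots> = (\<Sum>k\<in>K. if k \<in> P then Poly_Mapping.lookup f k * (wsign x
        (w k) * wsign y v * ctrace r D x (w k @ v)) else 0)"
      proof (rule sum.cong)
        fix k assume kK: "k \<in> K"
        show "Poly_Mapping.lookup f k * beta r D (Poly_Mapping.single k 1) (wpath y v) =
          (if k \<in> P then Poly_Mapping.lookup f k * (wsign x (w k) * wsign y v * ctrace r D x
            (w k @ v)) else 0)"
          unfolding single[OF kK] beta_wpath P using kK v by auto
      qed simp
      also have "\<dots> = (\<Sum>k\<in>P. Poly_Mapping.lookup f k * (wsign x (w k) * wsign y v * ctrace r D x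
        (w k @ v)))"
        unfolding sum.inter_filter[OF K(1), symmetric] by (rule sum.cong) (auto simp: P_def)
      also have "\<dots> = wsign y v * (\<Sum>k\<in>P. Poly_Mapping.lookup f k * wsign x (w k) * ctrace r D x
        (w k @ v))"
        by (simp add: sum_distrib_left mult_ac)
      finally have "wsign y v * wsign y v * (\<Sum>k\<in>P. Poly_Mapping.lookup f k * wsign x
        (w k) * ctrace r D x (w k @ v)) = 0"
        by (simp only: mult.assoc mult_zero_right)
      then show "(\<Sum>k\<in>P. Poly_Mapping.lookup f k * wsign x (w k) * ctrace r D x (w k @ v)) = 0"
        by (simp only: wsign_square mult_1_left)
    qed
    moreover have "(Poly_Mapping.lookup f k * wsign x (w k)) * ?g (w k) = ?h k" if "k \<in> P" for k
    proof -
      have kk: "k \<in> K" "fst k = x" using that by (simp_all add: P)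
      have "(Poly_Mapping.lookup f k * wsign x (w k)) * ?g (w k) =
        Poly_Mapping.lookup f k * (wsign x (w k) * wsign x (w k)) * \<mu> (wpath x (w k))"
        using k(3)[OF kk(1)] by (simp add: mult_ac)
      then show ?thesis unfolding single[OF kk(1)] kk(2) wsign_square by simp
    qed
    ultimately have "(\<Sum>k\<in>P. ?h k) = 0" by (simp cong: sum.cong)
    then show "(\<Sum>k | k \<in> K \<and> \<kappa> k = t. ?h k) = 0" by (simp only: P_def)
  qed
  finally show False using \<mu>(4) by simp
qed

section \<open>Descent of the form through the two quotients\<close>

theorem theorem69:
  fixes r :: nat and X :: "(nat \<Rightarrow> int) set"
  assumes "1 \<le> r" and "cubist r X"
  shows "symmetric_algebra (U_cubist r X :: ('k::field, 'k U_path_elem set set) nu_algebra)"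
proof -
  obtain D where D: "down_closed r D" "X = D - shift r (- 1) ` D"
    using assms(2) by (auto simp: cubist_def)
  interpret P: nu_alg "PA r :: ('k, _) nu_algebra" by (rule nu_alg_PA)
  interpret I: nu_alg_ideal "PA r" "U_ideal r :: 'k U_path_elem set" by (rule U_alg_ideals)
  interpret V: nu_alg_ideal "U_alg r" "U_vertex_ideal r X :: 'k U_path_elem set set"
    unfolding U_vertex_ideal_def by (rule U_alg_ideals)
  have \<beta>: "alg_bilinear_form (PA r) (beta r D :: 'k U_path_elem \<Rightarrow> _)"
    "alg_associative_form (PA r) (beta r D :: 'k U_path_elem \<Rightarrow> _)"
    "alg_symmetric_form (PA r) (beta r D :: 'k U_path_elem \<Rightarrow> _)"
    by (rule beta_bilinear beta_associative beta_symmetric)+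
  \<comment> \<open>The radical is an ideal, so only the relations themselves are tested.\<close>
  have "U_ideal r \<subseteq> {f \<in> alg_carrier (PA r). \<forall>g\<in>alg_carrier (PA r). beta r D f g = (0 :: 'k)}"
    unfolding U_ideal_def
  proof (rule P.genideal_least[OF P.radical_ideal[OF \<beta>]])
    show "U_relations r \<subseteq> {f \<in> alg_carrier (PA r). \<forall>g\<in>alg_carrier (PA r). beta r D f g = (0 :: 'k)}"
      using beta_relations[OF assms(1)] I.I_D(1) P.genideal_contains unfolding U_ideal_def by blast
  qed
  then have "beta r D i b = 0" if "i \<in> U_ideal r" "b \<in> alg_carrier (PA r)" for i b :: "'k U_path_elem"
    using that by blast
  from I.quotient_form[OF \<beta> this] obtain B1 where
    B1: "alg_bilinear_form (U_alg r) B1" "alg_associative_form (U_alg r) B1"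
      "alg_symmetric_form (U_alg r) B1"
      "\<And>a b. a \<in> alg_carrier (PA r) \<Longrightarrow> b \<in> alg_carrier (PA r) \<Longrightarrow>
        B1 (alg_coset (PA r) (U_ideal r) a) (alg_coset (PA r) (U_ideal r) b) = (beta r D a b :: 'k)"
    unfolding U_alg_def by blast
  note rad = V.radical_ideal[OF B1(1-3)]
  let ?N = "{x \<in> alg_carrier (U_alg r). \<forall>b\<in>alg_carrier (U_alg r). B1 x b = 0}"
  \<comment> \<open>Likewise for the vertex ideal: once the idempotents outside \<open>X\<close> lie
    in the radical, so do all products u e_x v.\<close>
  have e: "U_e r x \<in> ?N" if x: "x \<in> Zlat r - X" for x
  proof -
    have ex: "(path_e x :: 'k U_path_elem) \<in> alg_carrier (PA r)"
      unfolding path_ab_wpath by (intro PA_wpath) (use x in auto)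
    have "B1 (U_e r x) b = 0" if b: "b \<in> alg_carrier (U_alg r)" for b
    proof -
      obtain g where g: "g \<in> alg_carrier (PA r)" "b = alg_coset (PA r) (U_ideal r) g"
        using b unfolding U_alg_def I.quotient_carrier by blast
      show ?thesis unfolding U_e_def g(2) B1(4)[OF ex g(1)]
        by (rule beta_vertex[OF assms(1) D(1) _ g(1)]) (use x D(2) in simp)
    qed
    moreover have "(U_e r x :: 'k U_path_elem set) \<in> alg_carrier (U_alg r)"
      unfolding U_e_def U_alg_def I.quotient_carrier using ex by (rule imageI)
    ultimately show ?thesis by blast
  qed
  have "U_vertex_ideal r X \<subseteq> ?N"
    unfolding U_vertex_ideal_def
  proof (rule V.span_least)
    show "alg_subspace (U_alg r) ?N" using rad by (simp only: alg_ideal_def)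
    have "alg_mult (U_alg r) (alg_mult (U_alg r) u (U_e r x)) v \<in> ?N"
      if "x \<in> Zlat r - X" "u \<in> alg_carrier (U_alg r)" "v \<in> alg_carrier (U_alg r)" for x u v
      using rad e[OF that(1)] that(2,3) unfolding alg_ideal_def by blast
    then show "(\<Union>x\<in>Zlat r - X. {alg_mult (U_alg r) (alg_mult (U_alg r) u (U_e r x)) v | u v.
             u \<in> alg_carrier (U_alg r) \<and> v \<in> alg_carrier (U_alg r)}) \<subseteq> ?N" by blast
  qed
  then have "B1 i b = 0" if "i \<in> U_vertex_ideal r X" "b \<in> alg_carrier (U_alg r)" for i b
    using that by blast
  from V.quotient_form[OF B1(1-3) this] obtain B2 where
    B2: "alg_bilinear_form (U_cubist r X) B2" "alg_associative_form (U_cubist r X) B2"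
      "alg_symmetric_form (U_cubist r X) B2"
      "\<And>a b. a \<in> alg_carrier (U_alg r) \<Longrightarrow> b \<in> alg_carrier (U_alg r) \<Longrightarrow>
        B2 (alg_coset (U_alg r) (U_vertex_ideal r X) a) (alg_coset (U_alg r)
          (U_vertex_ideal r X) b) = B1 a b"
    unfolding U_cubist_def by blast
  \<comment> \<open>Both descents preserve values on representatives, so a radical element lifts to
    a radical element of the path algebra, where \<open>beta_nondegenerate\<close> applies.\<close>
  have nd: "a = alg_zero (U_cubist r X)"
    if a: "a \<in> alg_carrier (U_cubist r X)" and z: "\<And>b. b \<in> alg_carrier (U_cubist r X) \<Longrightarrow>
      B2 a b = 0" for a
  proof -
    obtain c where c: "c \<in> alg_carrier (U_alg r)" "a = alg_coset (U_alg r) (U_vertex_ideal r X) c"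
      using a unfolding U_cubist_def V.quotient_carrier by blast
    obtain f where f: "f \<in> alg_carrier (PA r)" "c = alg_coset (PA r) (U_ideal r) f"
      using c(1) unfolding U_alg_def I.quotient_carrier by blast
    have "beta r D f g = 0" if g: "g \<in> alg_carrier (PA r)" for g
    proof -
      have g': "alg_coset (PA r) (U_ideal r) g \<in> alg_carrier (U_alg r)"
        unfolding U_alg_def I.quotient_carrier using g by (rule imageI)
      then have "alg_coset (U_alg r) (U_vertex_ideal r X) (alg_coset (PA r)
        (U_ideal r) g) \<in> alg_carrier (U_cubist r X)"
        unfolding U_cubist_def V.quotient_carrier by (rule imageI)
      from z[OF this] show ?thesis
        unfolding c(2) B2(4)[OF c(1) g'] unfolding f(2) B1(4)[OF f(1) g] .
    qed
    then have "c \<in> U_vertex_ideal r X"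
      unfolding f(2) by (rule beta_nondegenerate[OF assms(1) D f(1)])
    then show ?thesis
      unfolding c(2) U_cubist_def V.quotient_zero using V.coset_eq_zero_iff[OF c(1)] by blast
  qed
  have "alg_nondegenerate_form (U_cubist r X) B2"
    unfolding alg_nondegenerate_form_def
  proof (intro conjI ballI impI)
    fix b assume b: "b \<in> alg_carrier (U_cubist r X)" and z: "\<forall>a\<in>alg_carrier (U_cubist r X). B2 a b = 0"
    show "b = alg_zero (U_cubist r X)"
      by (rule nd[OF b]) (use z b B2(3) in \<open>auto simp: alg_symmetric_form_def\<close>)
  qed (use nd in blast)
  then show ?thesis unfolding symmetric_algebra_def using B2(1-3) by blast
qed

end
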